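(* Let $H$ be a graph that is $3$-connected or isomorphic to $K_3$, and let $q>r\ge 2$ be integers. Then for every $F\in\mathcal{M}_r(H)$ there are infinitely many (pairwise non-isomorphic) graphs $G\in\mathcal{M}_q(H)$ such that $F$ is (isomorphic to) an induced subgraph of $G$.
   Context: All graphs are finite and simple. For an integer $q\ge 2$, a $q$-colouring of a graph $G$ is a map $E(G)\to[q]=\{1,\dots,q\}$. A graph $G$ is $q$-Ramsey for $H$, written $G\to(H)_q$, if every $q$-colouring of $E(G)$ contains a monochromatic copy of $H$ (a subgraph isomorphic to $H$ all of whose edges have the same colour). $G$ is $q$-Ramsey-minimal for $H$ if $G\to(H)_q$ but no proper subgraph $G'\subsetneq G$ satisfies $G'\to(H)_q$. $\mathcal{M}_q(H)$ denotes the set of all graphs that are $q$-Ramsey-minimal for $H$. *)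

theory Defs
  imports Main "HOL-Library.FuncSet"
begin

text \<open>An edge is its set of two endpoints. The type itself does not enforce this; the
  condition is the predicate \<open>fin_simple_graph\<close>.\<close>

datatype 'a graph = Graph (vertices: "'a set") (edges: "'a set set")

definition fin_simple_graph :: "'a graph \<Rightarrow> bool" where
  "fin_simple_graph G \<longleftrightarrow>
     finite (vertices G) \<and> (\<forall>e\<in>edges G. e \<subseteq> vertices G \<and> card e = 2)"

definition subgraph :: "'a graph \<Rightarrow> 'a graph \<Rightarrow> bool" where
  "subgraph G' G \<longleftrightarrow>
     fin_simple_graph G' \<and> vertices G' \<subseteq> vertices G \<and> edges G' \<subseteq> edges G"

definition proper_subgraph :: "'a graph \<Rightarrow> 'a graph \<Rightarrow> bool" where
  "proper_subgraph G' G \<longleftrightarrow> subgraph G' G \<and> G' \<noteq> G"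

definition induced :: "'a graph \<Rightarrow> 'a set \<Rightarrow> 'a graph" where
  "induced G S = Graph S {e \<in> edges G. e \<subseteq> S}"

definition induced_subgraph :: "'a graph \<Rightarrow> 'a graph \<Rightarrow> bool" where
  "induced_subgraph G' G \<longleftrightarrow> (\<exists>S. S \<subseteq> vertices G \<and> G' = induced G S)"

definition isomorphic :: "'a graph \<Rightarrow> 'b graph \<Rightarrow> bool" where
  "isomorphic G G' \<longleftrightarrow>
     (\<exists>f. bij_betw f (vertices G) (vertices G') \<and>
          (\<forall>u\<in>vertices G. \<forall>v\<in>vertices G. {u, v} \<in> edges G \<longleftrightarrow> {f u, f v} \<in> edges G'))"

definition complete_graph :: "nat \<Rightarrow> nat graph" where
  "complete_graph n = Graph {1..n} {e. e \<subseteq> {1..n} \<and> card e = 2}"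

definition connected_graph :: "'a graph \<Rightarrow> bool" where
  "connected_graph G \<longleftrightarrow>
     vertices G \<noteq> {} \<and>
     (\<forall>u\<in>vertices G. \<forall>v\<in>vertices G. (u, v) \<in> {(x, y). {x, y} \<in> edges G}\<^sup>*)"

text \<open>The standard definition of \<open>k\<close>-connectivity: more than \<open>k\<close> vertices, and no
  set of fewer than \<open>k\<close> vertices disconnects the graph. In particular \<open>K\<^sub>3\<close> is not
  3-connected, while \<open>K\<^sub>4\<close> is.\<close>

definition k_connected :: "nat \<Rightarrow> 'a graph \<Rightarrow> bool" where
  "k_connected k G \<longleftrightarrow>
     card (vertices G) > k \<and>
     (\<forall>S. S \<subseteq> vertices G \<and> card S < k \<longrightarrow> connected_graph (induced G (vertices G - S)))"

text \<open>A \<open>q\<close>-colouring is a function on all sets of vertices of which only the values on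
  \<open>edges G\<close> matter.\<close>

definition ramsey :: "nat \<Rightarrow> 'a graph \<Rightarrow> 'b graph \<Rightarrow> bool" where
  "ramsey q H G \<longleftrightarrow>
     (\<forall>c \<in> edges G \<rightarrow> {1..q}.
        \<exists>H'. subgraph H' G \<and> isomorphic H H' \<and> (\<exists>i\<in>{1..q}. \<forall>e\<in>edges H'. c e = i))"

definition ramsey_minimal :: "nat \<Rightarrow> 'a graph \<Rightarrow> 'b graph set" where
  "ramsey_minimal q H =
     {G. fin_simple_graph G \<and> ramsey q H G \<and>
         (\<forall>G'. proper_subgraph G' G \<longrightarrow> \<not> ramsey q H G')}"

end

theory Submission
  imports Defs "HOL-Library.Nat_Bijection" "HOL-Library.Ramsey" "HOL-Combinatorics.Transposition"
begin

text \<open>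
  Both hypotheses on \<open>H\<close> say that at most two vertices never separate \<open>H\<close>; hence graphs glued along
  an edge, or along a common centre and one further vertex, acquire no new copies of \<open>H\<close>.
  Deleting an edge at \<open>v\<close> from a minimal \<open>q\<close>-Ramsey graph leaves a graph in which no \<open>H\<close>-free colouring
  is constant on the star at \<open>v\<close>. Copies of it, glued at \<open>v\<close> along a hypergraph of large girth and large
  chromatic number, have no \<open>H\<close>-free colouring. Splitting a variable of such a system, or deleting a
  constraint, gives senders: graphs that force two edges to have different, respectively equal,
  colours. Chaining senders places the two edges arbitrarily far apart.

  Now join every edge of \<open>F\<close> to one far away edge \<open>f\<close> by senders forcing different colours. In
  an \<open>H\<close>-free colouring with \<open>r + 1\<close> colours, \<open>F\<close> would only use \<open>r\<close> colours, which is impossible, while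
  every subgraph that misses an edge of \<open>F\<close>, or has no vertex at some intermediate distance, has
  such a colouring. So a minimal subgraph contains \<open>F\<close> as an induced subgraph and is large. Iterate
  over the number of colours.
\<close>

section \<open>Sparse uncolourable hypergraphs\<close>

text \<open>No explicit gadget is available for an arbitrary such \<open>H\<close>, so everything is
  extracted from the bare existence of a Ramsey graph. A gadget is read as a constraint: the
  variables are edges at one common centre, their values are colours, and a copy of the gadget rules
  out some combinations of values. Forcing a relation between two variables then only requires a
  system that is barely unsatisfiable, found by an extremal choice.

  The price is that the gadgets overlap, and a copy of \<open>H\<close> might run through several of
  them. It uses at most \<open>card (edges H)\<close> gadgets, so sparsity matters only for
  subsystems of that size. This is the bound put on the hypergraphs.

  The distance between the two edges joined by a sender has a second purpose: once it is at least
  the number of vertices of \<open>H\<close>, a connected copy of \<open>H\<close> is too small to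
  have vertices both in \<open>F\<close> and on \<open>f\<close>, so every copy can be confined to
  \<open>F\<close> or to one sender.\<close>

definition leaf :: "'a set \<Rightarrow> 'a set set \<Rightarrow> bool" where
  "leaf A \<C> \<longleftrightarrow> card (A \<inter> \<Union>(\<C> - {A})) \<le> 1"

text \<open>This replaces large girth: small subsystems behave like forests. Asking for two leaves, not just
  one, makes the property pass to amalgams.\<close>

definition sparse :: "nat \<Rightarrow> 'a set set \<Rightarrow> bool" where
  "sparse L \<H> \<longleftrightarrow> (\<forall>\<C>\<subseteq>\<H>. 2 \<le> card \<C> \<and> card \<C> \<le> L \<longrightarrow>
     (\<exists>A\<in>\<C>. \<exists>B\<in>\<C>. A \<noteq> B \<and> leaf A \<C> \<and> leaf B \<C>))"

text \<open>This is chromatic number above \<open>q\<close>. Colourings are total functions, so that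
  they can be pulled back along the maps of an amalgamation by mere composition.\<close>

definition uncolourable :: "nat \<Rightarrow> 'a set set \<Rightarrow> bool" where
  "uncolourable q \<H> \<longleftrightarrow> (\<forall>d. range d \<subseteq> {1..q} \<longrightarrow> (\<exists>A\<in>\<H>. \<exists>i. \<forall>x\<in>A. d x = i))"

lemma sparseD:
  "sparse L \<H> \<Longrightarrow> \<C> \<subseteq> \<H> \<Longrightarrow> 2 \<le> card \<C> \<Longrightarrow> card \<C> \<le> L \<Longrightarrow>
    \<exists>A\<in>\<C>. \<exists>B\<in>\<C>. A \<noteq> B \<and> leaf A \<C> \<and> leaf B \<C>"
  by (simp add: sparse_def)

lemma uncolourableD:
  "uncolourable q \<H> \<Longrightarrow> range d \<subseteq> {1..q} \<Longrightarrow> \<exists>A\<in>\<H>. \<exists>i. \<forall>x\<in>A. d x = i"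
  unfolding uncolourable_def by (elim allE impE)

lemma card_le_1_mono: "A \<subseteq> B \<Longrightarrow> finite B \<Longrightarrow> card B \<le> 1 \<Longrightarrow> card A \<le> 1"
  by (meson card_mono le_trans)

lemma card_le_1_image: "finite A \<Longrightarrow> card A \<le> 1 \<Longrightarrow> card (f ` A) \<le> 1"
  by (meson card_image_le le_trans)

lemma monochromatic_subset:
  fixes d :: "nat \<Rightarrow> nat"
  assumes "d ` {..<q * k + 1} \<subseteq> {1..q}"
  obtains K i where "K \<subseteq> {..<q * k + 1}" "card K = k" "\<forall>x\<in>K. d x = i"
proof -
  have "\<exists>i\<in>{1..q}. k \<le> card {x \<in> {..<q * k + 1}. d x = i}"
  proof (rule ccontr)
    assume "\<not> ?thesis"
    then have less: "card {x \<in> {..<q * k + 1}. d x = i} \<le> k" if "i \<in> {1..q}" for i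
      using that by force
    have "{..<q * k + 1} = (\<Union>i\<in>{1..q}. {x \<in> {..<q * k + 1}. d x = i})"
      using assms by blast
    then have "q * k + 1 = card (\<Union>i\<in>{1..q}. {x \<in> {..<q * k + 1}. d x = i})"
      by (metis card_lessThan)
    also have "\<dots> \<le> (\<Sum>i\<in>{1..q}. card {x \<in> {..<q * k + 1}. d x = i})"
      by (rule card_UN_le) simp
    also have "\<dots> \<le> (\<Sum>i\<in>{1..q}. k)"
      by (rule sum_mono) (use less in blast)
    finally show False by simp
  qed
  then obtain i where "k \<le> card {x \<in> {..<q * k + 1}. d x = i}" by blast
  then obtain K where "K \<subseteq> {x \<in> {..<q * k + 1}. d x = i}" "card K = k"
    by (meson obtain_subset_with_card_n)
  then show ?thesis by (intro that[of K i]) auto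
qed

text \<open>The partite amalgamation of Nesetril and Roedl: one copy of \<open>\<G>\<close> for every \<open>D \<in> \<H>\<close>, with its
  \<open>i\<close>-th part placed on \<open>D\<close> and all other vertices new. The codes \<open>(0, _)\<close> are the vertices of \<open>\<H>\<close>.\<close>

locale amalgam =
  fixes \<G> :: "nat set set" and \<pi> :: "nat \<Rightarrow> nat" and i :: nat
    and \<H> :: "nat set set" and \<beta> :: "nat set \<Rightarrow> nat \<Rightarrow> nat" and L :: nat
  assumes finG: "finite \<G>" "\<And>A. A \<in> \<G> \<Longrightarrow> finite A"
    and inj_\<pi>: "\<And>A. A \<in> \<G> \<Longrightarrow> inj_on \<pi> A"
    and sparseG: "sparse (Suc L) \<G>"
    and finH: "finite \<H>" "\<And>D. D \<in> \<H> \<Longrightarrow> finite D"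
    and sparseH: "sparse L \<H>"
    and bij_\<beta>: "\<And>D. D \<in> \<H> \<Longrightarrow> bij_betw (\<beta> D) {x \<in> \<Union>\<G>. \<pi> x = i} D"
begin

definition f :: "nat set \<Rightarrow> nat \<Rightarrow> nat" where
  "f D x = (if \<pi> x = i then prod_encode (0, \<beta> D x) else prod_encode (Suc (set_encode D), x))"

definition \<G>' :: "nat set set" where
  "\<G>' = {f D ` A | D A. D \<in> \<H> \<and> A \<in> \<G>}"

lemma inj_f: "D \<in> \<H> \<Longrightarrow> inj_on (f D) (\<Union>\<G>)"
  using bij_\<beta>[of D] unfolding bij_betw_def inj_on_def f_def by auto

text \<open>Different copies of \<open>\<G>\<close> share only vertices of \<open>\<H>\<close>: the
  code of every other vertex contains \<open>set_encode D\<close>, which determines the finite set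
  \<open>D\<close>.\<close>

lemma f_eq:
  assumes "D \<in> \<H>" "D' \<in> \<H>" "D \<noteq> D'" "x \<in> \<Union>\<G>" "x' \<in> \<Union>\<G>" "f D x = f D' x'"
  shows "\<pi> x = i \<and> (\<exists>y \<in> D \<inter> D'. f D x = prod_encode (0, y))"
proof -
  have "\<pi> x = i"
  proof (rule ccontr)
    assume "\<pi> x \<noteq> i"
    then have "set_encode D = set_encode D'"
      using assms(6) by (auto simp: f_def split: if_splits)
    then show False
      using assms(3) finH(2)[OF assms(1)] finH(2)[OF assms(2)] by (simp add: set_encode_eq)
  qed
  moreover from this have "\<pi> x' = i" "\<beta> D x = \<beta> D' x'"
    using assms(6) by (auto simp: f_def split: if_splits)
  ultimately show ?thesis
    using assms bij_\<beta>[of D] bij_\<beta>[of D'] unfolding bij_betw_def f_def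
    by (metis (mono_tags, lifting) IntI image_eqI mem_Collect_eq)
qed

lemma fin': "finite \<G>'" "A \<in> \<G>' \<Longrightarrow> finite A"
proof -
  have "\<G>' = (\<lambda>(D, A). f D ` A) ` (\<H> \<times> \<G>)" by (auto simp: \<G>'_def)
  then show "finite \<G>'" using finG(1) finH(1) by simp
  show "A \<in> \<G>' \<Longrightarrow> finite A" using finG(2) by (auto simp: \<G>'_def)
qed

text \<open>Hyperedges from different copies of \<open>\<G>\<close> meet only in part
  \<open>i\<close>, where each has at most one vertex; those from the same copy meet as in
  \<open>\<G>\<close>. If no two members of \<open>\<C>\<close> share a copy, all of them are
  leaves, and if all share one copy, \<open>\<G>\<close> supplies the leaves. Otherwise the sparsity
  of \<open>\<H>\<close> applies to the sets \<open>D\<close> that occur, and each leaf among these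
  yields a leaf of \<open>\<C>\<close>.\<close>

lemma sparse': "sparse (Suc L) \<G>'"
  unfolding sparse_def
proof (intro allI impI)
  fix \<C> assume C: "\<C> \<subseteq> \<G>'" and "2 \<le> card \<C> \<and> card \<C> \<le> Suc L"
  then have c2: "2 \<le> card \<C>" and cL: "card \<C> \<le> Suc L" by auto
  have finC: "finite \<C>" using C fin'(1) finite_subset by blast
  have "\<forall>C\<in>\<C>. \<exists>D A. D \<in> \<H> \<and> A \<in> \<G> \<and> C = f D ` A" using C unfolding \<G>'_def by blast
  then obtain Df Af where DA: "\<And>C. C \<in> \<C> \<Longrightarrow> Df C \<in> \<H>" "\<And>C. C \<in> \<C> \<Longrightarrow> Af C \<in> \<G>"
      "\<And>C. C \<in> \<C> \<Longrightarrow> C = f (Df C) ` Af C" by metis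
  have DAz: "\<exists>x\<in>Af C. z = f (Df C) x" if "C \<in> \<C>" "z \<in> C" for C z
    using subsetD[OF equalityD1[OF DA(3)[OF that(1)]] that(2)] by blast
  have DAi: "C = C'" if "C \<in> \<C>" "C' \<in> \<C>" "Df C = Df C'" "Af C = Af C'" for C C'
  proof -
    have "f (Df C) ` Af C = f (Df C') ` Af C'" using that by simp
    then show ?thesis by (rule trans[OF DA(3)[OF that(1)] trans[OF _ DA(3)[OF that(2), symmetric]]])
  qed
  define \<D> where "\<D> = Df ` \<C>"
  have D: "\<D> \<subseteq> \<H>" "finite \<D>" using DA(1) finC by (auto simp: \<D>_def)
  define CC where "CC D = {C \<in> \<C>. Df C = D}" for D
  have inner: "\<exists>x \<in> Af C \<inter> \<Union>(Af ` CC D - {Af C}). z = f D x"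
    if h: "C \<in> CC D" "C' \<in> CC D" "C \<noteq> C'" "z \<in> C" "z \<in> C'" for C C' D z
  proof -
    from that have *: "C \<in> \<C>" "C' \<in> \<C>" "Df C = D" "Df C' = D" by (auto simp: CC_def)
    obtain x where x: "x \<in> Af C" "z = f D x" using DAz[OF *(1) h(4)] *(3) by blast
    obtain x' where x': "x' \<in> Af C'" "z = f D x'" using DAz[OF *(2) h(5)] *(4) by blast
    have "x = x'" using inj_f[of D] x x' DA * by (metis UnionI inj_onD)
    moreover have "Af C \<noteq> Af C'" using that DAi * by metis
    ultimately show ?thesis using x x' that by blast
  qed
  have outer: "\<exists>x\<in>Af C. \<pi> x = i \<and> z = f D x \<and> z \<in> (\<lambda>y. prod_encode (0, y)) ` (D \<inter> \<Union>(\<D> - {D}))"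
    if h: "C \<in> CC D" "C' \<in> \<C>" "C' \<notin> CC D" "z \<in> C" "z \<in> C'" for C C' D z
  proof -
    from that have *: "C \<in> \<C>" "Df C = D" "Df C' \<noteq> D" by (auto simp: CC_def)
    obtain x where x: "x \<in> Af C" "z = f D x" using DAz[OF *(1) h(4)] *(2) by blast
    obtain x' where x': "x' \<in> Af C'" "z = f (Df C') x'" using DAz[OF h(2) h(5)] by blast
    have "\<pi> x = i \<and> (\<exists>y \<in> D \<inter> Df C'. f D x = prod_encode (0, y))"
      by (rule f_eq[where x' = x']) (use x x' DA * that in auto)
    moreover have "Df C' \<in> \<D> - {D}" using that * by (auto simp: \<D>_def)
    ultimately show ?thesis using x by blast
  qed
  have part1: "card (f D ` {x \<in> A. \<pi> x = i}) \<le> 1" if "A \<in> \<G>" for A D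
  proof -
    have "card {x \<in> A. \<pi> x = i} \<le> 1"
      using inj_\<pi>[OF that] finG(2)[OF that]
      by (simp add: card_le_Suc0_iff_eq inj_on_def)
    moreover have "finite {x \<in> A. \<pi> x = i}" using finG(2)[OF that] by simp
    ultimately show ?thesis by (rule card_le_1_image[rotated])
  qed
  have single: "leaf C \<C>" if "CC D = {C}" for C D
  proof -
    have *: "C \<in> \<C>" "Df C = D" using that by (auto simp: CC_def)
    have "C \<inter> \<Union>(\<C> - {C}) \<subseteq> f D ` {x \<in> Af C. \<pi> x = i}"
    proof
      fix z assume "z \<in> C \<inter> \<Union>(\<C> - {C})"
      then obtain C' where "C' \<in> \<C>" "C' \<noteq> C" "z \<in> C" "z \<in> C'" by blast
      then show "z \<in> f D ` {x \<in> Af C. \<pi> x = i}" using outer[of C D C' z] that by auto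
    qed
    moreover have "finite (f D ` {x \<in> Af C. \<pi> x = i})" using finG(2) DA(2) * by simp
    ultimately show ?thesis unfolding leaf_def
      using part1[OF DA(2)[OF *(1)]] by (rule card_le_1_mono)
  qed
  have two: "\<exists>A1\<in>CC D. \<exists>A2\<in>CC D. A1 \<noteq> A2 \<and> leaf (Af A1) (Af ` CC D) \<and> leaf (Af A2) (Af ` CC D)"
    if "2 \<le> card (CC D)" for D
  proof -
    have "inj_on Af (CC D)" using DAi by (auto simp: CC_def inj_on_def)
    then have "card (Af ` CC D) = card (CC D)" by (rule card_image)
    moreover have "card (CC D) \<le> Suc L"
      using cL card_mono[OF finC, of "CC D"] by (auto simp: CC_def)
    moreover have "Af ` CC D \<subseteq> \<G>" using DA(2) by (auto simp: CC_def)
    ultimately have "\<exists>A\<in>Af ` CC D. \<exists>B\<in>Af ` CC D. A \<noteq> B \<and> leaf A (Af ` CC D) \<and> leaf B (Af ` CC D)"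
      using that by (intro sparseD[OF sparseG]) auto
    then show ?thesis unfolding bex_simps by (metis (no_types))
  qed
  have img1: "card (f D ` (Af C \<inter> \<Union>(Af ` CC D - {Af C}))) \<le> 1"
    if "leaf (Af C) (Af ` CC D)" "C \<in> \<C>" for C D
  proof -
    have "finite (Af C \<inter> \<Union>(Af ` CC D - {Af C}))" using finG(2) DA(2) that by simp
    then show ?thesis using that(1) unfolding leaf_def by (rule card_le_1_image)
  qed
  have lf: "\<exists>C\<in>CC D. leaf C \<C>" if "D \<in> \<D>" "leaf D \<D>" for D
  proof (cases "card (CC D) = 1")
    case True
    then show ?thesis using single by (metis card_1_singletonE singletonI)
  next
    case False
    have "CC D \<noteq> {}" "finite (CC D)" using that finC by (auto simp: CC_def \<D>_def)
    then have "2 \<le> card (CC D)" using False by (simp add: Suc_leI card_gt_0_iff le_neq_implies_less numeral_2_eq_2)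
    then obtain C1 C2 where CD: "C1 \<in> CC D" "C2 \<in> CC D" "C1 \<noteq> C2"
      "leaf (Af C1) (Af ` CC D)" "leaf (Af C2) (Af ` CC D)" using two by meson
    \<comment> \<open>The copy at \<open>D\<close> touches the rest of \<open>\<C>\<close> only in
      these vertices, and as \<open>D\<close> is a leaf of \<open>\<D>\<close> there is at most
      one.\<close>
    define Y where "Y = (\<lambda>y. prod_encode (0, y)) ` (D \<inter> \<Union>(\<D> - {D}))"
    have finD: "finite D" using that D finH(2) by auto
    have "finite (D \<inter> \<Union>(\<D> - {D}))" using finD by simp
    then have Y1: "card Y \<le> 1"
      using that(2) unfolding Y_def leaf_def by (rule card_le_1_image)
    have finY: "finite Y" using finD by (simp add: Y_def)
    have ex: "\<exists>y\<in>Y. y \<in> C \<and> y \<notin> f D ` (Af C \<inter> \<Union>(Af ` CC D - {Af C}))"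
      if "\<not> leaf C \<C>" "C \<in> CC D" "leaf (Af C) (Af ` CC D)" for C
    proof (rule ccontr)
      assume neg: "\<not> ?thesis"
      have CC: "C \<in> \<C>" using that by (auto simp: CC_def)
      have "C \<inter> \<Union>(\<C> - {C}) \<subseteq> f D ` (Af C \<inter> \<Union>(Af ` CC D - {Af C}))"
      proof
        fix z assume "z \<in> C \<inter> \<Union>(\<C> - {C})"
        then obtain C' where C': "C' \<in> \<C>" "C' \<noteq> C" "z \<in> C" "z \<in> C'" by blast
        show "z \<in> f D ` (Af C \<inter> \<Union>(Af ` CC D - {Af C}))"
        proof (cases "C' \<in> CC D")
          case True
          then show ?thesis using inner[of C D C' z] C' that(2) by auto
        next
          case False
          then have "z \<in> Y" using outer[of C D C' z] C' that(2) by (auto simp: Y_def)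
          then show ?thesis using neg C' by blast
        qed
      qed
      moreover have "finite (f D ` (Af C \<inter> \<Union>(Af ` CC D - {Af C})))" using finG(2) DA(2) CC by simp
      ultimately have "leaf C \<C>" unfolding leaf_def
        using img1[OF that(3) CC] by (rule card_le_1_mono)
      then show False using that by simp
    qed
    show ?thesis
    proof (rule ccontr)
      assume "\<not> ?thesis"
      then have "\<not> leaf C1 \<C>" "\<not> leaf C2 \<C>" using CD by auto
      then obtain y1 y2 where y: "y1 \<in> Y" "y1 \<in> C1" "y1 \<notin> f D ` (Af C1 \<inter> \<Union>(Af ` CC D - {Af C1}))"
        "y2 \<in> Y" "y2 \<in> C2" using ex CD by meson
      \<comment> \<open>If both leaves inside the copy fail to be leaves of \<open>\<C>\<close>,
        both contain the one vertex of \<open>Y\<close>. They then already meet there inside the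
        copy, so it adds no new contact. A single leaf per copy would not give this
        contradiction.\<close>
      have "y1 = y2" using Y1 finY y by (simp add: card_le_Suc0_iff_eq)
      then show False using inner[of C1 D C2 y1] CD y by auto
    qed
  qed
  show "\<exists>A\<in>\<C>. \<exists>B\<in>\<C>. A \<noteq> B \<and> leaf A \<C> \<and> leaf B \<C>"
  proof (cases "inj_on Df \<C>")
    case True
    obtain C1 C2 where "C1 \<in> \<C>" "C2 \<in> \<C>" "C1 \<noteq> C2"
      using c2 by (metis One_nat_def card_le_Suc0_iff_eq finC not_less_eq_eq numeral_2_eq_2)
    moreover have "leaf C \<C>" if "C \<in> \<C>" for C
      by (rule single[of "Df C"]) (use True that in \<open>auto simp: CC_def inj_on_def\<close>)
    ultimately show ?thesis by metis
  next
    case False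
    \<comment> \<open>This strict drop turns the bound \<open>Suc L\<close> on \<open>\<C>\<close>
      into the bound \<open>L\<close> on \<open>\<D>\<close>.\<close>
    then have "card \<D> < card \<C>" unfolding \<D>_def
      by (simp add: card_image_le finC inj_on_iff_eq_card le_neq_implies_less)
    show ?thesis
    proof (cases "card \<D> \<ge> 2")
      case True
      then obtain D1 D2 where "D1 \<in> \<D>" "D2 \<in> \<D>" "D1 \<noteq> D2" "leaf D1 \<D>" "leaf D2 \<D>"
        using sparseD[OF sparseH D(1)] \<open>card \<D> < card \<C>\<close> cL by auto
      then obtain C1 C2 where "C1 \<in> CC D1" "leaf C1 \<C>" "C2 \<in> CC D2" "leaf C2 \<C>"
        using lf[of D1] lf[of D2] by metis
      moreover from this have "C1 \<in> \<C>" "C2 \<in> \<C>" "C1 \<noteq> C2" using \<open>D1 \<noteq> D2\<close> unfolding CC_def by blast+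
      ultimately show ?thesis by metis
    next
      case False
      moreover have "\<C> \<noteq> {}" using c2 by auto
      then have "\<D> \<noteq> {}" by (simp add: \<D>_def)
      then have "card \<D> \<noteq> 0" using D(2) by simp
      ultimately have "card \<D> = 1" by linarith
      then obtain D where D: "\<D> = {D}" by (rule card_1_singletonE)
      then have CD: "CC D = \<C>" by (auto simp: CC_def \<D>_def)
      then obtain C1 C2 where C12: "C1 \<in> \<C>" "C2 \<in> \<C>" "C1 \<noteq> C2"
        "leaf (Af C1) (Af ` \<C>)" "leaf (Af C2) (Af ` \<C>)" using two[of D] c2 by auto
      have "leaf C \<C>" if "C \<in> \<C>" "leaf (Af C) (Af ` \<C>)" for C
      proof -
        have "C \<inter> \<Union>(\<C> - {C}) \<subseteq> f D ` (Af C \<inter> \<Union>(Af ` \<C> - {Af C}))"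
        proof
          fix z assume "z \<in> C \<inter> \<Union>(\<C> - {C})"
          then obtain C' where "C' \<in> \<C>" "C' \<noteq> C" "z \<in> C" "z \<in> C'" by blast
          then show "z \<in> f D ` (Af C \<inter> \<Union>(Af ` \<C> - {Af C}))"
            using inner[of C D C' z] that CD by auto
        qed
        moreover have "finite (f D ` (Af C \<inter> \<Union>(Af ` \<C> - {Af C})))" using finG(2) DA(2) that by simp
        ultimately show ?thesis
          using img1[of C D, unfolded CD, OF that(2,1)] unfolding leaf_def by (rule card_le_1_mono)
      qed
      then show ?thesis using C12 by metis
    qed
  qed
qed

end

text \<open>The induction on \<open>L\<close> runs over all \<open>k\<close> at once, because its
  step uses hyperedges as large as a whole part of the system built so far. The start is the
  pigeonhole principle on \<open>q * k + 1\<close> points; in the step the same points index the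
  parts.\<close>

theorem sparse_uncolourable_hypergraph:
  "\<exists>\<H> :: nat set set. finite \<H> \<and> (\<forall>A\<in>\<H>. finite A \<and> card A = k) \<and> sparse L \<H> \<and> uncolourable q \<H>"
proof (induction L arbitrary: k)
  case 0
  let ?H = "{K. K \<subseteq> {..<q * k + 1} \<and> card K = k}"
  have "uncolourable q ?H"
    unfolding uncolourable_def
  proof (intro allI impI)
    fix d :: "nat \<Rightarrow> nat" assume "range d \<subseteq> {1..q}"
    then have "d ` {..<q * k + 1} \<subseteq> {1..q}" by blast
    then obtain K i where "K \<subseteq> {..<q * k + 1}" "card K = k" "\<forall>x\<in>K. d x = i"
      by (rule monochromatic_subset)
    then show "\<exists>A\<in>?H. \<exists>i. \<forall>x\<in>A. d x = i" by blast
  qed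
  moreover have "sparse 0 ?H" by (auto simp: sparse_def)
  moreover have "finite ?H" "\<forall>A\<in>?H. finite A \<and> card A = k" by (auto intro: finite_subset)
  ultimately show ?case by blast
next
  case (Suc L)
  let ?a = "q * k + 1"
  let ?\<K> = "{K. K \<subseteq> {..<?a} \<and> card K = k}"
  note hypergraph = Suc.IH
  text \<open>After \<open>i\<close> amalgamation steps some copy of the initial system of disjoint hyperedges is
    coloured constantly (by \<open>e\<close>) on each of its first \<open>i\<close> parts.\<close>
  have "\<exists>(\<G> :: nat set set) \<pi>. finite \<G> \<and> (\<forall>A\<in>\<G>. finite A \<and> card A = k \<and> inj_on \<pi> A) \<and>
      sparse (Suc L) \<G> \<and>
      (\<forall>d. range d \<subseteq> {1..q} \<longrightarrow> (\<exists>e. e ` {..<i} \<subseteq> {1..q} \<and>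
        (\<forall>K\<in>?\<K>. \<exists>A\<in>\<G>. \<pi> ` A = K \<and> (\<forall>x\<in>A. \<pi> x < i \<longrightarrow> d x = e (\<pi> x)))))" for i
  proof (induction i)
    case 0
    \<comment> \<open>Every \<open>k\<close>-subset gets a private copy of its points. The
      hyperedges are thus disjoint, and each is a leaf of any subsystem.\<close>
    define g where "g K j = prod_encode (set_encode K, j)" for K j
    define p where "p = snd \<circ> prod_decode"
    have pg: "p (g K j) = j" for K j by (simp add: p_def g_def)
    have injg: "inj_on (g K) B" for K B by (rule inj_on_inverseI[where g = p]) (rule pg)
    have "inj_on p (g K ` K)" for K by (rule inj_on_inverseI[where g = "g K"]) (auto simp: pg)
    note injp = this
    define \<G> where "\<G> = (\<lambda>K. g K ` K) ` ?\<K>"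
    have finK: "finite K" if "K \<in> ?\<K>" for K using that finite_subset by blast
    have disj: "g K ` K \<inter> g K' ` K' = {}" if "K \<in> ?\<K>" "K' \<in> ?\<K>" "K \<noteq> K'" for K K'
    proof -
      have "set_encode K \<noteq> set_encode K'"
        using that finK[OF that(1)] finK[OF that(2)] by (simp add: set_encode_eq)
      then show ?thesis by (auto simp: g_def)
    qed
    have "\<forall>A\<in>\<G>. finite A \<and> card A = k \<and> inj_on p A"
    proof
      fix A assume "A \<in> \<G>"
      then obtain K where K: "K \<in> ?\<K>" "A = g K ` K" unfolding \<G>_def by blast
      then show "finite A \<and> card A = k \<and> inj_on p A"
        using finK[OF K(1)] card_image[OF injg[of K K]] injp[of K] by simp
    qed
    moreover have "finite \<G>" by (simp add: \<G>_def)
    moreover have "sparse (Suc L) \<G>"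
      unfolding sparse_def
    proof (intro allI impI)
      fix \<C> assume C: "\<C> \<subseteq> \<G>" "2 \<le> card \<C> \<and> card \<C> \<le> Suc L"
      have "A \<inter> B = {}" if "A \<in> \<G>" "B \<in> \<G>" "A \<noteq> B" for A B using that disj unfolding \<G>_def by blast
      then have "leaf A \<C>" if "A \<in> \<C>" for A
      proof -
        have "A \<inter> \<Union>(\<C> - {A}) = {}" using that C(1) \<open>\<And>B A. A \<in> \<G> \<Longrightarrow> B \<in> \<G> \<Longrightarrow> A \<noteq> B \<Longrightarrow> A \<inter> B = {}\<close> by blast
        then show ?thesis by (simp add: leaf_def)
      qed
      moreover obtain A B where "A \<in> \<C>" "B \<in> \<C>" "A \<noteq> B" using C(2)
        by (metis One_nat_def Suc_1 card.infinite card_le_Suc0_iff_eq not_less_eq_eq zero_le)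
      ultimately show "\<exists>A\<in>\<C>. \<exists>B\<in>\<C>. A \<noteq> B \<and> leaf A \<C> \<and> leaf B \<C>" by blast
    qed
    moreover have "\<exists>A\<in>\<G>. p ` A = K" if "K \<in> ?\<K>" for K
      using that by (intro bexI[of _ "g K ` K"]) (auto simp: \<G>_def pg image_image)
    ultimately show ?case
      by (intro exI[of _ \<G>] exI[of _ p]) auto
  next
    case (Suc i)
    obtain \<G> :: "nat set set" and \<pi> where G': "finite \<G> \<and> (\<forall>A\<in>\<G>. finite A \<and> card A = k \<and> inj_on \<pi> A) \<and>
      sparse (Suc L) \<G> \<and>
      (\<forall>d. range d \<subseteq> {1..q} \<longrightarrow> (\<exists>e. e ` {..<i} \<subseteq> {1..q} \<and>
        (\<forall>K\<in>?\<K>. \<exists>A\<in>\<G>. \<pi> ` A = K \<and> (\<forall>x\<in>A. \<pi> x < i \<longrightarrow> d x = e (\<pi> x)))))"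
      using Suc by (elim exE) (rule that)
    have G: "finite \<G>" "\<And>A. A \<in> \<G> \<Longrightarrow> finite A" "\<And>A. A \<in> \<G> \<Longrightarrow> card A = k"
        "\<And>A. A \<in> \<G> \<Longrightarrow> inj_on \<pi> A" "sparse (Suc L) \<G>"
      using G' by simp_all
    have col: "\<exists>e. e ` {..<i} \<subseteq> {1..q} \<and>
        (\<forall>K\<in>?\<K>. \<exists>A\<in>\<G>. \<pi> ` A = K \<and> (\<forall>x\<in>A. \<pi> x < i \<longrightarrow> d x = e (\<pi> x)))"
      if "range d \<subseteq> {1..q}" for d
      using G' that by simp
    let ?X = "{x \<in> \<Union>\<G>. \<pi> x = i}"
    have finX: "finite ?X" using G by simp
    \<comment> \<open>The hyperedges have the size of part \<open>i\<close>, so that this part can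
      be placed on each of them.\<close>
    obtain \<H> :: "nat set set" where H: "finite \<H>" "\<And>D. D \<in> \<H> \<Longrightarrow> finite D"
      "\<And>D. D \<in> \<H> \<Longrightarrow> card D = card ?X" "sparse L \<H>" "uncolourable q \<H>"
      using hypergraph[of "card ?X"] by metis
    have "\<exists>b. bij_betw b ?X D" if "D \<in> \<H>" for D
      using finX H that by (metis finite_same_card_bij)
    then obtain \<beta> where \<beta>: "\<And>D. D \<in> \<H> \<Longrightarrow> bij_betw (\<beta> D) ?X D" by metis
    interpret amalgam \<G> \<pi> i \<H> \<beta> L by unfold_locales (use G H \<beta> in auto)
    define \<pi>' where "\<pi>' z = (case prod_decode z of (0, y) \<Rightarrow> i | (Suc n, x) \<Rightarrow> \<pi> x)" for z
    have \<pi>'f: "\<pi>' (f D x) = \<pi> x" for D x by (simp add: \<pi>'_def f_def)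
    have "\<forall>A\<in>\<G>'. finite A \<and> card A = k \<and> inj_on \<pi>' A"
    proof
      fix A' assume "A' \<in> \<G>'"
      then obtain D A where DA: "D \<in> \<H>" "A \<in> \<G>" "A' = f D ` A" by (auto simp: \<G>'_def)
      then have "inj_on (f D) A" using inj_f by (meson Sup_upper inj_on_subset)
      moreover have "inj_on (\<pi>' \<circ> f D) A"
        using G(4)[OF DA(2)] by (simp add: comp_def \<pi>'f)
      then have "inj_on \<pi>' A'" unfolding DA(3) by (rule inj_on_imageI)
      ultimately show "finite A' \<and> card A' = k \<and> inj_on \<pi>' A'"
        using G DA by (simp add: card_image)
    qed
    moreover have "\<exists>e. e ` {..<Suc i} \<subseteq> {1..q} \<and>
        (\<forall>K\<in>?\<K>. \<exists>A\<in>\<G>'. \<pi>' ` A = K \<and> (\<forall>x\<in>A. \<pi>' x < Suc i \<longrightarrow> d x = e (\<pi>' x)))"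
      if d: "range d \<subseteq> {1..q}" for d
    proof -
      \<comment> \<open>The colouring of the shared vertices is constant on some \<open>D\<close>.
        In the copy placed on \<open>D\<close> this makes part \<open>i\<close> constant, while the
        earlier parts are handled by pulling \<open>d\<close> back to that copy.\<close>
      have "range (\<lambda>y. d (prod_encode (0, y))) \<subseteq> {1..q}" using d by auto
      from uncolourableD[OF H(5) this] obtain D j
        where D: "D \<in> \<H>" "\<forall>y\<in>D. d (prod_encode (0, y)) = j" by blast
      have "range (d \<circ> f D) \<subseteq> {1..q}" using d by auto
      from col[OF this] obtain e where "e ` {..<i} \<subseteq> {1..q} \<and>
        (\<forall>K\<in>?\<K>. \<exists>A\<in>\<G>. \<pi> ` A = K \<and> (\<forall>x\<in>A. \<pi> x < i \<longrightarrow> (d \<circ> f D) x = e (\<pi> x)))"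
        by (elim exE) (rule that)
      then have e: "e ` {..<i} \<subseteq> {1..q}" "\<And>K. K \<in> ?\<K> \<Longrightarrow>
          \<exists>A\<in>\<G>. \<pi> ` A = K \<and> (\<forall>x\<in>A. \<pi> x < i \<longrightarrow> (d \<circ> f D) x = e (\<pi> x))"
        by simp_all
      \<comment> \<open>If \<open>D\<close> is empty then \<open>j\<close> is arbitrary and need not
        be a colour, so a value of \<open>d\<close> replaces it.\<close>
      define j' where "j' = (if D = {} then d 0 else j)"
      have "j' \<in> {1..q}"
      proof (cases "D = {}")
        case True
        then have "j' = d 0" by (simp add: j'_def)
        then show ?thesis using d by (metis rangeI subsetD)
      next
        case False
        then obtain y where "y \<in> D" by blast
        then have "d (prod_encode (0, y)) = j'" using D(2) by (auto simp: j'_def)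
        then show ?thesis using d by (metis rangeI subsetD)
      qed
      then have "(e(i := j')) ` {..<Suc i} \<subseteq> {1..q}" using e(1) by (auto simp: less_Suc_eq)
      moreover have "\<exists>A\<in>\<G>'. \<pi>' ` A = K \<and> (\<forall>x\<in>A. \<pi>' x < Suc i \<longrightarrow> d x = (e(i := j')) (\<pi>' x))"
        if K: "K \<in> ?\<K>" for K
      proof -
        obtain A where A: "A \<in> \<G>" "\<pi> ` A = K" "\<forall>x\<in>A. \<pi> x < i \<longrightarrow> d (f D x) = e (\<pi> x)"
          using e(2)[OF K] by auto
        have "d (f D x) = (e(i := j')) (\<pi> x)" if "x \<in> A" "\<pi> x < Suc i" for x
        proof (cases "\<pi> x = i")
          case True
          then have "\<beta> D x \<in> D" using \<beta>[OF D(1)] A(1) that(1) by (auto simp: bij_betw_def)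
          then show ?thesis using D True by (auto simp: f_def j'_def)
        next
          case False
          then show ?thesis using A(3) that by simp
        qed
        moreover have "f D ` A \<in> \<G>'" using A D by (auto simp: \<G>'_def)
        moreover have "\<pi>' ` f D ` A = K" using A(2) by (simp add: image_image \<pi>'f)
        ultimately show ?thesis by (intro bexI[of _ "f D ` A"]) (auto simp: \<pi>'f)
      qed
      ultimately show ?thesis by blast
    qed
    ultimately show ?case using fin'(1) sparse' by (intro exI[of _ \<G>'] exI[of _ \<pi>']) simp
  qed
  from this[of ?a] obtain \<G> :: "nat set set" and \<pi> where G': "finite \<G> \<and>
      (\<forall>A\<in>\<G>. finite A \<and> card A = k \<and> inj_on \<pi> A) \<and> sparse (Suc L) \<G> \<and>
      (\<forall>d. range d \<subseteq> {1..q} \<longrightarrow> (\<exists>e. e ` {..<?a} \<subseteq> {1..q} \<and>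
        (\<forall>K\<in>?\<K>. \<exists>A\<in>\<G>. \<pi> ` A = K \<and> (\<forall>x\<in>A. \<pi> x < ?a \<longrightarrow> d x = e (\<pi> x)))))"
    by (elim exE) (rule that)
  have G: "finite \<G>" "\<forall>A\<in>\<G>. finite A \<and> card A = k" "sparse (Suc L) \<G>" using G' by simp_all
  have col: "\<exists>e. e ` {..<?a} \<subseteq> {1..q} \<and>
      (\<forall>K\<in>?\<K>. \<exists>A\<in>\<G>. \<pi> ` A = K \<and> (\<forall>x\<in>A. \<pi> x < ?a \<longrightarrow> d x = e (\<pi> x)))"
    if "range d \<subseteq> {1..q}" for d
    using G' that by simp
  have "uncolourable q \<G>"
    unfolding uncolourable_def
  proof (intro allI impI)
    fix d :: "nat \<Rightarrow> nat" assume "range d \<subseteq> {1..q}"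
    from col[OF this] obtain e where "e ` {..<?a} \<subseteq> {1..q} \<and>
      (\<forall>K\<in>?\<K>. \<exists>A\<in>\<G>. \<pi> ` A = K \<and> (\<forall>x\<in>A. \<pi> x < ?a \<longrightarrow> d x = e (\<pi> x)))"
      by (elim exE) (rule that)
    then have e: "e ` {..<?a} \<subseteq> {1..q}" "\<And>K. K \<in> ?\<K> \<Longrightarrow>
        \<exists>A\<in>\<G>. \<pi> ` A = K \<and> (\<forall>x\<in>A. \<pi> x < ?a \<longrightarrow> d x = e (\<pi> x))"
      by simp_all
    obtain K j where K: "K \<subseteq> {..<?a}" "card K = k" "\<forall>x\<in>K. e x = j"
      using monochromatic_subset[OF e(1)] by blast
    then have "K \<in> ?\<K>" by simp
    from e(2)[OF this] obtain A where A: "A \<in> \<G>" "\<pi> ` A = K"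
      "\<And>x. x \<in> A \<Longrightarrow> \<pi> x < ?a \<Longrightarrow> d x = e (\<pi> x)" by auto
    have "d x = j" if "x \<in> A" for x
    proof -
      have "\<pi> x \<in> K" using A(2) that by blast
      then show ?thesis using A(3)[OF that] K(1,3) by auto
    qed
    then show "\<exists>A\<in>\<G>. \<exists>i. \<forall>x\<in>A. d x = i"
      by (intro bexI[OF _ A(1)] exI[of _ j] ballI)
  qed
  then show ?case using G by (intro exI[of _ \<G>] conjI)
qed

section \<open>Copies of a graph and good colourings\<close>

definition edge_set :: "'a set set \<Rightarrow> bool" where
  "edge_set E \<longleftrightarrow> finite E \<and> (\<forall>e\<in>E. card e = 2)"

text \<open>A copy is recorded by its edges alone. For the graphs \<open>H\<close> considered below,
  which have no isolated vertices, the union of the edges recovers its vertex set.\<close>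

definition copies :: "'a graph \<Rightarrow> 'b set set set" where
  "copies H = {(`) h ` edges H | h. inj_on h (vertices H)}"

definition good :: "'a graph \<Rightarrow> nat \<Rightarrow> 'b set set \<Rightarrow> ('b set \<Rightarrow> nat) \<Rightarrow> bool" where
  "good H q E c \<longleftrightarrow> c ` E \<subseteq> {1..q} \<and>
     (\<forall>K\<in>copies H. K \<subseteq> E \<longrightarrow> \<not> (\<exists>i. \<forall>e\<in>K. c e = i))"

lemma edge_setD:
  assumes "edge_set E"
  shows "finite E" "e \<in> E \<Longrightarrow> card e = 2" "e \<in> E \<Longrightarrow> finite e" "finite (\<Union>E)"
proof -
  show "finite E" "e \<in> E \<Longrightarrow> card e = 2" using assms by (auto simp: edge_set_def)
  have fin: "finite e" if "e \<in> E" for e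
    using assms that by (intro card_ge_0_finite) (auto simp: edge_set_def)
  then show "e \<in> E \<Longrightarrow> finite e" "finite (\<Union>E)" using assms by (auto simp: edge_set_def)
qed

lemma edge_set_subset: "edge_set E \<Longrightarrow> E' \<subseteq> E \<Longrightarrow> edge_set E'"
  by (auto simp: edge_set_def intro: finite_subset)

lemma edge_set_Un: "edge_set E \<Longrightarrow> edge_set E' \<Longrightarrow> edge_set (E \<union> E')"
  by (auto simp: edge_set_def)

lemma edge_set_UN: "finite I \<Longrightarrow> (\<And>a. a \<in> I \<Longrightarrow> edge_set (T a)) \<Longrightarrow> edge_set (\<Union>a\<in>I. T a)"
  by (auto simp: edge_set_def)

lemma edge_set_image:
  assumes "edge_set E" "inj_on f (\<Union>E)"
  shows "edge_set ((`) f ` E)"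
proof -
  have "card (f ` e) = 2" if "e \<in> E" for e
    using assms that by (metis Sup_upper card_image edge_setD(2) inj_on_subset)
  then show ?thesis using assms(1) by (auto simp: edge_set_def)
qed

lemma glue_functions:
  assumes "\<And>a b e. a \<in> I \<Longrightarrow> b \<in> I \<Longrightarrow> e \<in> T a \<Longrightarrow> e \<in> T b \<Longrightarrow> g a e = g b e"
  shows "\<exists>c. \<forall>a\<in>I. \<forall>e\<in>T a. c e = g a e"
proof (intro exI ballI)
  fix a e assume *: "a \<in> I" "e \<in> T a"
  then have "(SOME b. b \<in> I \<and> e \<in> T b) \<in> I \<and> e \<in> T (SOME b. b \<in> I \<and> e \<in> T b)"
    by (intro someI[of "\<lambda>b. b \<in> I \<and> e \<in> T b"]) simp
  then show "g (SOME b. b \<in> I \<and> e \<in> T b) e = g a e" using * assms by blast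
qed

lemma goodD: "good H q E c \<Longrightarrow> e \<in> E \<Longrightarrow> c e \<in> {1..q}"
  "good H q E c \<Longrightarrow> K \<in> copies H \<Longrightarrow> K \<subseteq> E \<Longrightarrow> \<not> (\<forall>e\<in>K. c e = i)"
  unfolding good_def by blast+

lemma good_subset: "good H q E c \<Longrightarrow> E' \<subseteq> E \<Longrightarrow> good H q E' c"
  unfolding good_def by blast

lemma good_cong: "good H q E c \<Longrightarrow> (\<And>e. e \<in> E \<Longrightarrow> c' e = c e) \<Longrightarrow> good H q E c'"
  unfolding good_def by (simp add: subset_iff image_subset_iff)

lemma good_permute:
  assumes "good H q E c" "inj p" "p ` {1..q} \<subseteq> {1..q}"
  shows "good H q E (p \<circ> c)"
  unfolding good_def
proof (intro conjI ballI impI notI)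
  show "(p \<circ> c) ` E \<subseteq> {1..q}" using goodD(1)[OF assms(1)] assms(3) by fastforce
  fix K assume K: "K \<in> copies H" "K \<subseteq> E" "\<exists>i. \<forall>e\<in>K. (p \<circ> c) e = i"
  then obtain i where "\<forall>e\<in>K. p (c e) = i" by auto
  then have "\<forall>e\<in>K. c e = inv p i" using assms(2) by (metis inv_f_f)
  then show False using goodD(2)[OF assms(1) K(1,2)] by blast
qed

text \<open>Every amalgam below is coloured through this: once each copy of \<open>H\<close> is
  confined to one part, goodness can be checked part by part.\<close>

lemma good_covered:
  assumes "c ` E \<subseteq> {1..q}"
    and "\<And>K. K \<in> copies H \<Longrightarrow> K \<subseteq> E \<Longrightarrow> \<exists>a\<in>I. K \<subseteq> T a"
    and "\<And>a. a \<in> I \<Longrightarrow> good H q (T a) c"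
  shows "good H q E c"
  unfolding good_def
proof (intro conjI ballI impI)
  show "c ` E \<subseteq> {1..q}" by (rule assms(1))
  fix K assume "K \<in> copies H" "K \<subseteq> E"
  then show "\<not> (\<exists>i. \<forall>e\<in>K. c e = i)" using assms(2,3) unfolding good_def by metis
qed

lemma transpose_image_subset: "a \<in> S \<Longrightarrow> b \<in> S \<Longrightarrow> transpose a b ` S \<subseteq> S"
  by (simp add: transpose_image_eq)

text \<open>Colours are interchangeable, so the colour of an edge along which parts are glued can be
  prescribed. The last clause records that the colour classes stay the same.\<close>

lemma good_recolour:
  assumes "good H q E c" "e \<in> E" "i \<in> {1..q}"
  obtains c' where "good H q E c'" "c' e = i" "\<And>f f'. c f = c f' \<longleftrightarrow> c' f = c' f'"
proof
  show "good H q E (transpose (c e) i \<circ> c)"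
    using assms goodD(1)[OF assms(1,2)] by (intro good_permute transpose_image_subset) auto
qed (auto simp: transpose_eq_iff dest: inj_onD[OF inj_transpose])

lemma good_recolour_pair:
  assumes c: "good H q E c" "e \<in> E" "f \<in> E" "c e \<noteq> c f" and ij: "i \<in> {1..q}" "j \<in> {1..q}" "i \<noteq> j"
  obtains c' where "good H q E c'" "c' e = i" "c' f = j"
proof -
  obtain c1 where c1: "good H q E c1" "c1 e = i" "\<And>f f'. c f = c f' \<longleftrightarrow> c1 f = c1 f'"
    using good_recolour[OF c(1,2) ij(1)] by metis
  have "good H q E (transpose (c1 f) j \<circ> c1)"
    using goodD(1)[OF c1(1) c(3)] ij c1(1) by (intro good_permute transpose_image_subset) auto
  moreover have "c1 f \<noteq> i" using c1 c(4) by metis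
  ultimately show ?thesis using ij c1(2) by (intro that[of "transpose (c1 f) j \<circ> c1"]) auto
qed

text \<open>The common core of the two hypotheses on \<open>H\<close>. Separation is phrased with
  two vertex sets covering all edges, instead of with deleted vertices, because gluing produces
  exactly this: \<open>P\<close> and \<open>Q\<close> will be the vertex sets of two sides of an
  amalgam.\<close>

locale inseparable_graph =
  fixes H :: "'a graph"
  assumes simple: "fin_simple_graph H"
    and Union_edges: "\<Union>(edges H) = vertices H"
    and card_vertices: "3 \<le> card (vertices H)"
    and separation: "\<And>P Q. \<forall>e\<in>edges H. e \<subseteq> P \<or> e \<subseteq> Q \<Longrightarrow> card (P \<inter> Q \<inter> vertices H) \<le> 2 \<Longrightarrow>
      vertices H \<subseteq> P \<or> vertices H \<subseteq> Q"
begin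

lemma finite_H: "finite (vertices H)" "finite (edges H)"
proof -
  show "finite (vertices H)" using simple by (simp add: fin_simple_graph_def)
  then show "finite (edges H)" by (rule finite_UnionD[of "edges H", unfolded Union_edges])
qed

lemma copyE:
  assumes "K \<in> copies H"
  obtains h where "inj_on h (vertices H)" "K = (`) h ` edges H" "\<Union>K = h ` vertices H"
  using assms unfolding copies_def Union_edges[symmetric] by blast

lemma copy_finite: "K \<in> copies H \<Longrightarrow> finite K" "K \<in> copies H \<Longrightarrow> finite (\<Union>K)"
  by (erule copyE, simp add: finite_H)+

lemma copy_card_le: "K \<in> copies H \<Longrightarrow> card K \<le> card (edges H)"
  by (erule copyE) (simp add: card_image_le finite_H)

lemma copy_card_Union: "K \<in> copies H \<Longrightarrow> card (\<Union>K) = card (vertices H)"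
  by (erule copyE) (simp add: card_image)

lemma copy_card_edge:
  assumes "K \<in> copies H" "e \<in> K"
  shows "card e = 2"
proof -
  obtain h where h: "inj_on h (vertices H)" "K = (`) h ` edges H" using assms(1) by (rule copyE)
  then obtain e' where "e' \<in> edges H" "e = h ` e'" using assms(2) by blast
  then show ?thesis using simple h(1) unfolding fin_simple_graph_def by (metis card_image inj_on_subset)
qed

lemma copy_image:
  assumes "K \<in> copies H" "inj_on f (\<Union>K)"
  shows "(`) f ` K \<in> copies H"
proof -
  obtain h where h: "inj_on h (vertices H)" "K = (`) h ` edges H" "\<Union>K = h ` vertices H"
    using assms(1) by (rule copyE)
  then have "inj_on (f \<circ> h) (vertices H)" using assms(2) by (simp add: comp_inj_on)
  moreover have "(`) f ` K = (`) (f \<circ> h) ` edges H" using h(2) by (simp add: image_image image_comp)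
  ultimately show ?thesis unfolding copies_def by blast
qed

lemma copy_separation:
  assumes K: "K \<in> copies H" and PQ: "\<And>e. e \<in> K \<Longrightarrow> e \<subseteq> P \<or> e \<subseteq> Q" and 2: "card (P \<inter> Q \<inter> \<Union>K) \<le> 2"
  shows "\<Union>K \<subseteq> P \<or> \<Union>K \<subseteq> Q"
proof -
  obtain h where h: "inj_on h (vertices H)" "K = (`) h ` edges H" "\<Union>K = h ` vertices H"
    using K by (rule copyE)
  have "h ` (h -` P \<inter> h -` Q \<inter> vertices H) = P \<inter> Q \<inter> \<Union>K" using h(3) by auto
  moreover have "inj_on h (h -` P \<inter> h -` Q \<inter> vertices H)" using h(1) by (rule inj_on_subset) auto
  ultimately have "card (h -` P \<inter> h -` Q \<inter> vertices H) \<le> 2" using 2 by (metis card_image)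
  moreover have "\<forall>e\<in>edges H. e \<subseteq> h -` P \<or> e \<subseteq> h -` Q" 
  proof
    fix e assume "e \<in> edges H"
    then have "h ` e \<in> K" using h(2) by blast
    from PQ[OF this] show "e \<subseteq> h -` P \<or> e \<subseteq> h -` Q" by blast
  qed
  ultimately have "vertices H \<subseteq> h -` P \<or> vertices H \<subseteq> h -` Q" by (intro separation)
  then show ?thesis unfolding h(3) by blast
qed

lemma copy_separationE:
  assumes "K \<in> copies H" "\<And>e. e \<in> K \<Longrightarrow> e \<subseteq> P \<or> e \<subseteq> Q" "P \<inter> Q \<inter> \<Union>K \<subseteq> {x, y}"
  shows "\<Union>K \<subseteq> P \<or> \<Union>K \<subseteq> Q"
proof (rule copy_separation[OF assms(1,2)])
  have "card (P \<inter> Q \<inter> \<Union>K) \<le> card {x, y}" by (rule card_mono) (use assms(3) in auto)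
  also have "\<dots> \<le> 2" by (simp add: card_insert_if)
  finally show "card (P \<inter> Q \<inter> \<Union>K) \<le> 2" .
qed

text \<open>If \<open>e\<close> were the only edge of the copy at \<open>u\<close>, then
  \<open>e\<close> and the vertices other than \<open>u\<close> would be two sides meeting only in
  the other end of \<open>e\<close>. So the copy would lie within \<open>e\<close>, although it has
  at least three vertices.\<close>

lemma copy_degree:
  assumes K: "K \<in> copies H" and e: "e \<in> K" "u \<in> e"
  shows "\<exists>e'\<in>K. e' \<noteq> e \<and> u \<in> e'"
proof (rule ccontr)
  assume "\<not> ?thesis"
  then have "\<And>e'. e' \<in> K \<Longrightarrow> e' \<subseteq> e \<or> e' \<subseteq> \<Union>K - {u}" by blast
  moreover obtain x y where "e = {x, y}" using copy_card_edge[OF K e(1)] by (auto simp: card_2_iff)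
  ultimately have "\<Union>K \<subseteq> e \<or> \<Union>K \<subseteq> \<Union>K - {u}" by (intro copy_separationE[OF K, of _ _ x y]) auto
  then have "card (\<Union>K) \<le> card e" using e copy_card_edge[OF K e(1)] by (metis DiffD2 UnionI card.infinite card_mono insertI1 subsetD zero_neq_numeral)
  then show False using copy_card_edge[OF K e(1)] copy_card_Union[OF K] card_vertices by simp
qed

lemma copy_two_edges:
  assumes "K \<in> copies H"
  shows "\<exists>e\<in>K. e \<noteq> f"
proof -
  have "card (\<Union>K) \<noteq> 0" using copy_card_Union[OF assms] card_vertices by simp
  then obtain u e where ue: "u \<in> e" "e \<in> K" by (metis UnionE all_not_in_conv card.empty)
  from copy_degree[OF assms ue(2,1)] ue show ?thesis by metis
qed

section \<open>Transport of colourings along injections, and Ramsey's theorem\<close>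

lemma good_pullback:
  assumes "good H q ((`) f ` E) c" "inj_on f (\<Union>E)"
  shows "good H q E (\<lambda>e. c (f ` e))"
  unfolding good_def
proof (intro conjI ballI impI notI)
  show "(\<lambda>e. c (f ` e)) ` E \<subseteq> {1..q}" using goodD(1)[OF assms(1)] by blast
  fix K assume K: "K \<in> copies H" "K \<subseteq> E" and "\<exists>i. \<forall>e\<in>K. c (f ` e) = i"
  then obtain i where "\<forall>e\<in>(`) f ` K. c e = i" by auto
  moreover have "(`) f ` K \<in> copies H"
    using K by (intro copy_image inj_on_subset[OF assms(2)]) auto
  ultimately show False using goodD(2)[OF assms(1)] K(2) by (meson image_mono)
qed

lemma good_pushforward:
  assumes "good H q E c" "inj_on f (\<Union>E)"
  obtains c' where "good H q ((`) f ` E) c'" "\<And>e. e \<in> E \<Longrightarrow> c' (f ` e) = c e"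
proof
  let ?g = "inv_into (\<Union>E) f"
  have g: "?g ` f ` e = e" if "e \<in> E" for e
    using that assms(2) by (metis Sup_upper inv_into_image_cancel)
  have img: "(`) ?g ` (`) f ` E = E" using g by (simp add: image_image)
  moreover have "inj_on ?g (\<Union>((`) f ` E))" by (rule inj_on_inv_into) auto
  ultimately show "good H q ((`) f ` E) (\<lambda>e. c (?g ` e))" using good_pullback[of q ?g "(`) f ` E" c] assms(1) by simp
  show "c (?g ` f ` e) = c e" if "e \<in> E" for e using g[OF that] by simp
qed

lemma ex_not_good: "\<exists>E :: nat set set. edge_set E \<and> \<not> (\<exists>c. good H q E c)"
proof -
  let ?k = "card (vertices H)"
  obtain N :: nat where N: "partn_lst {..<N} (replicate q ?k) 2" using ramsey_full by blast
  let ?E = "nsets {..<N} 2"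
  have "edge_set ?E" by (auto simp: edge_set_def nsets_def intro: finite_imp_finite_nsets)
  moreover have "\<not> good H q ?E c" for c
  proof
    assume c: "good H q ?E c"
    \<comment> \<open>\<open>partn_lst\<close> numbers its colours from \<open>0\<close>, hence the
      shift by one.\<close>
    have "(\<lambda>e. c e - 1) \<in> ?E \<rightarrow> {..<length (replicate q ?k)}"
      using goodD(1)[OF c] by fastforce
    then obtain i where i: "i < q" "monochromatic {..<N} (replicate q ?k ! i) 2 (\<lambda>e. c e - 1) i"
      using N unfolding partn_lst_def by auto
    then obtain A where A: "A \<in> nsets {..<N} ?k" "\<And>e. e \<in> nsets A 2 \<Longrightarrow> c e - 1 = i"
      unfolding monochromatic_def by auto
    then have "finite A" "card A = ?k" "A \<subseteq> {..<N}" by (auto simp: nsets_def)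
    then obtain h where h: "bij_betw h (vertices H) A" using finite_H finite_same_card_bij by metis
    have "h ` e \<in> nsets A 2" if "e \<in> edges H" for e
    proof -
      have e: "e \<subseteq> vertices H" "card e = 2" using that simple by (auto simp: fin_simple_graph_def)
      then have "card (h ` e) = 2" using h by (metis bij_betw_def card_image inj_on_subset)
      moreover have "h ` e \<subseteq> A" using e h by (auto simp: bij_betw_def)
      ultimately show ?thesis by (auto simp: nsets_def intro: card_ge_0_finite)
    qed
    then have "(`) h ` edges H \<subseteq> nsets A 2" by blast
    moreover have "nsets A 2 \<subseteq> ?E" using \<open>A \<subseteq> {..<N}\<close> by (rule nsets_mono)
    moreover have "c e = Suc i" if "e \<in> nsets A 2" for e
      using A(2)[OF that] goodD(1)[OF c, of e] that \<open>nsets A 2 \<subseteq> ?E\<close> by fastforce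
    moreover have "(`) h ` edges H \<in> copies H" using h unfolding copies_def bij_betw_def by blast
    ultimately show False using goodD(2)[OF c, of "(`) h ` edges H" "Suc i"] by blast
  qed
  ultimately show ?thesis by blast
qed

lemma minimal_not_good:
  assumes "finite E" "\<not> (\<exists>c. good H q E c)"
  obtains E' where "E' \<subseteq> E" "\<not> (\<exists>c. good H q E' c)" "\<And>e. e \<in> E' \<Longrightarrow> \<exists>c. good H q (E' - {e}) c"
proof -
  let ?P = "\<lambda>E'. E' \<subseteq> E \<and> \<not> (\<exists>c. good H q E' c)"
  have "?P E" using assms by simp
  from ex_has_least_nat[of ?P, OF this, of card] obtain E' where
    E': "E' \<subseteq> E" "\<not> (\<exists>c. good H q E' c)"
      "\<And>D. D \<subseteq> E \<Longrightarrow> \<not> (\<exists>c. good H q D c) \<Longrightarrow> card E' \<le> card D"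
    by metis
  moreover have "\<exists>c. good H q (E' - {e}) c" if "e \<in> E'" for e
  proof (rule ccontr)
    assume "\<not> ?thesis"
    then have "card E' \<le> card (E' - {e})" using E'(1) by (intro E'(3)) auto
    moreover have "finite E'" using E' assms(1) finite_subset by blast
    ultimately show False using that by (meson card_Diff1_less leD)
  qed
  ultimately show ?thesis using that[of E'] E'(1,2) by blast
qed

end

section \<open>Gluing along a star\<close>

text \<open>The constraint that \<open>S\<close> represents: the relation on colour vectors
  \<open>p\<close> of the star edges from \<open>v\<close> to \<open>W\<close> that is realised by
  good colourings of \<open>S\<close>.\<close>

definition attains :: "'a graph \<Rightarrow> nat \<Rightarrow> nat set set \<Rightarrow> nat \<Rightarrow> nat set \<Rightarrow> (nat \<Rightarrow> nat) \<Rightarrow> bool" where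
  "attains H q S v W p \<longleftrightarrow> (\<exists>c. good H q S c \<and> (\<forall>w\<in>W. c {v, w} = p w))"

text \<open>Indexed, since the constraints keep their names while their sets of variables are
  modified. One leaf is enough from here on, as these systems are not amalgamated further.\<close>

definition sparse_family :: "nat \<Rightarrow> 'i set \<Rightarrow> ('i \<Rightarrow> 'b set) \<Rightarrow> bool" where
  "sparse_family L I A \<longleftrightarrow> (\<forall>J\<subseteq>I. 2 \<le> card J \<and> card J \<le> L \<longrightarrow>
     (\<exists>a\<in>J. card (A a \<inter> (\<Union>b\<in>J - {a}. A b)) \<le> 1))"

lemma sparse_familyD:
  "sparse_family L I A \<Longrightarrow> J \<subseteq> I \<Longrightarrow> 2 \<le> card J \<Longrightarrow> card J \<le> L \<Longrightarrow>
    \<exists>a\<in>J. card (A a \<inter> (\<Union>b\<in>J - {a}. A b)) \<le> 1"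
  by (simp add: sparse_family_def)

context inseparable_graph
begin

text \<open>Because of this, sparsity up to \<open>card (edges H)\<close> also covers pairs, so any
  two parts of a star amalgam share at most one variable.\<close>

lemma two_le_card_edges: "2 \<le> card (edges H)"
proof -
  have K: "(`) id ` edges H \<in> copies H" unfolding copies_def by (intro CollectI exI[of _ id]) auto
  then have K: "edges H \<in> copies H" by simp
  obtain e where e: "e \<in> edges H" using copy_two_edges[OF K] by blast
  obtain f where f: "f \<in> edges H" "f \<noteq> e" using copy_two_edges[OF K, of e] by blast
  have "card {e, f} \<le> card (edges H)" by (rule card_mono) (use e f finite_H in auto)
  then show ?thesis using f by simp
qed

text \<open>The parts used by a copy form a sparse subsystem, so if there are at least two of them, one
  meets the others in the centre and at most one further vertex, which cannot separate the copy.\<close>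

lemma copy_in_star_amalgam:
  assumes v: "v \<notin> X"
    and inter: "\<And>a b. a \<in> I \<Longrightarrow> b \<in> I \<Longrightarrow> a \<noteq> b \<Longrightarrow> \<Union>(T a) \<inter> \<Union>(T b) \<subseteq> insert v X"
    and star: "\<And>a x. a \<in> I \<Longrightarrow> x \<in> X \<Longrightarrow> x \<in> \<Union>(T a) \<Longrightarrow> {v, x} \<in> T a"
    and fin: "\<And>a. a \<in> I \<Longrightarrow> finite (\<Union>(T a))"
    and sp: "sparse_family (card (edges H)) I (\<lambda>a. X \<inter> \<Union>(T a))"
    and K: "K \<in> copies H" "K \<subseteq> (\<lambda>x. {v, x}) ` X \<union> (\<Union>a\<in>I. T a)"
  shows "\<exists>a\<in>I. K \<subseteq> T a"
proof -
  let ?Z = "(\<lambda>x. {v, x}) ` X"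
  have "\<forall>e\<in>K - ?Z. \<exists>a. a \<in> I \<and> e \<in> T a" using K(2) by blast
  from bchoice[OF this] obtain f where f: "\<And>e. e \<in> K - ?Z \<Longrightarrow> f e \<in> I \<and> e \<in> T (f e)" by blast
  define J where "J = f ` (K - ?Z)"
  have JI: "J \<subseteq> I" using f by (auto simp: J_def)
  have finJ: "finite J" using copy_finite(1)[OF K(1)] by (simp add: J_def)
  \<comment> \<open>Each part in \<open>J\<close> is charged to an edge of the copy; this is the
    origin of the sparsity bound \<open>card (edges H)\<close>.\<close>
  have cardJ: "card J \<le> card (edges H)"
    using card_image_le[of "K - ?Z" f] card_mono[of K "K - ?Z"] copy_finite(1)[OF K(1)] copy_card_le[OF K(1)]
    by (auto simp: J_def)
  \<comment> \<open>Star edges need not determine a part. But a vertex other than \<open>v\<close>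
    has degree at least two in the copy and lies on at most one star edge, so it also lies on an
    edge to which \<open>f\<close> assigns a part.\<close>
  have nonstar: "\<exists>e\<in>K - ?Z. u \<in> e" if u: "u \<in> \<Union>K" "u \<noteq> v" for u
  proof -
    obtain e where e: "e \<in> K" "u \<in> e" using u by blast
    obtain e' where e': "e' \<in> K" "e' \<noteq> e" "u \<in> e'" using copy_degree[OF K(1) e] by blast
    have "e = {v, u}" if "e \<in> ?Z" using that e(2) u(2) by auto
    moreover have "e' = {v, u}" if "e' \<in> ?Z" using that e'(3) u(2) by auto
    ultimately show ?thesis using e e' by blast
  qed
  have covered: "\<exists>a\<in>J. u \<in> \<Union>(T a)" if "u \<in> \<Union>K" "u \<noteq> v" for u
    using nonstar[OF that] f unfolding J_def by blast
  have "2 \<le> card (\<Union>K)" using copy_card_Union[OF K(1)] card_vertices by simp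
  then have "\<exists>u\<in>\<Union>K. u \<noteq> v"
    by (metis One_nat_def card_le_Suc0_iff_eq copy_finite(2)[OF K(1)] not_less_eq_eq numeral_2_eq_2)
  then obtain a0 where a0: "a0 \<in> J" using covered by blast
  show ?thesis
  proof (cases "J = {a0}")
    case True
    have "e \<in> T a0" if e: "e \<in> K" for e
    proof (cases "e \<in> ?Z")
      case Z: True
      then obtain x where x: "x \<in> X" "e = {v, x}" by blast
      then have "x \<in> \<Union>(T a0)" using covered[of x] e v True by auto
      then show ?thesis using star[of a0 x] x a0 JI by blast
    next
      case False
      then have "f e \<in> J" using e by (simp add: J_def)
      then show ?thesis using True f[of e] False e by auto
    qed
    then show ?thesis using a0 JI by blast
  next
    case False
    then obtain b0 where "b0 \<in> J" "b0 \<noteq> a0" using a0 by blast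
    then have "card {a0, b0} \<le> card J" using a0 finJ by (intro card_mono) auto
    then have "2 \<le> card J" using \<open>b0 \<noteq> a0\<close> by simp
    from sparse_familyD[OF sp JI this cardJ] obtain a where a: "a \<in> J"
      "card (X \<inter> \<Union>(T a) \<inter> (\<Union>b\<in>J - {a}. X \<inter> \<Union>(T b))) \<le> 1" by blast
    let ?Y = "X \<inter> \<Union>(T a) \<inter> (\<Union>b\<in>J - {a}. X \<inter> \<Union>(T b))"
    have finY: "finite ?Y" using fin a(1) JI by blast
    have "\<exists>x. ?Y \<subseteq> {x}"
    proof (cases "?Y = {}")
      case True
      then show ?thesis by blast
    next
      case False
      then obtain x where "x \<in> ?Y" by blast
      moreover have "\<forall>y\<in>?Y. \<forall>z\<in>?Y. y = z" using a(2) finY by (simp add: card_le_Suc0_iff_eq)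
      ultimately show ?thesis by blast
    qed
    then obtain x where x: "?Y \<subseteq> {x}" by blast
    let ?P = "insert v (\<Union>(T a))" and ?Q = "insert v (\<Union>b\<in>J - {a}. \<Union>(T b))"
    have PQ: "?P \<inter> ?Q \<subseteq> {v, x}"
    proof
      fix z assume z: "z \<in> ?P \<inter> ?Q"
      show "z \<in> {v, x}"
      proof (cases "z = v")
        case False
        then obtain b where b: "b \<in> J - {a}" "z \<in> \<Union>(T b)" "z \<in> \<Union>(T a)" using z by blast
        then have "z \<in> X" using inter[of a b] a(1) JI False by blast
        then have "z \<in> ?Y" using b by blast
        then show ?thesis using x by blast
      qed simp
    qed
    have sub: "e \<subseteq> ?P" if "e \<in> K - ?Z" "f e = a" for e using f[OF that(1)] that(2) by blast
    have sub': "e \<subseteq> ?Q" if "e \<in> K - ?Z" "f e \<noteq> a" for e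
    proof -
      have "f e \<in> J - {a}" using that by (simp add: J_def)
      then show ?thesis using f[OF that(1)] by blast
    qed
    \<comment> \<open>The overlap of the two sides lies in \<open>{v, x}\<close>. An edge within it
      is \<open>{v, x}\<close> with \<open>x\<close> in \<open>X\<close>, hence a star edge. As both
      sides own an edge that is no star edge, neither can swallow the other.\<close>
    have noth: False if "e \<in> K - ?Z" "e \<subseteq> ?P \<inter> ?Q" for e
    proof -
      have ex: "e \<subseteq> {v, x}" using that PQ by blast
      have "card e = 2" using copy_card_edge[OF K(1)] that by blast
      then have "x \<in> e" "e = {v, x}" "x \<noteq> v" using ex by (auto simp: card_2_iff)
      then have "x \<in> ?P \<inter> ?Q" using that by blast
      then have "x \<in> \<Union>(T a)" "\<exists>b\<in>J - {a}. x \<in> \<Union>(T b)" using \<open>x \<noteq> v\<close> by auto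
      then have "x \<in> X" using inter a(1) JI \<open>x \<noteq> v\<close> by blast
      then show False using that \<open>e = {v, x}\<close> by blast
    qed
    have "\<Union>K \<subseteq> ?P \<or> \<Union>K \<subseteq> ?Q"
    proof (rule copy_separationE[OF K(1), where x = v and y = x])
      fix e assume e: "e \<in> K"
      show "e \<subseteq> ?P \<or> e \<subseteq> ?Q"
      proof (cases "e \<in> ?Z")
        case True
        then obtain y where y: "y \<in> X" "e = {v, y}" by blast
        then obtain b where "b \<in> J" "y \<in> \<Union>(T b)" using covered[of y] e v by auto
        then show ?thesis using y by blast
      next
        case False
        then show ?thesis using sub sub' e by blast
      qed
    qed (use PQ in blast)
    then show ?thesis
    proof
      assume P: "\<Union>K \<subseteq> ?P"
      obtain b where "b \<in> J" "b \<noteq> a" using \<open>b0 \<in> J\<close> \<open>b0 \<noteq> a0\<close> a0 by blast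
      then obtain e where e: "e \<in> K - ?Z" "f e \<noteq> a" unfolding J_def by blast
      then have "e \<subseteq> ?P \<inter> ?Q" using sub'[OF e] P by blast
      then show ?thesis using noth[OF e(1)] by blast
    next
      assume Q: "\<Union>K \<subseteq> ?Q"
      obtain e where e: "e \<in> K - ?Z" "f e = a" using a(1) unfolding J_def by blast
      then have "e \<subseteq> ?P \<inter> ?Q" using sub[OF e] Q by blast
      then show ?thesis using noth[OF e(1)] by blast
    qed
  qed
qed

text \<open>This translates constraint systems into graphs. The value of a variable \<open>x\<close>
  is the colour of \<open>{u, \<iota> x}\<close>, and each \<open>a\<close> in \<open>I\<close>
  contributes a copy of \<open>S\<close> placed on its variables through \<open>\<beta> a\<close>.
  Good colourings of \<open>G\<close> restrict to solutions of the system, and every solution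
  extends to a good colouring, since no copy of \<open>H\<close> uses several parts.\<close>

lemma star_amalgam:
  fixes S :: "nat set set" and \<beta> :: "'i \<Rightarrow> nat \<Rightarrow> nat"
  assumes S: "edge_set S" "finite W" "v \<notin> W" "\<And>w. w \<in> W \<Longrightarrow> {v, w} \<in> S"
    and I: "finite I" "\<And>a. a \<in> I \<Longrightarrow> inj_on (\<beta> a) W"
    and X: "finite X" "\<And>a. a \<in> I \<Longrightarrow> \<beta> a ` W \<subseteq> X"
    and sp: "sparse_family (card (edges H)) I (\<lambda>a. \<beta> a ` W)"
  obtains G :: "nat set set" and u :: nat and \<iota> :: "nat \<Rightarrow> nat"
  where "edge_set G" "inj \<iota>" "u \<notin> range \<iota>" "\<And>x. x \<in> X \<Longrightarrow> {u, \<iota> x} \<in> G"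
    "\<And>c a. good H q G c \<Longrightarrow> a \<in> I \<Longrightarrow> attains H q S v W (\<lambda>w. c {u, \<iota> (\<beta> a w)})"
    "\<And>d. d ` X \<subseteq> {1..q} \<Longrightarrow> \<forall>a\<in>I. attains H q S v W (d \<circ> \<beta> a) \<Longrightarrow>
      \<exists>c. good H q G c \<and> (\<forall>x\<in>X. c {u, \<iota> x} = d x)"
proof -
  obtain code :: "'i \<Rightarrow> nat" where code: "inj_on code I"
    using finite_imp_inj_to_nat_seg[OF I(1)] by metis
  \<comment> \<open>Codes: \<open>(0, 0)\<close> is the centre, \<open>(0, Suc x)\<close> the
    variable \<open>x\<close>, and \<open>(Suc (code a), _)\<close> are private vertices of the copy
    \<open>a\<close>.\<close>
  define \<iota> :: "nat \<Rightarrow> nat" where "\<iota> x = prod_encode (0, Suc x)" for x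
  define u :: nat where "u = prod_encode (0, 0)"
  define \<phi> where "\<phi> a x = (if x = v then u else if x \<in> W then \<iota> (\<beta> a x) else prod_encode (Suc (code a), x))" for a x
  define T where "T a = (`) (\<phi> a) ` S" for a
  define Z where "Z = (\<lambda>x. {u, x}) ` \<iota> ` X"
  define G where "G = Z \<union> (\<Union>a\<in>I. T a)"
  have inj\<iota>: "inj \<iota>" and u: "u \<notin> range \<iota>" by (auto simp: \<iota>_def u_def inj_on_def)
  have inj\<phi>: "inj_on (\<phi> a) B" if "a \<in> I" for a B
    using I(2)[OF that] by (auto simp: inj_on_def \<phi>_def \<iota>_def u_def split: if_splits)
  have \<phi>v: "\<phi> a v = u" and \<phi>w: "w \<in> W \<Longrightarrow> \<phi> a w = \<iota> (\<beta> a w)" for a w using S(3) by (auto simp: \<phi>_def)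
  have UT: "\<Union>(T a) = \<phi> a ` \<Union>S" for a unfolding T_def by blast
  have XT: "\<iota> ` X \<inter> \<Union>(T a) = \<iota> ` \<beta> a ` W" if "a \<in> I" for a
  proof
    show "\<iota> ` X \<inter> \<Union>(T a) \<subseteq> \<iota> ` \<beta> a ` W"
      unfolding UT by (auto simp: \<phi>_def \<iota>_def u_def split: if_splits)
    show "\<iota> ` \<beta> a ` W \<subseteq> \<iota> ` X \<inter> \<Union>(T a)"
    proof
      fix z assume "z \<in> \<iota> ` \<beta> a ` W"
      then obtain w where w: "w \<in> W" "z = \<iota> (\<beta> a w)" by blast
      then have "z = \<phi> a w" "w \<in> \<Union>S" using S(4) by (auto simp: \<phi>w)
      then show "z \<in> \<iota> ` X \<inter> \<Union>(T a)" using X(2)[OF that] w unfolding UT by blast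
    qed
  qed
  have starT: "{u, \<iota> (\<beta> a w)} = \<phi> a ` {v, w}" if "w \<in> W" for a w using that by (simp add: \<phi>v \<phi>w)
  have edgeT: "edge_set (T a)" if "a \<in> I" for a
    unfolding T_def by (rule edge_set_image[OF S(1) inj\<phi>[OF that]])
  have inter: "\<Union>(T a) \<inter> \<Union>(T b) \<subseteq> insert u (\<iota> ` X)" if "a \<in> I" "b \<in> I" "a \<noteq> b" for a b
  proof
    fix z assume "z \<in> \<Union>(T a) \<inter> \<Union>(T b)"
    then obtain x y where xy: "z = \<phi> a x" "z = \<phi> b y" unfolding UT by blast
    moreover have "code a \<noteq> code b" using that code by (auto simp: inj_on_def)
    ultimately have "x = v \<or> x \<in> W" by (auto simp: \<phi>_def \<iota>_def u_def split: if_splits)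
    then show "z \<in> insert u (\<iota> ` X)" using xy(1) X(2)[OF that(1)] by (auto simp: \<phi>v \<phi>w)
  qed
  have spT: "sparse_family (card (edges H)) I (\<lambda>a. \<iota> ` X \<inter> \<Union>(T a))"
    unfolding sparse_family_def
  proof (intro allI impI)
    fix J assume J: "J \<subseteq> I" "2 \<le> card J \<and> card J \<le> card (edges H)"
    from sparse_familyD[OF sp J(1)] J(2) obtain a where
      a: "a \<in> J" "card (\<beta> a ` W \<inter> (\<Union>b\<in>J - {a}. \<beta> b ` W)) \<le> 1" by blast
    have "\<iota> ` X \<inter> \<Union>(T a) \<inter> (\<Union>b\<in>J - {a}. \<iota> ` X \<inter> \<Union>(T b)) = \<iota> ` \<beta> a ` W \<inter> (\<Union>b\<in>J - {a}. \<iota> ` \<beta> b ` W)"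
    proof -
      have "(\<Union>b\<in>J - {a}. \<iota> ` X \<inter> \<Union>(T b)) = (\<Union>b\<in>J - {a}. \<iota> ` \<beta> b ` W)"
        by (rule SUP_cong[OF refl], rule XT) (use J(1) in blast)
      moreover have "\<iota> ` X \<inter> \<Union>(T a) = \<iota> ` \<beta> a ` W" by (rule XT) (use J(1) a(1) in blast)
      ultimately show ?thesis by (simp only:)
    qed
    also have "\<dots> = \<iota> ` (\<beta> a ` W \<inter> (\<Union>b\<in>J - {a}. \<beta> b ` W))"
      by (simp add: image_Int[OF inj\<iota>] image_UN)
    finally have "card (\<iota> ` X \<inter> \<Union>(T a) \<inter> (\<Union>b\<in>J - {a}. \<iota> ` X \<inter> \<Union>(T b))) \<le> 1"
      using a(2) card_image[OF inj_on_subset[OF inj\<iota> subset_UNIV]] by simp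
    then show "\<exists>a\<in>J. card (\<iota> ` X \<inter> \<Union>(T a) \<inter> (\<Union>b\<in>J - {a}. \<iota> ` X \<inter> \<Union>(T b))) \<le> 1" using a(1) by blast
  qed
  have star: "{u, x} \<in> T a" if "a \<in> I" "x \<in> \<iota> ` X" "x \<in> \<Union>(T a)" for a x
  proof -
    have "x \<in> \<iota> ` \<beta> a ` W" using that XT by blast
    then obtain w where "w \<in> W" "x = \<iota> (\<beta> a w)" by blast
    then show ?thesis using starT[of w a] S(4) unfolding T_def by (metis imageI)
  qed
  have cover: "\<exists>a\<in>I. K \<subseteq> T a" if "K \<in> copies H" "K \<subseteq> G" for K
  proof (rule copy_in_star_amalgam[OF _ inter star _ spT that(1)])
    show "u \<notin> \<iota> ` X" using u by blast
    show "finite (\<Union>(T a))" if "a \<in> I" for a using edge_setD(4)[OF edgeT[OF that]] .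
    show "K \<subseteq> (\<lambda>x. {u, x}) ` \<iota> ` X \<union> (\<Union>a\<in>I. T a)" using that(2) by (simp add: G_def Z_def)
  qed
  have "edge_set Z" unfolding edge_set_def Z_def using X(1) u by (auto simp: card_insert_if)
  then have "edge_set G" unfolding G_def by (intro edge_set_Un edge_set_UN I(1) edgeT)
  moreover have "{u, \<iota> x} \<in> G" if "x \<in> X" for x using that by (simp add: G_def Z_def)
  moreover have "attains H q S v W (\<lambda>w. c {u, \<iota> (\<beta> a w)})" if "good H q G c" "a \<in> I" for c a
  proof -
    have "good H q (T a) c" by (rule good_subset[OF that(1)]) (use that(2) in \<open>auto simp: G_def\<close>)
    then have "good H q S (\<lambda>e. c (\<phi> a ` e))"
      unfolding T_def by (rule good_pullback) (rule inj\<phi>[OF that(2)])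
    then show ?thesis unfolding attains_def by (intro exI[of _ "\<lambda>e. c (\<phi> a ` e)"]) (simp add: \<phi>v \<phi>w)
  qed
  moreover have "\<exists>c. good H q G c \<and> (\<forall>x\<in>X. c {u, \<iota> x} = d x)"
    if d: "d ` X \<subseteq> {1..q}" and att: "\<forall>a\<in>I. attains H q S v W (d \<circ> \<beta> a)" for d
  proof -
    have "\<forall>a\<in>I. \<exists>g. good H q (T a) g \<and> (\<forall>w\<in>W. g {u, \<iota> (\<beta> a w)} = d (\<beta> a w))"
    proof
      fix a assume a: "a \<in> I"
      obtain c where c: "good H q S c" "\<forall>w\<in>W. c {v, w} = d (\<beta> a w)"
        using bspec[OF att a] unfolding attains_def by auto
      obtain g where "good H q ((`) (\<phi> a) ` S) g" "\<And>e. e \<in> S \<Longrightarrow> g (\<phi> a ` e) = c e"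
        using good_pushforward[OF c(1) inj\<phi>[OF a]] by blast
      then show "\<exists>g. good H q (T a) g \<and> (\<forall>w\<in>W. g {u, \<iota> (\<beta> a w)} = d (\<beta> a w))"
        using c(2) S(4) unfolding T_def starT[symmetric]
        by (intro exI[of _ g]) (metis starT)
    qed
    from bchoice[OF this] obtain g where
      g: "\<And>a. a \<in> I \<Longrightarrow> good H q (T a) (g a)" "\<And>a w. a \<in> I \<Longrightarrow> w \<in> W \<Longrightarrow> g a {u, \<iota> (\<beta> a w)} = d (\<beta> a w)"
      by blast
    define z where "z e = d (SOME x. e = {u, \<iota> x})" for e
    have z: "z {u, \<iota> x} = d x" for x
    proof -
      have "(SOME y. {u, \<iota> x} = {u, \<iota> y}) = x"
        by (rule some_equality) (use inj\<iota> u in \<open>auto simp: doubleton_eq_iff inj_def\<close>)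
      then show ?thesis by (simp add: z_def)
    qed
    have gz: "g a e = z e" if aI: "a \<in> I" and "e \<in> T a" "e \<in> Z" for a e
    proof -
      obtain x where x: "e = {u, \<iota> x}" "x \<in> X" using \<open>e \<in> Z\<close> by (auto simp: Z_def)
      then have "\<iota> x \<in> \<iota> ` X \<inter> \<Union>(T a)" using that by blast
      then obtain w where "w \<in> W" "x = \<beta> a w" using XT[OF aI] inj\<iota> by (auto simp: inj_def)
      then show ?thesis using g(2)[OF aI] x z by simp
    qed
    \<comment> \<open>Sparsity of the pair leaves at most one common vertex besides the centre, so
      an edge common to two parts is a star edge. There all colourings agree with the prescribed
      values \<open>d\<close>.\<close>
    have TT: "e \<in> Z" if "a \<in> I" "b \<in> I" and ne: "a \<noteq> b" and "e \<in> T a" "e \<in> T b" for a b e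
    proof -
      have "2 \<le> card {a, b}" "card {a, b} \<le> card (edges H)" "{a, b} \<subseteq> I"
        using that two_le_card_edges by auto
      from sparse_familyD[OF spT this(3,1,2)] obtain a' b' where ab: "{a', b'} = {a, b}" "a' \<noteq> b'"
        "card (\<iota> ` X \<inter> \<Union>(T a') \<inter> (\<iota> ` X \<inter> \<Union>(T b'))) \<le> 1"
        using ne by (auto simp: insert_Diff_if)
      let ?Y = "\<iota> ` X \<inter> \<Union>(T a') \<inter> (\<iota> ` X \<inter> \<Union>(T b'))"
      have ab': "a' \<in> I" "b' \<in> I" "e \<in> T a'" "e \<in> T b'" using ab(1) that by (auto simp: doubleton_eq_iff)
      have fin: "finite ?Y" using X(1) by simp
      have "\<forall>y\<in>?Y. \<forall>y'\<in>?Y. y = y'"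
        using ab(3) unfolding One_nat_def card_le_Suc0_iff_eq[OF fin] .
      then have eq: "y = y'" if "y \<in> ?Y" "y' \<in> ?Y" for y y' using that by (elim ballE) auto
      have sub: "e \<subseteq> insert u ?Y" using inter[OF ab'(1,2) ab(2)] ab'(3,4) by blast
      obtain x y where "e = {x, y}" "x \<noteq> y" using edge_setD(2)[OF edgeT[OF ab'(1)] ab'(3)] by (auto simp: card_2_iff)
      then have "\<exists>y\<in>?Y. e = {u, y}" using sub eq[of x y] by auto
      then show ?thesis unfolding Z_def by blast
    qed
    have "\<exists>c. \<forall>a\<in>I. \<forall>e\<in>T a. c e = g a e"
      by (rule glue_functions) (metis TT gz)
    then obtain c0 where c0: "\<And>a e. a \<in> I \<Longrightarrow> e \<in> T a \<Longrightarrow> c0 e = g a e" by blast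
    define c where "c e = (if e \<in> Z then z e else c0 e)" for e
    have cT: "c e = g a e" if "a \<in> I" "e \<in> T a" for a e using that gz c0 by (auto simp: c_def)
    have cZ: "c {u, \<iota> x} = d x" if "x \<in> X" for x using that z by (simp add: c_def Z_def)
    have "good H q G c"
    proof (rule good_covered[where I = I and T = T])
      show "good H q (T a) c" if "a \<in> I" for a by (rule good_cong[OF g(1)[OF that]]) (rule cT[OF that])
      then have "c e \<in> {1..q}" if "e \<in> T a" "a \<in> I" for a e using goodD(1) that by blast
      moreover have "c e \<in> {1..q}" if "e \<in> Z" for e using that cZ d unfolding Z_def by fastforce
      ultimately show "c ` G \<subseteq> {1..q}" unfolding G_def by blast
    qed (rule cover)
    then show ?thesis using cZ by blast
  qed
  ultimately show ?thesis using that[of G \<iota> u] inj\<iota> u by blast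
qed

end

section \<open>Star senders\<close>

lemma attains_cong: "(\<And>w. w \<in> W \<Longrightarrow> p w = p' w) \<Longrightarrow> attains H q S v W p \<longleftrightarrow> attains H q S v W p'"
  by (simp add: attains_def)

lemma sparse_family_subset: "sparse_family L I A \<Longrightarrow> J \<subseteq> I \<Longrightarrow> sparse_family L J A"
  unfolding sparse_family_def by (meson subset_trans)

text \<open>Each hyperedge of an uncolourable hypergraph carries one constraint. Every assignment is
  constant on some hyperedge, and the constraint there rejects constant vectors.\<close>

lemma unsatisfiable_family:
  assumes "\<And>i. \<not> attains H q S v W (\<lambda>_. i)" "finite W"
  obtains \<H> :: "nat set set" and \<beta> :: "nat set \<Rightarrow> nat \<Rightarrow> nat"
  where "finite \<H>" "\<And>A. A \<in> \<H> \<Longrightarrow> inj_on (\<beta> A) W" "sparse_family L \<H> (\<lambda>A. \<beta> A ` W)"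
    "\<And>d. range d \<subseteq> {1..q} \<Longrightarrow> \<exists>A\<in>\<H>. \<not> attains H q S v W (d \<circ> \<beta> A)"
proof -
  obtain \<H> :: "nat set set" where Hf: "finite \<H> \<and> (\<forall>A\<in>\<H>. finite A \<and> card A = card W) \<and>
      sparse L \<H> \<and> uncolourable q \<H>"
    using sparse_uncolourable_hypergraph[of "card W" L q] by (elim exE) (rule that)
  have "\<forall>A\<in>\<H>. \<exists>b. bij_betw b W A" using Hf assms(2) by (metis finite_same_card_bij)
  from bchoice[OF this] obtain \<beta> where \<beta>: "\<And>A. A \<in> \<H> \<Longrightarrow> bij_betw (\<beta> A) W A" by blast
  show ?thesis
  proof (rule that[of \<H> \<beta>])
    show "finite \<H>" using Hf by simp
    show "inj_on (\<beta> A) W" if "A \<in> \<H>" for A using \<beta>[OF that] by (simp add: bij_betw_def)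
    have img: "\<beta> A ` W = A" if "A \<in> \<H>" for A using \<beta>[OF that] by (simp add: bij_betw_def)
    show "sparse_family L \<H> (\<lambda>A. \<beta> A ` W)"
      unfolding sparse_family_def
    proof (intro allI impI)
      fix J assume J: "J \<subseteq> \<H>" "2 \<le> card J \<and> card J \<le> L"
      then obtain A where A: "A \<in> J" "leaf A J" using sparseD[of L \<H> J] Hf by blast
      have "(\<Union>B\<in>J - {A}. \<beta> B ` W) = \<Union>(J - {A})"
      proof -
        have "(\<Union>B\<in>J - {A}. \<beta> B ` W) = (\<Union>B\<in>J - {A}. B)"
          by (rule SUP_cong[OF refl], rule img) (use J(1) in blast)
        then show ?thesis by simp
      qed
      moreover have "\<beta> A ` W = A" using img J(1) A(1) by blast
      ultimately have "card (\<beta> A ` W \<inter> (\<Union>B\<in>J - {A}. \<beta> B ` W)) \<le> 1" using A(2) by (simp add: leaf_def)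
      then show "\<exists>A\<in>J. card (\<beta> A ` W \<inter> (\<Union>B\<in>J - {A}. \<beta> B ` W)) \<le> 1" using A(1) by (rule bexI)
    qed
    fix d :: "nat \<Rightarrow> nat" assume "range d \<subseteq> {1..q}"
    then obtain A i where A: "A \<in> \<H>" "\<And>x. x \<in> A \<Longrightarrow> d x = i" using uncolourableD[of q \<H> d] Hf by blast
    have "\<not> attains H q S v W (d \<circ> \<beta> A)"
    proof
      assume "attains H q S v W (d \<circ> \<beta> A)"
      moreover have "attains H q S v W (d \<circ> \<beta> A) \<longleftrightarrow> attains H q S v W (\<lambda>_. i)"
        by (rule attains_cong) (use A img in auto)
      ultimately show False using assms(1) by simp
    qed
    then show "\<exists>A\<in>\<H>. \<not> attains H q S v W (d \<circ> \<beta> A)" using A(1) by (rule bexI)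
  qed
qed

context inseparable_graph
begin

lemma star_amalgam_solution:
  assumes "1 \<le> q" and ed: "\<And>x. x \<in> X \<Longrightarrow> {u, \<iota> x} \<in> G" and c: "good H q G c"
    and X: "\<And>a. a \<in> I \<Longrightarrow> \<beta> a ` W \<subseteq> X"
    and att: "\<And>c a. good H q G c \<Longrightarrow> a \<in> I \<Longrightarrow> attains H q S v W (\<lambda>w. c {u, \<iota> (\<beta> a w)})"
  obtains d where "range d \<subseteq> {1..q}" "\<And>x. x \<in> X \<Longrightarrow> d x = c {u, \<iota> x}"
    "\<And>a. a \<in> I \<Longrightarrow> attains H q S v W (d \<circ> \<beta> a)"
proof -
  \<comment> \<open>The default \<open>1\<close> only makes the assignment total with values among
    the colours.\<close>
  define d where "d x = (if x \<in> X then c {u, \<iota> x} else 1)" for x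
  show ?thesis
  proof (rule that[of d])
    show "range d \<subseteq> {1..q}" using goodD(1)[OF c ed] assms(1) by (auto simp: d_def)
    show "\<And>x. x \<in> X \<Longrightarrow> d x = c {u, \<iota> x}" by (simp add: d_def)
    show "attains H q S v W (d \<circ> \<beta> a)" if "a \<in> I" for a
    proof -
      have "attains H q S v W (d \<circ> \<beta> a) \<longleftrightarrow> attains H q S v W (\<lambda>w. c {u, \<iota> (\<beta> a w)})"
        by (rule attains_cong) (use X[OF that] in \<open>auto simp: d_def\<close>)
      then show ?thesis using att[OF c that] by simp
    qed
  qed
qed

text \<open>Among the unsatisfiable sparse systems take one with as many variables as possible. Separating
  two occurrences of a variable makes it satisfiable, and every solution must distinguish them.\<close>

lemma negative_star_sender:
  fixes S :: "nat set set"
  assumes S: "edge_set S" "finite W" "v \<notin> W" "\<And>w. w \<in> W \<Longrightarrow> {v, w} \<in> S"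
    and c0: "good H q S c0" and nonconst: "\<And>c i. good H q S c \<Longrightarrow> \<exists>w\<in>W. c {v, w} \<noteq> i"
  obtains N :: "nat set set" and u x y
  where "edge_set N" "u \<noteq> x" "u \<noteq> y" "x \<noteq> y" "{u, x} \<in> N" "{u, y} \<in> N" "\<exists>c. good H q N c"
    "\<And>c. good H q N c \<Longrightarrow> c {u, x} \<noteq> c {u, y}"
proof -
  let ?R = "attains H q S v W"
  let ?L = "card (edges H)"
  have notc: "\<not> ?R (\<lambda>_. i)" for i using nonconst[of _ i] unfolding attains_def by blast
  obtain w0 where "w0 \<in> W" using nonconst[OF c0] by blast
  then have q1: "1 \<le> q" using goodD(1)[OF c0 S(4)] by fastforce
  obtain \<H> :: "nat set set" and \<beta>0 :: "nat set \<Rightarrow> nat \<Rightarrow> nat" where \<beta>0: "finite \<H>" "\<And>A. A \<in> \<H> \<Longrightarrow> inj_on (\<beta>0 A) W"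
    "sparse_family ?L \<H> (\<lambda>A. \<beta>0 A ` W)"
    "\<And>d. range d \<subseteq> {1..q} \<Longrightarrow> \<exists>A\<in>\<H>. \<not> ?R (d \<circ> \<beta>0 A)"
    by (rule unsatisfiable_family[where L = ?L, OF notc S(2)]) (rule that; assumption)
  define sat where "sat \<beta> \<longleftrightarrow> (\<exists>d. range d \<subseteq> {1..q} \<and> (\<forall>A\<in>\<H>. ?R (d \<circ> \<beta> A)))"
    for \<beta> :: "nat set \<Rightarrow> nat \<Rightarrow> nat"
  define P where "P \<beta> \<longleftrightarrow> (\<forall>A\<in>\<H>. inj_on (\<beta> A) W) \<and> sparse_family ?L \<H> (\<lambda>A. \<beta> A ` W) \<and> \<not> sat \<beta>" for \<beta>
  define Var where "Var \<beta> = (\<Union>A\<in>\<H>. \<beta> A ` W)" for \<beta> :: "nat set \<Rightarrow> nat \<Rightarrow> nat"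
  have finVar: "finite (Var \<beta>)" for \<beta> using \<beta>0(1) S(2) by (simp add: Var_def)
  \<comment> \<open>The number of occurrences bounds the number of variables, so a system with the
    most variables exists.\<close>
  have bound: "card (Var \<beta>) < Suc (card \<H> * card W)" for \<beta>
  proof -
    have "card (Var \<beta>) \<le> (\<Sum>A\<in>\<H>. card (\<beta> A ` W))" unfolding Var_def by (rule card_UN_le[OF \<beta>0(1)])
    also have "\<dots> \<le> (\<Sum>A\<in>\<H>. card W)" by (rule sum_mono) (rule card_image_le[OF S(2)])
    finally show ?thesis by simp
  qed
  have "\<not> sat \<beta>0" using \<beta>0(4) unfolding sat_def by metis
  then have "P \<beta>0" using \<beta>0(2,3) by (simp add: P_def)
  then have "\<exists>\<beta>. P \<beta> \<and> (\<forall>\<gamma>. P \<gamma> \<longrightarrow> card (Var \<gamma>) \<le> card (Var \<beta>))"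
    by (rule ex_has_greatest_nat[of P \<beta>0 "\<lambda>\<beta>. card (Var \<beta>)"]) (use bound in blast)
  then obtain \<beta> where \<beta>: "P \<beta>" "\<And>\<gamma>. P \<gamma> \<Longrightarrow> card (Var \<gamma>) \<le> card (Var \<beta>)" by blast
  have inj: "inj_on (\<beta> A) W" if "A \<in> \<H>" for A using \<beta>(1) that by (simp add: P_def)
  \<comment> \<open>With disjoint sets of variables the values of \<open>c0\<close> could be copied
    to each constraint independently. Hence some variable occurs in two constraints.\<close>
  have "\<exists>A\<in>\<H>. \<exists>B\<in>\<H>. A \<noteq> B \<and> \<beta> A ` W \<inter> \<beta> B ` W \<noteq> {}"
  proof (rule ccontr)
    assume disj: "\<not> ?thesis"
    have eq: "A = B" if "A \<in> \<H>" "B \<in> \<H>" "x \<in> \<beta> A ` W" "x \<in> \<beta> B ` W" for A B x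
    proof (rule ccontr)
      assume "A \<noteq> B"
      moreover have "\<beta> A ` W \<inter> \<beta> B ` W \<noteq> {}" using IntI[OF that(3,4)] by auto
      ultimately show False using disj that(1,2) by metis
    qed
    have "\<exists>d. \<forall>A\<in>\<H>. \<forall>x\<in>\<beta> A ` W. d x = c0 {v, inv_into W (\<beta> A) x}"
      by (rule glue_functions) (drule (3) eq, simp)
    then obtain d0 where d0: "\<And>A x. A \<in> \<H> \<Longrightarrow> x \<in> \<beta> A ` W \<Longrightarrow> d0 x = c0 {v, inv_into W (\<beta> A) x}" by blast
    define d where "d x = (if d0 x \<in> {1..q} then d0 x else 1)" for x
    have "range d \<subseteq> {1..q}" using q1 by (auto simp: d_def)
    moreover have "?R (d \<circ> \<beta> A)" if "A \<in> \<H>" for A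
    proof -
      have "c0 {v, w} = d (\<beta> A w)" if "w \<in> W" for w
        using d0[OF \<open>A \<in> \<H>\<close> imageI[OF that]] inv_into_f_f[OF inj[OF \<open>A \<in> \<H>\<close>] that] goodD(1)[OF c0 S(4)[OF that]]
        by (simp add: d_def)
      then show ?thesis unfolding attains_def using c0 by (intro exI[of _ c0]) simp
    qed
    ultimately have "sat \<beta>" unfolding sat_def by blast
    then show False using \<beta>(1) by (simp add: P_def)
  qed
  then obtain A B where AB: "A \<in> \<H>" "B \<in> \<H>" "A \<noteq> B" and "\<beta> A ` W \<inter> \<beta> B ` W \<noteq> {}" by metis
  then obtain w w' where w: "w \<in> W" "w' \<in> W" "\<beta> A w = \<beta> B w'" by auto
  obtain z where z: "z \<notin> Var \<beta>" using finVar[of \<beta>] ex_new_if_finite infinite_UNIV_nat by blast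
  \<comment> \<open>The occurrence of the shared variable in \<open>A\<close> is renamed to the
    fresh \<open>z\<close>, and \<open>B\<close> keeps the old name. No variable is lost and one is
    gained. As \<open>z\<close> lies in only one constraint, no intersection grows, so sparsity
    persists; by maximality the new system must be satisfiable.\<close>
  define \<gamma> where "\<gamma> = \<beta>(A := (\<beta> A)(w := z))"
  have zim: "z \<notin> \<beta> C ` W" if "C \<in> \<H>" for C using z that by (auto simp: Var_def)
  have inj\<gamma>: "inj_on (\<gamma> C) W" if "C \<in> \<H>" for C
    using inj[OF that] zim[OF that] by (auto simp: \<gamma>_def intro: inj_on_fun_updI)
  have sub: "\<gamma> C ` W \<subseteq> insert z (\<beta> C ` W)" "C \<noteq> A \<Longrightarrow> \<gamma> C ` W = \<beta> C ` W" for C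
    by (auto simp: \<gamma>_def)
  have sp\<gamma>: "sparse_family ?L \<H> (\<lambda>A. \<gamma> A ` W)"
    unfolding sparse_family_def
  proof (intro allI impI)
    fix J assume J: "J \<subseteq> \<H>" "2 \<le> card J \<and> card J \<le> ?L"
    have "sparse_family ?L \<H> (\<lambda>A. \<beta> A ` W)" using \<beta>(1) by (simp add: P_def)
    from sparse_familyD[OF this J(1)] J(2) obtain C where
      C: "C \<in> J" "card (\<beta> C ` W \<inter> (\<Union>D\<in>J - {C}. \<beta> D ` W)) \<le> 1" by blast
    have "\<gamma> C ` W \<inter> (\<Union>D\<in>J - {C}. \<gamma> D ` W) \<subseteq> \<beta> C ` W \<inter> (\<Union>D\<in>J - {C}. \<beta> D ` W)"
    proof
      fix y assume "y \<in> \<gamma> C ` W \<inter> (\<Union>D\<in>J - {C}. \<gamma> D ` W)"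
      then obtain D where D: "D \<in> J - {C}" "y \<in> \<gamma> C ` W" "y \<in> \<gamma> D ` W" by blast
      then have CD: "C \<in> \<H>" "D \<in> \<H>" "C \<noteq> D" using C(1) J(1) by auto
      have "y \<noteq> z"
      proof
        assume "y = z"
        then have "C = A" "D = A" using sub(2)[of C] sub(2)[of D] D zim[OF CD(1)] zim[OF CD(2)] by metis+
        then show False using CD(3) by simp
      qed
      then have "y \<in> \<beta> C ` W" "y \<in> \<beta> D ` W" using sub(1) D(2,3) by blast+
      then show "y \<in> \<beta> C ` W \<inter> (\<Union>D\<in>J - {C}. \<beta> D ` W)" using D(1) by blast
    qed
    then have "card (\<gamma> C ` W \<inter> (\<Union>D\<in>J - {C}. \<gamma> D ` W)) \<le> 1"
      by (rule card_le_1_mono) (use S(2) C(2) in simp_all)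
    then show "\<exists>C\<in>J. card (\<gamma> C ` W \<inter> (\<Union>D\<in>J - {C}. \<gamma> D ` W)) \<le> 1" using C(1) by (rule bexI)
  qed
  have Var\<gamma>: "insert z (Var \<beta>) \<subseteq> Var \<gamma>"
  proof
    fix y assume "y \<in> insert z (Var \<beta>)"
    then consider "y = z" | C w1 where "C \<in> \<H>" "w1 \<in> W" "y = \<beta> C w1" "C \<noteq> A \<or> w1 \<noteq> w" | "y = \<beta> A w"
      unfolding Var_def by blast
    then show "y \<in> Var \<gamma>"
    proof cases
      case 1
      then have "y = \<gamma> A w" by (simp add: \<gamma>_def)
      then show ?thesis using AB w by (auto simp: Var_def)
    next
      case 2
      then have "y = \<gamma> C w1" by (auto simp: \<gamma>_def)
      then show ?thesis using 2 by (auto simp: Var_def)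
    next
      case 3
      then have "y = \<gamma> B w'" using w AB by (simp add: \<gamma>_def)
      then show ?thesis using AB w by (auto simp: Var_def)
    qed
  qed
  then have "card (insert z (Var \<beta>)) \<le> card (Var \<gamma>)" by (rule card_mono[OF finVar])
  then have "\<not> card (Var \<gamma>) \<le> card (Var \<beta>)" using z finVar by simp
  then have "\<not> P \<gamma>" using \<beta>(2) by blast
  then have "sat \<gamma>" using inj\<gamma> sp\<gamma> by (simp add: P_def)
  then obtain d where d: "range d \<subseteq> {1..q}" "\<And>C. C \<in> \<H> \<Longrightarrow> ?R (d \<circ> \<gamma> C)" unfolding sat_def by blast
  define x where "x = \<beta> A w"
  have xX: "x \<in> Var \<gamma>" "z \<in> Var \<gamma>" using Var\<gamma> AB w by (auto simp: x_def Var_def)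
  have "x \<in> Var \<beta>" using AB w by (auto simp: x_def Var_def)
  then have xz: "x \<noteq> z" using z by blast
  \<comment> \<open>A solution with equal values at \<open>x\<close> and \<open>z\<close> would
    solve the system before the split.\<close>
  have neq: "d x \<noteq> d z" if d: "range d \<subseteq> {1..q}" "\<And>C. C \<in> \<H> \<Longrightarrow> ?R (d \<circ> \<gamma> C)" for d
  proof
    assume eq: "d x = d z"
    have "?R (d \<circ> \<beta> C)" if "C \<in> \<H>" for C
    proof -
      have "d \<circ> \<beta> C = d \<circ> \<gamma> C" using eq by (auto simp: \<gamma>_def x_def fun_eq_iff)
      then show ?thesis using d(2)[OF that] by simp
    qed
    then have "sat \<beta>" unfolding sat_def using d(1) by blast
    then show False using \<beta>(1) by (simp add: P_def)
  qed
  have sub\<gamma>: "\<And>C. C \<in> \<H> \<Longrightarrow> \<gamma> C ` W \<subseteq> Var \<gamma>" by (auto simp: Var_def)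
  obtain G :: "nat set set" and u :: nat and \<iota> :: "nat \<Rightarrow> nat"
  where G: "edge_set G" "inj \<iota>" "u \<notin> range \<iota>" "\<And>x. x \<in> Var \<gamma> \<Longrightarrow> {u, \<iota> x} \<in> G"
    "\<And>c a. good H q G c \<Longrightarrow> a \<in> \<H> \<Longrightarrow> ?R (\<lambda>w. c {u, \<iota> (\<gamma> a w)})"
    "\<And>d. d ` Var \<gamma> \<subseteq> {1..q} \<Longrightarrow> \<forall>a\<in>\<H>. ?R (d \<circ> \<gamma> a) \<Longrightarrow>
      \<exists>c. good H q G c \<and> (\<forall>x\<in>Var \<gamma>. c {u, \<iota> x} = d x)"
    by (rule star_amalgam[where q = q, OF S \<beta>0(1) inj\<gamma> finVar[of \<gamma>] sub\<gamma> sp\<gamma>]) (assumption+, (rule that; assumption))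
  show ?thesis
  proof (rule that[of G u "\<iota> x" "\<iota> z"])
    show "u \<noteq> \<iota> x" "u \<noteq> \<iota> z" using G(3) by auto
    show "\<iota> x \<noteq> \<iota> z" using G(2) xz by (auto simp: inj_def)
    show "\<exists>c. good H q G c" using G(6)[of d] d by blast
    fix c assume c: "good H q G c"
    obtain d where "range d \<subseteq> {1..q}" "\<And>x. x \<in> Var \<gamma> \<Longrightarrow> d x = c {u, \<iota> x}" "\<And>a. a \<in> \<H> \<Longrightarrow> ?R (d \<circ> \<gamma> a)"
      by (rule star_amalgam_solution[where \<beta> = \<gamma> and X = "Var \<gamma>" and I = \<H> and S = S and W = W and v = v
            and u = u and \<iota> = \<iota> and G = G and q = q and c = c, OF q1 G(4) c sub\<gamma> G(5)])
        (assumption+, (rule that; assumption))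
    then show "c {u, \<iota> x} \<noteq> c {u, \<iota> z}" using neq[of d] xX by simp
  qed (use G xX in auto)
qed

text \<open>When the constraint on a pair says that its two values differ, an unsatisfiable system
  is a graph of chromatic number above \<open>q\<close>. In a critical one, every colouring that is
  proper after the deletion of one edge gives equal colours to the ends of that edge.\<close>

lemma positive_star_sender:
  fixes N :: "nat set set"
  assumes N: "edge_set N" "u \<noteq> x" "u \<noteq> y" "x \<noteq> y" "{u, x} \<in> N" "{u, y} \<in> N"
    and c0: "good H q N c0" and neq: "\<And>c. good H q N c \<Longrightarrow> c {u, x} \<noteq> c {u, y}"
  obtains M :: "nat set set" and u' x' y'
  where "edge_set M" "u' \<noteq> x'" "u' \<noteq> y'" "x' \<noteq> y'" "{u', x'} \<in> M" "{u', y'} \<in> M" "\<exists>c. good H q M c"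
    "\<And>c. good H q M c \<Longrightarrow> c {u', x'} = c {u', y'}"
proof -
  let ?W = "{x, y}"
  let ?R = "attains H q N u ?W"
  let ?L = "card (edges H)"
  have R: "?R p" if p: "p x \<in> {1..q}" "p y \<in> {1..q}" "p x \<noteq> p y" for p
  proof -
    obtain c where "good H q N c" "c {u, x} = p x" "c {u, y} = p y"
      by (rule good_recolour_pair[OF c0 N(5,6) neq[OF c0] p])
    then show ?thesis unfolding attains_def by blast
  qed
  have W: "finite ?W" "u \<notin> ?W" "\<And>w. w \<in> ?W \<Longrightarrow> {u, w} \<in> N" using N by auto
  have q1: "1 \<le> q" using goodD(1)[OF c0 N(5)] by simp
  have notc: "\<not> ?R (\<lambda>_. i)" for i
  proof
    assume "?R (\<lambda>_. i)"
    then obtain c where "good H q N c" "c {u, x} = i" "c {u, y} = i" unfolding attains_def by blast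
    then show False using neq[of c] by simp
  qed
  obtain \<H> :: "nat set set" and \<beta> :: "nat set \<Rightarrow> nat \<Rightarrow> nat" where \<beta>: "finite \<H>" "\<And>A. A \<in> \<H> \<Longrightarrow> inj_on (\<beta> A) ?W"
    "sparse_family ?L \<H> (\<lambda>A. \<beta> A ` ?W)"
    "\<And>d. range d \<subseteq> {1..q} \<Longrightarrow> \<exists>A\<in>\<H>. \<not> ?R (d \<circ> \<beta> A)"
    by (rule unsatisfiable_family[where L = ?L, OF notc W(1)]) (rule that; assumption)
  define sat where "sat J \<longleftrightarrow> (\<exists>d. range d \<subseteq> {1..q} \<and> (\<forall>A\<in>J. ?R (d \<circ> \<beta> A)))" for J
  have "\<H> \<subseteq> \<H> \<and> \<not> sat \<H>"
  proof (intro conjI subset_refl notI)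
    assume "sat \<H>"
    then obtain d where "range d \<subseteq> {1..q}" "\<forall>A\<in>\<H>. ?R (d \<circ> \<beta> A)" unfolding sat_def by blast
    then show False using \<beta>(4)[of d] by blast
  qed
  from ex_has_least_nat[of "\<lambda>J. J \<subseteq> \<H> \<and> \<not> sat J", OF this, of card]
  obtain J where J: "J \<subseteq> \<H>" "\<not> sat J" "\<And>J'. J' \<subseteq> \<H> \<Longrightarrow> \<not> sat J' \<Longrightarrow> card J \<le> card J'" by metis
  have "J \<noteq> {}"
  proof
    assume "J = {}"
    then have "sat J" unfolding sat_def using q1 by (intro exI[of _ "\<lambda>_. 1"]) auto
    then show False using J(2) by blast
  qed
  then obtain A where A: "A \<in> J" by blast
  let ?I = "J - {A}"
  have finJ: "finite J" using J(1) \<beta>(1) finite_subset by blast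
  then have "card ?I < card J" using A by (rule card_Diff1_less)
  then have "sat ?I" using J(1) J(3)[of ?I] by fastforce
  then obtain d where d: "range d \<subseteq> {1..q}" "\<And>B. B \<in> ?I \<Longrightarrow> ?R (d \<circ> \<beta> B)"
    unfolding sat_def by blast
  \<comment> \<open>The union is over \<open>J\<close> and not over \<open>?I\<close>: the ends of
    the deleted pair must be present even if no other constraint contains them.\<close>
  define X where "X = (\<Union>B\<in>J. \<beta> B ` ?W)"
  have X: "finite X" "\<And>B. B \<in> ?I \<Longrightarrow> \<beta> B ` ?W \<subseteq> X" using finJ by (auto simp: X_def)
  have injI: "\<And>B. B \<in> ?I \<Longrightarrow> inj_on (\<beta> B) ?W" using \<beta>(2) J(1) by blast
  have spI: "sparse_family ?L ?I (\<lambda>A. \<beta> A ` ?W)" by (rule sparse_family_subset[OF \<beta>(3)]) (use J(1) in blast)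
  obtain G :: "nat set set" and t :: nat and \<iota> :: "nat \<Rightarrow> nat"
  where G: "edge_set G" "inj \<iota>" "t \<notin> range \<iota>" "\<And>x. x \<in> X \<Longrightarrow> {t, \<iota> x} \<in> G"
    "\<And>c a. good H q G c \<Longrightarrow> a \<in> ?I \<Longrightarrow> ?R (\<lambda>w. c {t, \<iota> (\<beta> a w)})"
    "\<And>d. d ` X \<subseteq> {1..q} \<Longrightarrow> \<forall>a\<in>?I. ?R (d \<circ> \<beta> a) \<Longrightarrow>
      \<exists>c. good H q G c \<and> (\<forall>x\<in>X. c {t, \<iota> x} = d x)"
    by (rule star_amalgam[where q = q, OF N(1) W finite_Diff[OF finJ] injI X spI]) (assumption+, (rule that; assumption))
  have xX: "\<beta> A x \<in> X" "\<beta> A y \<in> X" using A by (auto simp: X_def)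
  have xy: "\<beta> A x \<noteq> \<beta> A y" using \<beta>(2)[of A] A J(1) N(4) by (auto simp: inj_on_def)
  show ?thesis
  proof (rule that[of G t "\<iota> (\<beta> A x)" "\<iota> (\<beta> A y)"])
    show "t \<noteq> \<iota> (\<beta> A x)" "t \<noteq> \<iota> (\<beta> A y)" using G(3) by auto
    show "\<iota> (\<beta> A x) \<noteq> \<iota> (\<beta> A y)" using G(2) xy by (auto simp: inj_def)
    show "\<exists>c. good H q G c" using G(6)[of d] d by blast
    fix c assume c: "good H q G c"
    obtain d where d: "range d \<subseteq> {1..q}" "\<And>x. x \<in> X \<Longrightarrow> d x = c {t, \<iota> x}" "\<And>a. a \<in> ?I \<Longrightarrow> ?R (d \<circ> \<beta> a)"
      by (rule star_amalgam_solution[where \<beta> = \<beta> and X = X and I = ?I and S = N and W = ?W and v = u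
            and u = t and \<iota> = \<iota> and G = G and q = q and c = c, OF q1 G(4) c X(2) G(5)])
        (assumption+, (rule that; assumption))
    have "d (\<beta> A x) = d (\<beta> A y)"
    proof (rule ccontr)
      assume "d (\<beta> A x) \<noteq> d (\<beta> A y)"
      moreover have "d z \<in> {1..q}" for z using d(1) by blast
      ultimately have "?R (d \<circ> \<beta> A)" by (intro R) auto
      then have "?R (d \<circ> \<beta> B)" if "B \<in> J" for B using d(3)[of B] that by blast
      then have "sat J" unfolding sat_def using d(1) by blast
      then show False using J(2) by blast
    qed
    then show "c {t, \<iota> (\<beta> A x)} = c {t, \<iota> (\<beta> A y)}" using d(2) xX by simp
  qed (use G xX in auto)
qed

end

section \<open>Senders\<close>

context inseparable_graph
begin

lemma good_empty: "good H q {} c"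
  unfolding good_def using copy_two_edges by blast

text \<open>If a good colouring of a minimal Ramsey graph minus an edge were constant on the other edges
  at one end of that edge, one could colour the missing edge differently, as copies have minimum degree 2.\<close>

lemma star_gadget:
  assumes "2 \<le> q"
  obtains S :: "nat set set" and v W c0
  where "edge_set S" "finite W" "v \<notin> W" "\<And>w. w \<in> W \<Longrightarrow> {v, w} \<in> S" "good H q S c0"
    "\<And>c i. good H q S c \<Longrightarrow> \<exists>w\<in>W. c {v, w} \<noteq> i"
proof -
  obtain E :: "nat set set" where E: "edge_set E" "\<not> (\<exists>c. good H q E c)" using ex_not_good by metis
  obtain E' where E': "E' \<subseteq> E" "\<not> (\<exists>c. good H q E' c)" "\<And>e. e \<in> E' \<Longrightarrow> \<exists>c. good H q (E' - {e}) c"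
    by (rule minimal_not_good[OF edge_setD(1)[OF E(1)] E(2)]) (rule that; assumption)
  have edge: "edge_set E'" by (rule edge_set_subset[OF E(1) E'(1)])
  have "E' \<noteq> {}" using E'(2) good_empty by blast
  then obtain e where e: "e \<in> E'" by blast
  obtain v w0 where vw: "e = {v, w0}" "v \<noteq> w0" using edge_setD(2)[OF edge e] by (auto simp: card_2_iff)
  define S where "S = E' - {e}"
  define W where "W = {x. {v, x} \<in> S}"
  have S: "edge_set S" unfolding S_def by (rule edge_set_subset[OF edge]) blast
  obtain c0 where c0: "good H q S c0" using E'(3)[OF e] by (auto simp: S_def)
  show ?thesis
  proof (rule that[OF S _ _ _ c0, of W v])
    have "W \<subseteq> \<Union>S" by (auto simp: W_def)
    then show "finite W" using edge_setD(4)[OF S] finite_subset by blast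
    show "v \<notin> W" using edge_setD(2)[OF S, of "{v, v}"] by (auto simp: W_def)
    show "\<And>w. w \<in> W \<Longrightarrow> {v, w} \<in> S" by (simp add: W_def)
    fix c i assume c: "good H q S c"
    show "\<exists>w\<in>W. c {v, w} \<noteq> i"
    proof (rule ccontr)
      assume const: "\<not> ?thesis"
      \<comment> \<open>Any colour other than \<open>i\<close>; here two colours are needed.\<close>
      define j :: nat where "j = (if i = 1 then 2 else 1)"
      have j: "j \<in> {1..q}" "j \<noteq> i" using assms by (auto simp: j_def)
      have "good H q E' (c(e := j))"
        unfolding good_def
      proof (intro conjI ballI impI notI)
        show "(c(e := j)) ` E' \<subseteq> {1..q}"
        proof (rule image_subsetI)
          fix e' assume "e' \<in> E'"
          then show "(c(e := j)) e' \<in> {1..q}"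
            using goodD(1)[OF c, of e'] j(1) by (cases "e' = e") (simp_all add: S_def)
        qed
        fix K assume K: "K \<in> copies H" "K \<subseteq> E'" "\<exists>k. \<forall>e'\<in>K. (c(e := j)) e' = k"
        then obtain k where k: "\<And>e'. e' \<in> K \<Longrightarrow> (c(e := j)) e' = k" by blast
        show False
        proof (cases "e \<in> K")
          case True
          then have "k = j" using k[of e] by simp
          obtain e' where e': "e' \<in> K" "e' \<noteq> e" "v \<in> e'" using copy_degree[OF K(1) True, of v] vw by blast
          obtain x where "e' = {v, x}" using copy_card_edge[OF K(1) e'(1)] e'(3) by (auto simp: card_2_iff)
          moreover have "e' \<in> S" using e' K(2) by (auto simp: S_def)
          ultimately have "c e' = i" using const by (auto simp: W_def)
          then show False using k[OF e'(1)] e'(2) \<open>k = j\<close> j(2) by simp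
        next
          case False
          then have "K \<subseteq> S" using K(2) by (auto simp: S_def)
          moreover have "\<forall>e'\<in>K. c e' = k" using k False by (metis fun_upd_other)
          ultimately show False using goodD(2)[OF c K(1)] by blast
        qed
      qed
      then show False using E'(2) by blast
    qed
  qed
qed

text \<open>The relation \<open>R\<close> is equality for positive and inequality for negative
  senders. The levels \<open>l\<close> certify that the terminal edges are at distance at least
  \<open>n\<close>, as \<open>l\<close> changes by at most one along an edge. Such certificates are
  easily glued and remain valid for subgraphs.\<close>

definition sender :: "(nat \<Rightarrow> nat \<Rightarrow> bool) \<Rightarrow> nat \<Rightarrow> nat \<Rightarrow> nat set set \<Rightarrow> nat set \<Rightarrow> nat set \<Rightarrow> bool" where
  "sender R q n E e f \<longleftrightarrow> edge_set E \<and> e \<in> E \<and> f \<in> E \<and> (\<exists>c. good H q E c) \<and>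
     (\<forall>c. good H q E c \<longrightarrow> R (c e) (c f)) \<and>
     (\<exists>l :: nat \<Rightarrow> nat. (\<forall>g\<in>E. \<forall>x\<in>g. \<forall>y\<in>g. l x \<le> Suc (l y)) \<and> (\<forall>x\<in>e. l x = 0) \<and> (\<forall>x\<in>f. l x = n))"

lemma senderD:
  assumes "sender R q n E e f"
  shows "edge_set E" "e \<in> E" "f \<in> E" "\<exists>c. good H q E c" "\<And>c. good H q E c \<Longrightarrow> R (c e) (c f)"
  using assms by (simp_all add: sender_def)

lemma sender_levelE:
  assumes "sender R q n E e f"
  obtains l :: "nat \<Rightarrow> nat" where "\<And>g x y. g \<in> E \<Longrightarrow> x \<in> g \<Longrightarrow> y \<in> g \<Longrightarrow> l x \<le> Suc (l y)"
    "\<And>x. x \<in> e \<Longrightarrow> l x = 0" "\<And>x. x \<in> f \<Longrightarrow> l x = n"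
proof -
  obtain l :: "nat \<Rightarrow> nat" where
    "(\<forall>g\<in>E. \<forall>x\<in>g. \<forall>y\<in>g. l x \<le> Suc (l y)) \<and> (\<forall>x\<in>e. l x = 0) \<and> (\<forall>x\<in>f. l x = n)"
    using assms unfolding sender_def by (elim conjE exE) (rule that; simp)
  then show ?thesis by (intro that[of l]) simp_all
qed

text \<open>The two ends of the common edge do not separate the copy, so its vertices lie on one
  side. Any edge inside the overlap is \<open>f\<close> itself and thus belongs to both
  sides.\<close>

lemma copy_in_edge_sum:
  assumes E: "edge_set E" "edge_set E'" and f: "f \<in> E" "f \<in> E'" "\<Union>E \<inter> \<Union>E' \<subseteq> f"
    and K: "K \<in> copies H" "K \<subseteq> E \<union> E'"
  shows "K \<subseteq> E \<or> K \<subseteq> E'"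
proof -
  obtain x y where xy: "f = {x, y}" using edge_setD(2)[OF E(1) f(1)] by (auto simp: card_2_iff)
  have in_f: "e = f" if "e \<subseteq> f" "card e = 2" for e
    using that edge_setD(2,3)[OF E(1) f(1)] by (simp add: card_subset_eq)
  have "\<Union>K \<subseteq> \<Union>E \<or> \<Union>K \<subseteq> \<Union>E'"
    by (rule copy_separationE[OF K(1), of _ _ x y]) (use K(2) f(3) xy in blast)+
  then show ?thesis
  proof
    assume U: "\<Union>K \<subseteq> \<Union>E"
    have "e \<in> E" if "e \<in> K" for e
    proof (cases "e \<in> E")
      case False
      then have "e \<in> E'" using that K(2) by blast
      then have "e \<subseteq> \<Union>E \<inter> \<Union>E'" using U that by blast
      then have "e \<subseteq> f" using f(3) by (rule subset_trans)
      then have "e = f" by (rule in_f) (rule copy_card_edge[OF K(1) that])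
      then show ?thesis using f(1) by simp
    qed
    then show ?thesis by blast
  next
    assume U: "\<Union>K \<subseteq> \<Union>E'"
    have "e \<in> E'" if "e \<in> K" for e
    proof (cases "e \<in> E'")
      case False
      then have "e \<in> E" using that K(2) by blast
      then have "e \<subseteq> \<Union>E \<inter> \<Union>E'" using U that by blast
      then have "e \<subseteq> f" using f(3) by (rule subset_trans)
      then have "e = f" by (rule in_f) (rule copy_card_edge[OF K(1) that])
      then show ?thesis using f(2) by simp
    qed
    then show ?thesis by blast
  qed
qed

text \<open>Identification of two edges with a prescribed orientation. The colourings fit together
  after the colours of the second graph are permuted to agree on the common edge.\<close>

lemma edge_sum:
  fixes E1 E2 :: "nat set set"
  assumes E: "edge_set E1" "edge_set E2" "{a, b} \<in> E1" "{a', b'} \<in> E2"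
    and c: "good H q E1 c1" "good H q E2 c2"
  obtains \<phi> where "inj_on \<phi> (\<Union>E2)" "\<phi> a' = a" "\<phi> b' = b"
    "\<And>x. x \<in> \<Union>E2 \<Longrightarrow> \<phi> x \<in> \<Union>E1 \<Longrightarrow> x = a' \<or> x = b'" "edge_set (E1 \<union> (`) \<phi> ` E2)"
    "\<exists>c. good H q (E1 \<union> (`) \<phi> ` E2) c"
    "\<And>c. good H q (E1 \<union> (`) \<phi> ` E2) c \<Longrightarrow> good H q E1 c \<and> good H q E2 (\<lambda>e. c (\<phi> ` e))"
proof -
  have ab: "a \<noteq> b" "a' \<noteq> b'" using edge_setD(2)[OF E(1,3)] edge_setD(2)[OF E(2,4)] by auto
  obtain M where M: "\<And>x. x \<in> \<Union>E1 \<Longrightarrow> x < M"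
    using edge_setD(4)[OF E(1)] unfolding finite_nat_set_iff_bounded by blast
  \<comment> \<open>Adding \<open>M\<close> moves all other vertices beyond those of
    \<open>E1\<close>.\<close>
  define \<phi> where "\<phi> x = (if x = a' then a else if x = b' then b else x + M)" for x
  have abM: "a < M" "b < M" by (rule M, rule UnionI[OF E(3)], simp)+
  have inj: "inj_on \<phi> (\<Union>E2)" using ab abM by (auto simp: inj_on_def \<phi>_def)
  have meet: "x = a' \<or> x = b'" if "x \<in> \<Union>E2" "\<phi> x \<in> \<Union>E1" for x
    using M[OF that(2)] by (auto simp: \<phi>_def split: if_splits)
  let ?E = "(`) \<phi> ` E2"
  have edge: "edge_set ?E" by (rule edge_set_image[OF E(2) inj])
  have f: "\<phi> ` {a', b'} = {a, b}" using ab by (auto simp: \<phi>_def)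
  have fE: "{a, b} \<in> ?E" using E(4) f by (metis imageI)
  have int: "\<Union>E1 \<inter> \<Union>?E \<subseteq> {a, b}"
  proof
    fix z assume z: "z \<in> \<Union>E1 \<inter> \<Union>?E"
    then obtain x where "x \<in> \<Union>E2" "z = \<phi> x" by blast
    then show "z \<in> {a, b}" using meet[of x] z ab by (auto simp: \<phi>_def)
  qed
  obtain c2' where c2': "good H q E2 c2'" "c2' {a', b'} = c1 {a, b}"
    using good_recolour[OF c(2) E(4) goodD(1)[OF c(1) E(3)]] by blast
  obtain g where g: "good H q ?E g" "\<And>e. e \<in> E2 \<Longrightarrow> g (\<phi> ` e) = c2' e"
    using good_pushforward[OF c2'(1) inj] by blast
  have gf: "g {a, b} = c1 {a, b}" using g(2)[OF E(4)] c2'(2) f by simp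
  define c where "c e = (if e \<in> E1 then c1 e else g e)" for e
  have g1: "good H q E1 c" by (rule good_cong[OF c(1)]) (simp add: c_def)
  have g2: "good H q ?E c"
  proof (rule good_cong[OF g(1)])
    fix e assume e: "e \<in> ?E"
    show "c e = g e"
    proof (cases "e \<in> E1")
      case True
      then have "e \<subseteq> {a, b}" using e int by blast
      then have "e = {a, b}" using edge_setD(2)[OF E(1) True] ab by (intro card_subset_eq) auto
      then show ?thesis using gf by (simp add: c_def)
    qed (simp add: c_def)
  qed
  have "good H q (E1 \<union> ?E) c"
  proof (rule good_covered[where I = "{True, False}" and T = "\<lambda>t. if t then E1 else ?E"])
    show "c ` (E1 \<union> ?E) \<subseteq> {1..q}" using goodD(1)[OF g1] goodD(1)[OF g2] by blast
    show "\<exists>t\<in>{True, False}. K \<subseteq> (if t then E1 else ?E)" if "K \<in> copies H" "K \<subseteq> E1 \<union> ?E" for K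
      using copy_in_edge_sum[OF E(1) edge E(3) fE int that] by auto
  qed (use g1 g2 in auto)
  moreover have "good H q E1 c \<and> good H q E2 (\<lambda>e. c (\<phi> ` e))" if "good H q (E1 \<union> ?E) c" for c
    using good_subset[OF that, of E1] good_pullback[OF good_subset[OF that, of ?E] inj] by blast
  moreover have "\<phi> a' = a" "\<phi> b' = b" using ab by (auto simp: \<phi>_def)
  ultimately show ?thesis using that[OF inj _ _ meet edge_set_Un[OF E(1) edge]] by blast
qed

text \<open>The positive sender hands the colour of \<open>f\<close> on to a more distant edge. Its
  levels are raised by \<open>n\<close>, which is consistent on the glued edge, where they are
  \<open>0\<close> and become \<open>n\<close>.\<close>

lemma sender_compose:
  assumes s1: "sender R q n E1 e f" and s2: "sender (=) q m E2 f' g"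
  shows "\<exists>E g. sender R q (n + m) E e g"
proof -
  obtain l1 :: "nat \<Rightarrow> nat" where l1: "\<And>h x y. h \<in> E1 \<Longrightarrow> x \<in> h \<Longrightarrow> y \<in> h \<Longrightarrow> l1 x \<le> Suc (l1 y)"
      "\<And>x. x \<in> e \<Longrightarrow> l1 x = 0" "\<And>x. x \<in> f \<Longrightarrow> l1 x = n"
    by (rule sender_levelE[OF s1]) (rule that; assumption)
  obtain l2 :: "nat \<Rightarrow> nat" where l2: "\<And>h x y. h \<in> E2 \<Longrightarrow> x \<in> h \<Longrightarrow> y \<in> h \<Longrightarrow> l2 x \<le> Suc (l2 y)"
      "\<And>x. x \<in> f' \<Longrightarrow> l2 x = 0" "\<And>x. x \<in> g \<Longrightarrow> l2 x = m"
    by (rule sender_levelE[OF s2]) (rule that; assumption)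
  note E = senderD(1)[OF s1] senderD(1)[OF s2] senderD(2)[OF s1] senderD(3)[OF s1]
    senderD(2)[OF s2] senderD(3)[OF s2]
  obtain c1 where c1: "good H q E1 c1" using senderD(4)[OF s1] by blast
  obtain c2 where c2: "good H q E2 c2" using senderD(4)[OF s2] by blast
  note c = c1 c2
  note R = senderD(5)[OF s1] senderD(5)[OF s2]
  obtain a b where f: "f = {a, b}" using edge_setD(2)[OF E(1,4)] by (auto simp: card_2_iff)
  obtain a' b' where f': "f' = {a', b'}" using edge_setD(2)[OF E(2,5)] by (auto simp: card_2_iff)
  obtain \<phi> where \<phi>: "inj_on \<phi> (\<Union>E2)" "\<phi> a' = a" "\<phi> b' = b"
    "\<And>x. x \<in> \<Union>E2 \<Longrightarrow> \<phi> x \<in> \<Union>E1 \<Longrightarrow> x = a' \<or> x = b'" "edge_set (E1 \<union> (`) \<phi> ` E2)"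
    "\<exists>c. good H q (E1 \<union> (`) \<phi> ` E2) c"
    "\<And>c. good H q (E1 \<union> (`) \<phi> ` E2) c \<Longrightarrow> good H q E1 c \<and> good H q E2 (\<lambda>e. c (\<phi> ` e))"
    by (rule edge_sum[OF E(1,2) E(4)[unfolded f] E(5)[unfolded f'] c]) (rule that; assumption)
  let ?E = "E1 \<union> (`) \<phi> ` E2"
  define l where "l z = (if z \<in> \<Union>E1 then l1 z else n + l2 (inv_into (\<Union>E2) \<phi> z))" for z
  have l1': "l z = l1 z" if "z \<in> \<Union>E1" for z using that by (simp add: l_def)
  have l2': "l (\<phi> x) = n + l2 x" if "x \<in> \<Union>E2" for x
  proof (cases "\<phi> x \<in> \<Union>E1")
    case True
    then have "x \<in> f'" using \<phi>(4) that f' by blast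
    moreover from this have "\<phi> x \<in> f" using f f' \<phi>(2,3) by auto
    ultimately show ?thesis using l1'[OF True] l1(3) l2(2) by simp
  next
    case False
    then show ?thesis using that \<phi>(1) by (simp add: l_def)
  qed
  have "\<phi> ` f' = f" using f f' \<phi>(2,3) by auto
  have "sender R q (n + m) ?E e (\<phi> ` g)"
    unfolding sender_def
  proof (intro conjI exI[of _ l] allI impI ballI)
    show "edge_set ?E" "\<exists>c. good H q ?E c" by (rule \<phi>)+
    show "e \<in> ?E" "\<phi> ` g \<in> ?E" using E by auto
    show "R (c e) (c (\<phi> ` g))" if "good H q ?E c" for c
      using R(1)[of c] R(2)[of "\<lambda>e. c (\<phi> ` e)"] \<phi>(7)[OF that] \<open>\<phi> ` f' = f\<close> by simp
    show "l x = 0" if "x \<in> e" for x using l1'[of x] l1(2) that E(3) by auto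
    show "l x = n + m" if "x \<in> \<phi> ` g" for x using l2' l2(3) that E(6) by auto
    fix h x y assume h: "h \<in> ?E" "x \<in> h" "y \<in> h"
    show "l x \<le> Suc (l y)"
    proof (cases "h \<in> E1")
      case True
      then have "x \<in> \<Union>E1" "y \<in> \<Union>E1" using h by auto
      then show ?thesis using l1(1)[OF True h(2,3)] l1' by simp
    next
      case False
      then obtain h' where h': "h' \<in> E2" "h = \<phi> ` h'" using h(1) by blast
      then obtain x' y' where x'y': "x' \<in> h'" "y' \<in> h'" "x = \<phi> x'" "y = \<phi> y'" using h by blast
      then have "x' \<in> \<Union>E2" "y' \<in> \<Union>E2" using h' by auto
      then show ?thesis using l2(1)[OF h'(1) x'y'(1,2)] l2' x'y' by simp
    qed
  qed
  then show ?thesis by blast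
qed

text \<open>Two positive star senders in series, the second one centred at an end of the output edge of
  the first, have disjoint terminal edges.\<close>

lemma positive_sender:
  fixes N :: "nat set set"
  assumes N: "edge_set N" "u \<noteq> x" "u \<noteq> y" "x \<noteq> y" "{u, x} \<in> N" "{u, y} \<in> N"
    and c0: "good H q N c0" and eq: "\<And>c. good H q N c \<Longrightarrow> c {u, x} = c {u, y}"
  shows "\<exists>E e f. sender (=) q 1 E e f"
proof -
  have yu: "{y, u} \<in> N" using N(6) by (simp add: insert_commute)
  obtain \<phi> where \<phi>: "inj_on \<phi> (\<Union>N)" "\<phi> u = y" "\<phi> x = u"
    "\<And>z. z \<in> \<Union>N \<Longrightarrow> \<phi> z \<in> \<Union>N \<Longrightarrow> z = u \<or> z = x" "edge_set (N \<union> (`) \<phi> ` N)"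
    "\<exists>c. good H q (N \<union> (`) \<phi> ` N) c"
    "\<And>c. good H q (N \<union> (`) \<phi> ` N) c \<Longrightarrow> good H q N c \<and> good H q N (\<lambda>e. c (\<phi> ` e))"
    by (rule edge_sum[OF N(1) N(1) yu N(5) c0 c0]) (rule that; assumption)
  \<comment> \<open>Levels \<open>0\<close> and \<open>1\<close> satisfy the level condition
    automatically. It remains to see that the output edge, whose ends are \<open>y\<close> and
    \<open>\<phi> y\<close>, avoids both \<open>u\<close> and \<open>x\<close>.\<close>
  let ?E = "N \<union> (`) \<phi> ` N" and ?l = "\<lambda>z. if z = u \<or> z = x then 0 else 1 :: nat"
  have \<phi>y: "\<phi> y \<notin> \<Union>N" using \<phi>(4)[of y] N by auto
  then have \<phi>y': "\<phi> y \<noteq> u" "\<phi> y \<noteq> x" using N(5) by auto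
  have "sender (=) q 1 ?E {u, x} (\<phi> ` {u, y})"
    unfolding sender_def
  proof (intro conjI exI[of _ ?l] allI impI)
    show "edge_set ?E" "\<exists>c. good H q ?E c" by (rule \<phi>)+
    show "{u, x} \<in> ?E" "\<phi> ` {u, y} \<in> ?E" using N(5,6) by blast+
    show "c {u, x} = c (\<phi> ` {u, y})" if "good H q ?E c" for c
    proof -
      have "c {u, x} = c {u, y}" using eq \<phi>(7)[OF that] by blast
      moreover have "c (\<phi> ` {u, x}) = c (\<phi> ` {u, y})" using eq[of "\<lambda>e. c (\<phi> ` e)"] \<phi>(7)[OF that] by blast
      ultimately show ?thesis using \<phi>(2,3) by (simp add: insert_commute)
    qed
    show "\<forall>z\<in>\<phi> ` {u, y}. ?l z = 1" using \<phi>(2) \<phi>y' N(3,4) by auto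
  qed auto
  then show ?thesis by blast
qed

text \<open>The negative star sender has adjacent terminal edges, which is length \<open>0\<close>
  with constant levels. Each positive sender appended to it adds one to the length.\<close>

lemma negative_sender:
  assumes "2 \<le> q"
  shows "\<exists>E e f. sender (\<noteq>) q n E e f"
proof -
  obtain S :: "nat set set" and v W c0 where S: "edge_set S" "finite W" "v \<notin> W"
    "\<And>w. w \<in> W \<Longrightarrow> {v, w} \<in> S" "good H q S c0" "\<And>c i. good H q S c \<Longrightarrow> \<exists>w\<in>W. c {v, w} \<noteq> i"
    by (rule star_gadget[OF assms]) (rule that; assumption)
  obtain N :: "nat set set" and u x y where N: "edge_set N" "u \<noteq> x" "u \<noteq> y" "x \<noteq> y" "{u, x} \<in> N"
    "{u, y} \<in> N" "\<exists>c. good H q N c" "\<And>c. good H q N c \<Longrightarrow> c {u, x} \<noteq> c {u, y}"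
    by (rule negative_star_sender[OF S(1-3) _ S(5)]) (rule S(4), assumption, rule S(6), assumption, (rule that; assumption))
  obtain cN where cN: "good H q N cN" using N(7) by blast
  obtain M :: "nat set set" and u' x' y' where M: "edge_set M" "u' \<noteq> x'" "u' \<noteq> y'" "x' \<noteq> y'"
    "{u', x'} \<in> M" "{u', y'} \<in> M" "\<exists>c. good H q M c" "\<And>c. good H q M c \<Longrightarrow> c {u', x'} = c {u', y'}"
    by (rule positive_star_sender[OF N(1-6) cN]) (rule N(8), assumption, (rule that; assumption))
  obtain cM where cM: "good H q M cM" using M(7) by blast
  have "\<exists>E e f. sender (=) q 1 E e f"
    by (rule positive_sender[OF M(1-6) cM]) (rule M(8), assumption)
  then obtain E1 e1 f1 where unit: "sender (=) q 1 E1 e1 f1" by blast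
  show ?thesis
  proof (induction n)
    case 0
    have "sender (\<noteq>) q 0 N {u, x} {u, y}"
      unfolding sender_def
    proof (intro conjI allI impI)
      show "\<exists>l :: nat \<Rightarrow> nat. (\<forall>g\<in>N. \<forall>a\<in>g. \<forall>b\<in>g. l a \<le> Suc (l b)) \<and>
          (\<forall>a\<in>{u, x}. l a = 0) \<and> (\<forall>a\<in>{u, y}. l a = 0)"
        by (intro exI[of _ "\<lambda>_. 0"]) simp
    qed (use N in simp_all)
    then show ?case by blast
  next
    case (Suc n)
    then obtain E e f where "sender (\<noteq>) q n E e f" by blast
    from sender_compose[OF this unit] show ?case by auto
  qed
qed

end

section \<open>Graphs whose edges avoid the colour of a distant edge\<close>

text \<open>If the copy missed level \<open>t\<close>, the vertices below and above \<open>t\<close>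
  would be disjoint sets covering every edge, and even an empty overlap cannot separate
  \<open>H\<close>.\<close>

lemma (in inseparable_graph) copy_attains_levels:
  fixes l :: "'b \<Rightarrow> nat"
  assumes K: "K \<in> copies H" and l: "\<And>g x y. g \<in> K \<Longrightarrow> x \<in> g \<Longrightarrow> y \<in> g \<Longrightarrow> l x \<le> Suc (l y)"
    and ends: "x \<in> \<Union>K" "l x < t" "y \<in> \<Union>K" "t < l y"
  shows "\<exists>z\<in>\<Union>K. l z = t"
proof (rule ccontr)
  assume none: "\<not> ?thesis"
  have "\<Union>K \<subseteq> {z. l z < t} \<or> \<Union>K \<subseteq> {z. t < l z}"
  proof (rule copy_separation[OF K])
    fix g assume g: "g \<in> K"
    show "g \<subseteq> {z. l z < t} \<or> g \<subseteq> {z. t < l z}"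
    proof (rule ccontr)
      assume "\<not> ?thesis"
      then obtain a b where "a \<in> g" "\<not> l a < t" "b \<in> g" "\<not> t < l b" by blast
      moreover from this have "l a \<noteq> t" "l b \<noteq> t" using none g by blast+
      ultimately show False using l[OF g, of a b] by linarith
    qed
  next
    have "{z. l z < t} \<inter> {z. t < l z} \<inter> \<Union>K = {}" by auto
    then show "card ({z. l z < t} \<inter> {z. t < l z} \<inter> \<Union>K) \<le> 2" by simp
  qed
  then show False using ends by auto
qed

text \<open>Each \<open>T e\<close> is a negative sender from \<open>e\<close> to the common edge
  \<open>f\<close>. Two of them meet in \<open>f\<close> and, at the other end, possibly in a vertex
  common to their input edges. Levels count from \<open>F\<close>.\<close>

locale sender_system = inseparable_graph H for H :: "'a graph" +
  fixes q r n :: nat and F :: "nat set set" and T :: "nat set \<Rightarrow> nat set set" and f :: "nat set"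
    and l :: "nat \<Rightarrow> nat"
  assumes q: "q = Suc r" "2 \<le> r"
    and edge_F: "edge_set F" and edge_T: "\<And>e. e \<in> F \<Longrightarrow> edge_set (T e)" and card_f: "card f = 2"
    and terminals: "\<And>e. e \<in> F \<Longrightarrow> e \<in> T e" "\<And>e. e \<in> F \<Longrightarrow> f \<in> T e"
    and meet_F: "\<And>e. e \<in> F \<Longrightarrow> \<Union>(T e) \<inter> \<Union>F \<subseteq> e"
    and meet_T: "\<And>e e'. e \<in> F \<Longrightarrow> e' \<in> F \<Longrightarrow> e \<noteq> e' \<Longrightarrow> \<Union>(T e) \<inter> \<Union>(T e') \<subseteq> f \<union> (e \<inter> e')"
    and level: "\<And>e g x y. e \<in> F \<Longrightarrow> g \<in> T e \<Longrightarrow> x \<in> g \<Longrightarrow> y \<in> g \<Longrightarrow> l x \<le> Suc (l y)"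
    and level_F: "\<And>x. x \<in> \<Union>F \<Longrightarrow> l x = 0" and level_f: "\<And>x. x \<in> f \<Longrightarrow> l x = n"
    and n: "card (vertices H) \<le> n"
    and T_good: "\<And>e. e \<in> F \<Longrightarrow> \<exists>c. good H q (T e) c"
    and T_neq: "\<And>e c. e \<in> F \<Longrightarrow> good H q (T e) c \<Longrightarrow> c e \<noteq> c f"
    and F_bad: "\<not> (\<exists>c. good H r F c)" and F_minimal: "\<And>e. e \<in> F \<Longrightarrow> \<exists>c. good H r (F - {e}) c"
begin

definition G :: "nat set set" where "G = F \<union> (\<Union>e\<in>F. T e)"

lemma edge_G: "edge_set G"
  unfolding G_def using edge_setD(1)[OF edge_F] edge_F edge_T by (intro edge_set_Un edge_set_UN)

lemma level_G:
  assumes "g \<in> G" "x \<in> g" "y \<in> g"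
  shows "l x \<le> Suc (l y)"
proof (cases "g \<in> F")
  case True
  then show ?thesis using level_F[OF UnionI[OF True assms(2)]] by simp
next
  case False
  then obtain e where "e \<in> F" "g \<in> T e" using assms(1) by (auto simp: G_def)
  then show ?thesis by (rule level) (rule assms)+
qed

lemma G_cases: "g \<in> G \<Longrightarrow> g \<in> F \<or> (\<exists>e\<in>F. g \<in> T e)"
  by (auto simp: G_def)

lemma eq_edge: "e \<in> F \<Longrightarrow> g \<subseteq> e \<Longrightarrow> card g = 2 \<Longrightarrow> g = e"
  using edge_setD(2,3)[OF edge_F] by (simp add: card_subset_eq)

lemma eq_f: "g \<subseteq> f \<Longrightarrow> card g = 2 \<Longrightarrow> g = f"
  using card_f by (intro card_subset_eq) (auto intro: card_ge_0_finite)

lemma induced_F: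
  assumes "g \<in> G" "g \<subseteq> \<Union>F"
  shows "g \<in> F"
proof (cases "g \<in> F")
  case False
  then obtain e where e: "e \<in> F" "g \<in> T e" using assms(1) by (auto simp: G_def)
  then have "g \<subseteq> e" using meet_F[OF e(1)] assms(2) by blast
  then have "g = e" by (rule eq_edge[OF e(1)]) (rule edge_setD(2)[OF edge_T[OF e(1)] e(2)])
  then show ?thesis using e(1) by simp
qed

lemma T_inter_F:
  assumes "e \<in> F" "g \<in> T e" "g \<in> F"
  shows "g = e"
proof (rule eq_edge[OF assms(1) _ edge_setD(2)[OF edge_F assms(3)]])
  show "g \<subseteq> e" using meet_F[OF assms(1)] assms(2,3) by blast
qed

lemma n3: "3 \<le> n"
  using n card_vertices by simp

text \<open>An edge with one end on \<open>f\<close> and the other in \<open>F\<close> would jump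
  from level \<open>n\<close> to level \<open>0\<close>, which \<open>n \<ge> 3\<close> forbids. And
  no edge fits into the intersection of two distinct edges.\<close>

lemma T_inter_T:
  assumes e: "e \<in> F" "e' \<in> F" "e \<noteq> e'" and g: "g \<in> T e" "g \<in> T e'"
  shows "g = f"
proof -
  have card_g: "card g = 2" using edge_setD(2)[OF edge_T[OF e(1)] g(1)] .
  have sub: "g \<subseteq> f \<union> (e \<inter> e')" using meet_T[OF e] g by blast
  have "g \<subseteq> f"
  proof (rule ccontr)
    assume "\<not> g \<subseteq> f"
    then obtain x where x: "x \<in> g" "x \<in> e \<inter> e'" using sub by blast
    then have lx: "l x = 0" using level_F e by blast
    have "g \<subseteq> e \<inter> e'"
    proof
      fix y assume y: "y \<in> g"
      have "l y \<noteq> n" using level[OF e(1) g(1) y x(1)] lx n3 by simp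
      then show "y \<in> e \<inter> e'" using sub y level_f by blast
    qed
    then have "g \<subseteq> e" "g \<subseteq> e'" by auto
    then have "g = e" "g = e'" using eq_edge[OF e(1) _ card_g] eq_edge[OF e(2) _ card_g] by auto
    then show False using e(3) by simp
  qed
  then show ?thesis using card_g by (rule eq_f)
qed

text \<open>A copy has at most \<open>n\<close> vertices and so cannot occupy all the
  \<open>n + 1\<close> levels from \<open>0\<close> to \<open>n\<close>; it misses level
  \<open>0\<close> or level \<open>n\<close>. Away from \<open>f\<close>, a sender meets the rest
  only in its edge \<open>e\<close>; away from \<open>F\<close>, only in \<open>f\<close>. Either
  way the overlap consists of the two ends of an edge and does not separate the copy.\<close>

lemma copy_in_system:
  assumes K: "K \<in> copies H" "K \<subseteq> G"
  shows "K \<subseteq> F \<or> (\<exists>e\<in>F. K \<subseteq> T e)"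
proof -
  have lK: "\<And>g x y. g \<in> K \<Longrightarrow> x \<in> g \<Longrightarrow> y \<in> g \<Longrightarrow> l x \<le> Suc (l y)" using level_G K(2) by blast
  have "(\<forall>x\<in>\<Union>K. l x \<noteq> 0) \<or> (\<forall>x\<in>\<Union>K. l x \<noteq> n)"
  proof (rule ccontr)
    assume "\<not> ?thesis"
    then obtain x y where xy: "x \<in> \<Union>K" "l x = 0" "y \<in> \<Union>K" "l y = n" by blast
    have "{..n} \<subseteq> l ` \<Union>K"
    proof
      fix t assume "t \<in> {..n}"
      then consider "t = 0" | "t = n" | "0 < t" "t < n" by fastforce
      then show "t \<in> l ` \<Union>K"
      proof cases
        case 3
        have "\<exists>z\<in>\<Union>K. l z = t"
          by (rule copy_attains_levels[OF K(1), where x = x and y = y]) (use lK xy 3 in simp_all)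
        then show ?thesis by blast
      qed (use xy in auto)
    qed
    then have "card {..n} \<le> card (l ` \<Union>K)" by (rule card_mono[OF finite_imageI[OF copy_finite(2)[OF K(1)]]])
    also have "\<dots> \<le> card (\<Union>K)" by (rule card_image_le[OF copy_finite(2)[OF K(1)]])
    finally show False using copy_card_Union[OF K(1)] n by simp
  qed
  then show ?thesis
  proof
    assume "\<forall>x\<in>\<Union>K. l x \<noteq> n"
    then have nof: "x \<notin> f" if "x \<in> \<Union>K" for x using level_f that by blast
    show ?thesis
    proof (cases "K \<subseteq> F")
      case False
      then obtain g where gK: "g \<in> K" "g \<notin> F" by blast
      then obtain e where e: "e \<in> F" "g \<in> T e" using G_cases[of g] K(2) by blast
      note g = gK e
      obtain x y where xy: "e = {x, y}" using edge_setD(2)[OF edge_F g(3)] by (auto simp: card_2_iff)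
      let ?P = "\<Union>(T e)" and ?Q = "\<Union>F \<union> (\<Union>e'\<in>F - {e}. \<Union>(T e'))"
      have PQ: "?P \<inter> ?Q \<inter> \<Union>K \<subseteq> e"
      proof
        fix z assume z: "z \<in> ?P \<inter> ?Q \<inter> \<Union>K"
        show "z \<in> e"
        proof (cases "z \<in> \<Union>F")
          case True
          then show ?thesis using meet_F[OF g(3)] z by blast
        next
          case False
          then obtain e' where "e' \<in> F" "e' \<noteq> e" "z \<in> \<Union>(T e')" using z by blast
          then show ?thesis using meet_T[OF g(3), of e'] z nof[of z] by blast
        qed
      qed
      have split: "g' \<in> T e \<or> g' \<subseteq> ?Q" if g': "g' \<in> K" for g'
      proof (cases "g' \<in> F")
        case False
        then obtain e' where e': "e' \<in> F" "g' \<in> T e'" using G_cases[of g'] K(2) g' by blast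
        show ?thesis
        proof (cases "e' = e")
          case False
          then have "\<Union>(T e') \<subseteq> ?Q" using e'(1) by blast
          then show ?thesis using e'(2) by blast
        qed (use e' in simp)
      qed blast
      have "\<Union>K \<subseteq> ?P \<or> \<Union>K \<subseteq> ?Q"
      proof (rule copy_separationE[OF K(1), of _ _ x y])
        show "g' \<subseteq> ?P \<or> g' \<subseteq> ?Q" if "g' \<in> K" for g' using split[OF that] by blast
      qed (use PQ xy in blast)
      then show ?thesis
      proof
        assume U: "\<Union>K \<subseteq> ?P"
        have "g' \<in> T e" if g': "g' \<in> K" for g'
        proof (rule ccontr)
          assume notin: "g' \<notin> T e"
          have c2: "card g' = 2" using copy_card_edge[OF K(1) g'] .
          have "g' \<subseteq> ?Q" using split[OF g'] notin by simp
          then have "g' \<subseteq> ?P \<inter> ?Q \<inter> \<Union>K" using U g' by blast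
          then have "g' \<subseteq> e" using PQ by (rule subset_trans)
          then have "g' = e" by (rule eq_edge[OF g(3)]) (rule c2)
          then show False using notin terminals(1)[OF g(3)] by simp
        qed
        then show ?thesis using g(3) by blast
      next
        assume "\<Union>K \<subseteq> ?Q"
        then have "g \<subseteq> ?P \<inter> ?Q \<inter> \<Union>K" using g by blast
        then have "g \<subseteq> e" using PQ by (rule subset_trans)
        then have "g = e" by (rule eq_edge[OF g(3)]) (rule copy_card_edge[OF K(1) g(1)])
        then show ?thesis using g by simp
      qed
    qed simp
  next
    assume "\<forall>x\<in>\<Union>K. l x \<noteq> 0"
    then have noF: "x \<notin> \<Union>F" if "x \<in> \<Union>K" for x using level_F that by blast
    have inT: "\<exists>e\<in>F. g \<in> T e" if g: "g \<in> K" for g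
    proof -
      have "g \<noteq> {}" using copy_card_edge[OF K(1) g] by auto
      then have "g \<notin> F" using noF g by blast
      then show ?thesis using G_cases[of g] K(2) g by blast
    qed
    obtain g where g: "g \<in> K" "g \<noteq> f" using copy_two_edges[OF K(1)] by blast
    then obtain e where e: "e \<in> F" "g \<in> T e" using inT by blast
    obtain x y where xy: "f = {x, y}" using card_f by (auto simp: card_2_iff)
    let ?P = "\<Union>(T e)" and ?Q = "\<Union>e'\<in>F - {e}. \<Union>(T e')"
    have PQ: "?P \<inter> ?Q \<inter> \<Union>K \<subseteq> f"
    proof
      fix z assume z: "z \<in> ?P \<inter> ?Q \<inter> \<Union>K"
      then obtain e' where "e' \<in> F" "e' \<noteq> e" "z \<in> \<Union>(T e')" by blast
      then show "z \<in> f" using meet_T[OF e(1), of e'] z noF[of z] e(1) by blast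
    qed
    have split: "g' \<in> T e \<or> g' \<subseteq> ?Q" if g': "g' \<in> K" for g'
      using inT[OF g'] by blast
    have "\<Union>K \<subseteq> ?P \<or> \<Union>K \<subseteq> ?Q"
    proof (rule copy_separationE[OF K(1), of _ _ x y])
      show "g' \<subseteq> ?P \<or> g' \<subseteq> ?Q" if "g' \<in> K" for g' using split[OF that] by blast
    qed (use PQ xy in blast)
    then show ?thesis
    proof
      assume U: "\<Union>K \<subseteq> ?P"
      have "g' \<in> T e" if g': "g' \<in> K" for g'
      proof (rule ccontr)
        assume notin: "g' \<notin> T e"
        then have "g' \<subseteq> ?Q" using split[OF g'] by simp
        then have "g' \<subseteq> ?P \<inter> ?Q \<inter> \<Union>K" using U g' by blast
        then have "g' \<subseteq> f" using PQ by (rule subset_trans)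
        then have "g' = f" by (rule eq_f) (rule copy_card_edge[OF K(1) g'])
        then show False using notin terminals(2)[OF e(1)] by simp
      qed
      then show ?thesis using e(1) by blast
    next
      assume "\<Union>K \<subseteq> ?Q"
      then have "g \<subseteq> ?P \<inter> ?Q \<inter> \<Union>K" using g e by blast
      then have "g \<subseteq> f" using PQ by (rule subset_trans)
      then have "g = f" by (rule eq_f) (rule copy_card_edge[OF K(1) g(1)])
      then show ?thesis using g by simp
    qed
  qed
qed

lemma F_nonempty: "F \<noteq> {}"
  using F_bad good_empty by metis

section \<open>Colourings of the system and of its subgraphs\<close>

lemma G_bad: "\<not> good H q G c"
proof
  assume c: "good H q G c"
  obtain e0 where "e0 \<in> F" using F_nonempty by blast
  then have "f \<in> G" using terminals(2) by (auto simp: G_def)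
  moreover have "q \<in> {1..q}" using q by simp
  ultimately obtain c' where c': "good H q G c'" "c' f = q"
    using good_recolour[OF c, of f q] by metis
  have good_F: "good H q F c'" by (rule good_subset[OF c'(1)]) (simp add: G_def)
  have "c' e \<in> {1..r}" if e: "e \<in> F" for e
  proof -
    have "good H q (T e) c'" by (rule good_subset[OF c'(1)]) (use e in \<open>auto simp: G_def\<close>)
    then have "c' e \<noteq> q" using T_neq[OF e] c'(2) by metis
    then show ?thesis using goodD(1)[OF good_F e] q by auto
  qed
  then have "good H r F c'" using good_F unfolding good_def by blast
  then show False using F_bad by blast
qed

text \<open>The colouring behind both properties of bad subgraphs. Both \<open>e1\<close> and
  \<open>f\<close> receive the extra colour \<open>q\<close>, which only the sender at
  \<open>e1\<close> prohibits. If what is left of this sender falls into a piece \<open>A\<close>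
  without \<open>f\<close> and a piece \<open>B\<close> without \<open>e1\<close>, with no copy
  across, the two pieces can follow incompatible colourings and neither notices the
  conflict.\<close>

lemma good_assembly:
  assumes E': "E' \<subseteq> G" and e1: "e1 \<in> F" and AB: "A \<subseteq> T e1" "B \<subseteq> T e1" "A \<inter> B = {}" "f \<notin> A" "e1 \<notin> B"
    and cover: "(T e1 \<union> F) \<inter> E' \<subseteq> A \<union> B \<union> F"
    and split: "\<And>K. K \<in> copies H \<Longrightarrow> K \<subseteq> E' \<Longrightarrow> K \<subseteq> T e1 \<Longrightarrow> K \<subseteq> A \<or> K \<subseteq> B \<or> K \<subseteq> F"
  shows "\<exists>c. good H q E' c"
proof -
  obtain c1 where c1: "good H r (F - {e1}) c1" using F_minimal[OF e1] by blast
  \<comment> \<open>The new colour occurs on \<open>e1\<close> alone, so no copy becomes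
    monochromatic: every copy has a second edge. The other edges of \<open>F\<close> avoid
    \<open>q\<close>, as their senders to \<open>f\<close> require.\<close>
  define cF where "cF = c1(e1 := q)"
  have cF_other: "cF e \<in> {1..r}" if "e \<in> F" "e \<noteq> e1" for e
    using goodD(1)[OF c1, of e] that by (simp add: cF_def)
  have cF: "good H q F cF"
    unfolding good_def
  proof (intro conjI ballI impI notI)
    show "cF ` F \<subseteq> {1..q}"
    proof (rule image_subsetI)
      fix e assume "e \<in> F"
      then show "cF e \<in> {1..q}" using cF_other[of e] q by (cases "e = e1") (auto simp: cF_def)
    qed
    fix K assume K: "K \<in> copies H" "K \<subseteq> F" "\<exists>i. \<forall>e\<in>K. cF e = i"
    then obtain i where i: "\<And>e. e \<in> K \<Longrightarrow> cF e = i" by blast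
    show False
    proof (cases "e1 \<in> K")
      case True
      obtain e where e: "e \<in> K" "e \<noteq> e1" using copy_two_edges[OF K(1)] by blast
      then have "cF e \<in> {1..r}" using cF_other K(2) by blast
      then show False using i[OF e(1)] i[OF True] q by (simp add: cF_def)
    next
      case False
      then have "\<forall>e\<in>K. c1 e = i" using i by (metis cF_def fun_upd_other)
      moreover have "K \<subseteq> F - {e1}" using K(2) False by blast
      ultimately show False using goodD(2)[OF c1 K(1)] by blast
    qed
  qed
  have ext: "\<exists>g. good H q (T e) g \<and> g e = i \<and> g f = j"
    if h: "e \<in> F" "i \<in> {1..q}" "j \<in> {1..q}" "i \<noteq> j" for e i j
  proof -
    obtain c where c: "good H q (T e) c" using T_good[OF h(1)] by blast
    obtain c' where "good H q (T e) c'" "c' e = i" "c' f = j"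
      by (rule good_recolour_pair[OF c terminals(1)[OF h(1)] terminals(2)[OF h(1)] T_neq[OF h(1) c] h(2-4)])
    then show ?thesis by blast
  qed
  have q12: "q \<in> {1..q}" "1 \<in> {1..q}" "q \<noteq> 1" "1 \<noteq> q" using q by auto
  \<comment> \<open>The colouring \<open>ga\<close> is right at \<open>e1\<close> and wrong at
    \<open>f\<close>, while \<open>gb\<close> below is right at \<open>f\<close> and wrong at
    \<open>e1\<close>. The colour \<open>1\<close> merely differs from \<open>q\<close>.\<close>
  obtain ga where ga: "good H q (T e1) ga" "ga e1 = q" "ga f = 1" using ext[OF e1 q12(1,2,3)] by blast
  obtain gb where gb: "good H q (T e1) gb" "gb e1 = 1" "gb f = q" using ext[OF e1 q12(2,1,4)] by blast
  have "\<forall>e\<in>F - {e1}. \<exists>g. good H q (T e) g \<and> g e = cF e \<and> g f = q"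
  proof
    fix e assume e: "e \<in> F - {e1}"
    then have "cF e \<in> {1..r}" using cF_other by blast
    then show "\<exists>g. good H q (T e) g \<and> g e = cF e \<and> g f = q" using e q by (intro ext) auto
  qed
  from bchoice[OF this] obtain g where g: "\<And>e. e \<in> F - {e1} \<Longrightarrow> good H q (T e) (g e)"
    "\<And>e. e \<in> F - {e1} \<Longrightarrow> g e e = cF e" "\<And>e. e \<in> F - {e1} \<Longrightarrow> g e f = q" by blast
  have "\<exists>h. \<forall>e\<in>F - {e1}. \<forall>x\<in>T e. h x = g e x"
  proof (rule glue_functions)
    fix a b x assume *: "a \<in> F - {e1}" "b \<in> F - {e1}" "x \<in> T a" "x \<in> T b"
    show "g a x = g b x"
    proof (cases "a = b")
      case False
      then have "x = f" using T_inter_T[of a b x] * by blast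
      then show ?thesis using g(3) * by simp
    qed simp
  qed
  then obtain h where h: "\<And>e x. e \<in> F - {e1} \<Longrightarrow> x \<in> T e \<Longrightarrow> h x = g e x" by blast
  define c where "c x = (if x \<in> F then cF x else if x \<in> A then ga x else if x \<in> B then gb x else h x)" for x
  have good_F: "good H q F c" by (rule good_cong[OF cF]) (simp add: c_def)
  have good_T: "good H q (T e) c" if e: "e \<in> F - {e1}" for e
  proof (rule good_cong[OF g(1)[OF e]])
    fix x assume x: "x \<in> T e"
    consider "x \<in> F" | "x \<notin> F" "x \<in> T e1" | "x \<notin> F" "x \<notin> T e1" by blast
    then show "c x = g e x"
    proof cases
      case 1
      then have "x = e" using T_inter_F[of e x] e x by blast
      then show ?thesis using g(2)[OF e] 1 by (simp add: c_def)
    next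
      case 2
      then have "x = f" using T_inter_T[of e e1 x] e e1 x by blast
      then show ?thesis using AB(4) 2(1) gb(3) g(3)[OF e] h[OF e x] by (simp add: c_def)
    next
      case 3
      then have "x \<notin> A" "x \<notin> B" using AB by blast+
      then show ?thesis using 3 h[OF e x] by (simp add: c_def)
    qed
  qed
  have good_A: "good H q A c"
  proof (rule good_cong[OF good_subset[OF ga(1) AB(1)]])
    fix x assume x: "x \<in> A"
    show "c x = ga x"
    proof (cases "x \<in> F")
      case True
      then have "x = e1" using T_inter_F[OF e1, of x] AB(1) x by blast
      then show ?thesis using True ga(2) by (simp add: c_def cF_def)
    qed (use x in \<open>simp add: c_def\<close>)
  qed
  have good_B: "good H q B c"
  proof (rule good_cong[OF good_subset[OF gb(1) AB(2)]])
    fix x assume x: "x \<in> B"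
    have "x \<notin> F" using T_inter_F[OF e1, of x] AB(2,5) x by blast
    moreover have "x \<notin> A" using AB(3) x by blast
    ultimately show "c x = gb x" using x by (simp add: c_def)
  qed
  let ?I = "insert F (insert A (insert B (T ` (F - {e1}))))"
  have good_I: "good H q D c" if "D \<in> ?I" for D using that good_F good_A good_B good_T by blast
  have "good H q E' c"
  proof (rule good_covered[where I = ?I and T = "\<lambda>D. D"])
    show "good H q D c" if "D \<in> ?I" for D using good_I[OF that] .
    show "c ` E' \<subseteq> {1..q}"
    proof (rule image_subsetI)
      fix x assume x: "x \<in> E'"
      have "\<exists>D\<in>?I. x \<in> D"
      proof (cases "x \<in> F \<or> x \<in> T e1")
        case True
        then have "x \<in> A \<union> B \<union> F" using cover x by blast
        then show ?thesis by blast
      next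
        case False
        then obtain e where "e \<in> F" "x \<in> T e" "e \<noteq> e1" using G_cases[of x] E' x by blast
        then show ?thesis by blast
      qed
      then show "c x \<in> {1..q}" using goodD(1) good_I by blast
    qed
    fix K assume K: "K \<in> copies H" "K \<subseteq> E'"
    then consider "K \<subseteq> F" | e where "e \<in> F" "K \<subseteq> T e" using copy_in_system E' by blast
    then show "\<exists>D\<in>?I. K \<subseteq> D"
    proof cases
      case (2 e)
      then show ?thesis using split[OF K] by (cases "e = e1") blast+
    qed blast
  qed
  then show ?thesis by blast
qed

text \<open>If \<open>e1\<close> is missing, the rest of its sender can follow the colouring that is
  right at \<open>f\<close>, so the piece \<open>A\<close> is empty.\<close>

lemma bad_subset_contains_F:
  assumes E': "E' \<subseteq> G" "\<not> (\<exists>c. good H q E' c)"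
  shows "F \<subseteq> E'"
proof (rule ccontr)
  assume "\<not> F \<subseteq> E'"
  then obtain e1 where e1: "e1 \<in> F" "e1 \<notin> E'" by blast
  have "\<exists>c. good H q E' c"
    by (rule good_assembly[OF E'(1) e1(1), of "{}" "T e1 - {e1}"]) (use e1 in blast)+
  then show False using E'(2) by blast
qed

text \<open>An unoccupied level cuts a sender into a lower piece near \<open>F\<close> and an upper
  piece near \<open>f\<close>. Neither an edge nor a copy of \<open>H\<close> can jump over
  it.\<close>

lemma bad_subset_meets_level:
  assumes E': "E' \<subseteq> G" "\<not> (\<exists>c. good H q E' c)" and t: "0 < t" "t < n"
  shows "\<exists>z\<in>\<Union>E'. l z = t"
proof (rule ccontr)
  assume none: "\<not> ?thesis"
  obtain e1 where e1: "e1 \<in> F" using F_nonempty by blast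
  \<comment> \<open>The empty set would satisfy both level conditions; excluding it makes
    \<open>A\<close> and \<open>B\<close> disjoint.\<close>
  define A where "A = {g \<in> T e1. g \<noteq> {} \<and> (\<forall>x\<in>g. l x < t)}"
  define B where "B = {g \<in> T e1. g \<noteq> {} \<and> (\<forall>x\<in>g. t < l x)}"
  have ne: "e1 \<noteq> {}" "f \<noteq> {}" using edge_setD(2)[OF edge_F e1] card_f by auto
  have "\<exists>c. good H q E' c"
  proof (rule good_assembly[OF E'(1) e1, of A B])
    show "A \<subseteq> T e1" "B \<subseteq> T e1" by (auto simp: A_def B_def)
    show "A \<inter> B = {}" unfolding A_def B_def by fastforce
    show "f \<notin> A" using ne(2) level_f t by (auto simp: A_def)
    show "e1 \<notin> B"
    proof
      assume "e1 \<in> B"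
      moreover obtain x where x: "x \<in> e1" using ne(1) by blast
      ultimately have "t < l x" by (simp add: B_def)
      then show False using level_F[OF UnionI[OF e1 x]] by simp
    qed
    show "(T e1 \<union> F) \<inter> E' \<subseteq> A \<union> B \<union> F"
    proof
      fix g assume g: "g \<in> (T e1 \<union> F) \<inter> E'"
      show "g \<in> A \<union> B \<union> F"
      proof (rule ccontr)
        assume not: "g \<notin> A \<union> B \<union> F"
        then have gT: "g \<in> T e1" using g by blast
        have "g \<noteq> {}" using edge_setD(2)[OF edge_T[OF e1] gT] by auto
        then obtain x y where "x \<in> g" "\<not> l x < t" "y \<in> g" "\<not> t < l y" using not gT by (auto simp: A_def B_def)
        moreover from this have "l x \<noteq> t" "l y \<noteq> t" using none g by blast+
        ultimately show False using level[OF e1 gT, of x y] by linarith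
      qed
    qed
    fix K assume K: "K \<in> copies H" "K \<subseteq> E'" "K \<subseteq> T e1"
    have nonempty: "g \<noteq> {}" if "g \<in> K" for g using copy_card_edge[OF K(1) that] by auto
    have "(\<forall>x\<in>\<Union>K. l x < t) \<or> (\<forall>x\<in>\<Union>K. t < l x)"
    proof (rule ccontr)
      assume "\<not> ?thesis"
      then obtain x y where xy: "x \<in> \<Union>K" "\<not> l x < t" "y \<in> \<Union>K" "\<not> t < l y" by blast
      then have "l x \<noteq> t" "l y \<noteq> t" using none K(2) by blast+
      then have "l y < t" "t < l x" using xy by auto
      have "\<exists>z\<in>\<Union>K. l z = t"
        by (rule copy_attains_levels[OF K(1) _ xy(3) \<open>l y < t\<close> xy(1) \<open>t < l x\<close>]) (use level[OF e1] K(3) in blast)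
      then show False using none K(2) by blast
    qed
    then show "K \<subseteq> A \<or> K \<subseteq> B \<or> K \<subseteq> F" using K(3) nonempty unfolding A_def B_def by blast
  qed
  then show False using E'(2) by blast
qed

lemma bad_subset_large:
  assumes E': "E' \<subseteq> G" "\<not> (\<exists>c. good H q E' c)"
  shows "n - 1 \<le> card (\<Union>E')"
proof -
  have fin: "finite (\<Union>E')" using edge_setD(4)[OF edge_set_subset[OF edge_G E'(1)]] .
  have "{0<..<n} \<subseteq> l ` \<Union>E'"
  proof
    fix t assume "t \<in> {0<..<n}"
    then have "\<exists>z\<in>\<Union>E'. l z = t" by (intro bad_subset_meets_level[OF E']) auto
    then show "t \<in> l ` \<Union>E'" by blast
  qed
  then have "card {0<..<n} \<le> card (l ` \<Union>E')" by (rule card_mono[OF finite_imageI[OF fin]])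
  also have "\<dots> \<le> card (\<Union>E')" by (rule card_image_le[OF fin])
  finally show ?thesis by simp
qed

end

section \<open>Minimal Ramsey graphs\<close>

context inseparable_graph
begin

text \<open>Builds a \<open>sender_system\<close> around a copy of \<open>F\<close>. The last clause
  concerns all bad subgraphs, since a minimal one is chosen only later.\<close>

lemma sender_extension:
  fixes F :: "nat set set"
  assumes F: "edge_set F" "\<not> (\<exists>c. good H r F c)" "\<And>e. e \<in> F \<Longrightarrow> \<exists>c. good H r (F - {e}) c" and r: "2 \<le> r"
  obtains G :: "nat set set" and \<iota> :: "nat \<Rightarrow> nat"
  where "edge_set G" "inj \<iota>" "(`) \<iota> ` F \<subseteq> G" "\<And>g. g \<in> G \<Longrightarrow> g \<subseteq> \<Union>((`) \<iota> ` F) \<Longrightarrow> g \<in> (`) \<iota> ` F"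
    "\<not> (\<exists>c. good H (Suc r) G c)"
    "\<And>E'. E' \<subseteq> G \<Longrightarrow> \<not> (\<exists>c. good H (Suc r) E' c) \<Longrightarrow> (`) \<iota> ` F \<subseteq> E' \<and> N \<le> card (\<Union>E')"
proof -
  \<comment> \<open>The first term confines copies of \<open>H\<close>, and the second provides
    \<open>n - 1 \<ge> N\<close> occupied intermediate levels.\<close>
  define n where "n = max (card (vertices H)) (Suc N)"
  have n_bounds: "0 < n" "card (vertices H) \<le> n" "N \<le> n - 1" by (auto simp: n_def)
  have "2 \<le> Suc r" using r by simp
  from negative_sender[OF this, of n] obtain E e0 f0 where s: "sender (\<noteq>) (Suc r) n E e0 f0" by blast
  obtain l :: "nat \<Rightarrow> nat" where l: "\<And>g x y. g \<in> E \<Longrightarrow> x \<in> g \<Longrightarrow> y \<in> g \<Longrightarrow> l x \<le> Suc (l y)"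
    "\<And>x. x \<in> e0 \<Longrightarrow> l x = 0" "\<And>x. x \<in> f0 \<Longrightarrow> l x = n"
    by (rule sender_levelE[OF s]) (rule that; assumption)
  obtain a0 b0 where e0: "e0 = {a0, b0}" "a0 \<noteq> b0"
    using edge_setD(2)[OF senderD(1)[OF s] senderD(2)[OF s]] by (auto simp: card_2_iff)
  obtain a1 b1 where f0: "f0 = {a1, b1}" "a1 \<noteq> b1"
    using edge_setD(2)[OF senderD(1)[OF s] senderD(3)[OF s]] by (auto simp: card_2_iff)
  have ln: "l a0 = 0" "l b0 = 0" "l a1 = n" "l b1 = n" using l(2,3) e0(1) f0(1) by auto
  then have distinct: "a0 \<noteq> a1" "a0 \<noteq> b1" "b0 \<noteq> a1" "b0 \<noteq> b1" using n_bounds(1) by auto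
  \<comment> \<open>The codes \<open>(0, 0)\<close> and \<open>(0, 1)\<close> are reserved for the
    ends of \<open>f\<close>, hence the double successor. Private vertices of the sender at
    \<open>e\<close> are coded with first component \<open>Suc (code e)\<close>.\<close>
  define \<iota> :: "nat \<Rightarrow> nat" where "\<iota> z = prod_encode (0, Suc (Suc z))" for z
  have inj\<iota>: "inj \<iota>" by (simp add: inj_def \<iota>_def)
  define F' where "F' = (`) \<iota> ` F"
  define f :: "nat set" where "f = {prod_encode (0, 0), prod_encode (0, 1)}"
  have edge_F': "edge_set F'" unfolding F'_def by (rule edge_set_image[OF F(1)]) (rule inj_on_subset[OF inj\<iota> subset_UNIV])
  have UF': "\<Union>F' \<subseteq> range \<iota>" by (auto simp: F'_def)
  obtain code :: "nat set \<Rightarrow> nat" where code: "inj_on code F'"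
    using finite_imp_inj_to_nat_seg[OF edge_setD(1)[OF edge_F']] by metis
  \<comment> \<open>An arbitrary orientation of each edge is chosen: only the colours of edges
    matter, so a sender may be attached either way round.\<close>
  have "\<forall>e\<in>F'. \<exists>x y. e = {x, y} \<and> x \<noteq> y" using edge_setD(2)[OF edge_F'] by (simp add: card_2_iff)
  then obtain \<alpha> \<omega> where ends: "\<And>e. e \<in> F' \<Longrightarrow> e = {\<alpha> e, \<omega> e} \<and> \<alpha> e \<noteq> \<omega> e" by metis
  have ends_\<iota>: "\<alpha> e \<in> range \<iota>" "\<omega> e \<in> range \<iota>" if "e \<in> F'" for e
    using ends[OF that] UF' that by blast+
  define \<phi> where "\<phi> e x = (if x = a0 then \<alpha> e else if x = b0 then \<omega> e else if x = a1 then prod_encode (0, 0)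
    else if x = b1 then prod_encode (0, 1) else prod_encode (Suc (code e), x))" for e x
  have \<phi>_simps: "\<phi> e a0 = \<alpha> e" "\<phi> e b0 = \<omega> e" "\<phi> e a1 = prod_encode (0, 0)" "\<phi> e b1 = prod_encode (0, 1)" for e
    using e0(2) f0(2) distinct by (simp_all add: \<phi>_def)
  define T where "T e = (`) (\<phi> e) ` E" for e
  have UT: "\<Union>(T e) = \<phi> e ` \<Union>E" for e unfolding T_def by blast
  have \<iota>_ne: "prod_encode (0, 0) \<notin> range \<iota>" "prod_encode (0, 1) \<notin> range \<iota>"
      "prod_encode (Suc d, x) \<notin> range \<iota>" for d x
    by (auto simp: \<iota>_def)
  have \<phi>_\<iota>: "x = a0 \<or> x = b0" if "\<phi> e x \<in> range \<iota>" for e x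
    using that \<iota>_ne by (auto simp: \<phi>_def split: if_splits)
  have inj\<phi>: "inj_on (\<phi> e) B" if e: "e \<in> F'" for e B
  proof (rule inj_onI)
    fix x y assume eq: "\<phi> e x = \<phi> e y"
    show "x = y"
    proof (cases "\<phi> e x \<in> range \<iota>")
      case True
      then have "x = a0 \<or> x = b0" "y = a0 \<or> y = b0" using \<phi>_\<iota> eq by metis+
      then show ?thesis using eq ends[OF e] by (auto simp: \<phi>_simps)
    next
      case False
      then have "x \<noteq> a0 \<and> x \<noteq> b0" "y \<noteq> a0 \<and> y \<noteq> b0" using eq ends_\<iota>[OF e] \<phi>_simps by metis+
      then show ?thesis using eq by (auto simp: \<phi>_def split: if_splits)
    qed
  qed
  have \<phi>_e0: "\<phi> e ` e0 = e" if "e \<in> F'" for e using ends[OF that] by (simp add: e0(1) \<phi>_simps)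
  have \<phi>_f0: "\<phi> e ` f0 = f" for e by (simp add: f0(1) \<phi>_simps f_def)
  define lev where "lev z = (case prod_decode z of (0, y) \<Rightarrow> if y < 2 then n else 0 | (Suc d, x) \<Rightarrow> l x)" for z
  have lev_\<iota>: "lev z = 0" if "z \<in> range \<iota>" for z using that by (auto simp: lev_def \<iota>_def)
  have lev_\<phi>: "lev (\<phi> e x) = l x" if e: "e \<in> F'" for e x
  proof -
    consider "x = a0 \<or> x = b0" | "x = a1 \<or> x = b1" | "x \<notin> {a0, b0, a1, b1}" by blast
    then show ?thesis
    proof cases
      case 1
      then show ?thesis using lev_\<iota> ends_\<iota>[OF e] ln(1,2) \<phi>_simps by auto
    next
      case 2
      then show ?thesis using ln(3,4) \<phi>_simps by (auto simp: lev_def)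
    next
      case 3
      then show ?thesis by (simp add: lev_def \<phi>_def)
    qed
  qed
  have meet_F: "\<Union>(T e) \<inter> \<Union>F' \<subseteq> e" if e: "e \<in> F'" for e
  proof
    fix z assume z: "z \<in> \<Union>(T e) \<inter> \<Union>F'"
    then obtain x where x: "z = \<phi> e x" unfolding UT by blast
    then have "x = a0 \<or> x = b0" using \<phi>_\<iota> z UF' by blast
    then have "z = \<alpha> e \<or> z = \<omega> e" using x \<phi>_simps by auto
    then show "z \<in> e" using ends[OF e] by blast
  qed
  interpret sender_system H "Suc r" r n F' T f lev
  proof unfold_locales
    show "edge_set (T e)" if "e \<in> F'" for e
      unfolding T_def by (rule edge_set_image[OF senderD(1)[OF s] inj\<phi>[OF that]])
    show "card f = 2" by (simp add: f_def)
    show "e \<in> T e" if "e \<in> F'" for e using \<phi>_e0[OF that] senderD(2)[OF s] unfolding T_def by (metis imageI)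
    show "f \<in> T e" for e using \<phi>_f0 senderD(3)[OF s] unfolding T_def by (metis imageI)
    show "\<Union>(T e) \<inter> \<Union>(T e') \<subseteq> f \<union> (e \<inter> e')" if e: "e \<in> F'" "e' \<in> F'" "e \<noteq> e'" for e e'
    proof
      fix z assume z: "z \<in> \<Union>(T e) \<inter> \<Union>(T e')"
      then obtain x y where xy: "z = \<phi> e x" "z = \<phi> e' y" unfolding UT by blast
      have ne: "code e \<noteq> code e'" using e code by (auto simp: inj_on_def)
      consider "x \<in> {a0, b0}" | "x \<in> {a1, b1}" | "x \<notin> {a0, b0, a1, b1}" by blast
      then show "z \<in> f \<union> (e \<inter> e')"
      proof cases
        case 1
        then have "z = \<alpha> e \<or> z = \<omega> e" using xy(1) \<phi>_simps by auto
        then have "z \<in> e" using ends[OF e(1)] by blast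
        then have "z \<in> e'" using meet_F[OF e(2)] z e(1) by blast
        then show ?thesis using \<open>z \<in> e\<close> by blast
      next
        case 2
        then show ?thesis using xy(1) \<phi>_f0[of e] f0(1) by blast
      next
        case 3
        then have zc: "z = prod_encode (Suc (code e), x)" using xy(1) by (simp add: \<phi>_def)
        then have "z \<notin> range \<iota>" using \<iota>_ne by simp
        then have "y \<noteq> a0" "y \<noteq> b0" using xy(2) ends_\<iota>[OF e(2)] \<phi>_simps by metis+
        then have False using zc xy(2) ne by (auto simp: \<phi>_def split: if_splits)
        then show ?thesis ..
      qed
    qed
    show "lev x \<le> Suc (lev y)" if e: "e \<in> F'" "g \<in> T e" "x \<in> g" "y \<in> g" for e g x y
    proof -
      obtain g0 where g0: "g0 \<in> E" "g = \<phi> e ` g0" using e(2) unfolding T_def by blast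
      then obtain x' y' where "x' \<in> g0" "y' \<in> g0" "x = \<phi> e x'" "y = \<phi> e y'" using e(3,4) by blast
      then show ?thesis using l(1)[OF g0(1)] lev_\<phi>[OF e(1)] by simp
    qed
    show "lev x = 0" if "x \<in> \<Union>F'" for x by (rule lev_\<iota>[OF subsetD[OF UF' that]])
    show "lev x = n" if "x \<in> f" for x using that by (auto simp: f_def lev_def)
    show "\<exists>c. good H (Suc r) (T e) c" if e: "e \<in> F'" for e
    proof -
      obtain c where "good H (Suc r) E c" using senderD(4)[OF s] by blast
      from good_pushforward[OF this inj\<phi>[OF e]] show ?thesis unfolding T_def by metis
    qed
    show "c e \<noteq> c f" if e: "e \<in> F'" "good H (Suc r) (T e) c" for e c
      using senderD(5)[OF s good_pullback[OF e(2)[unfolded T_def] inj\<phi>[OF e(1)]]] \<phi>_e0[OF e(1)] \<phi>_f0 by simp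
    show "\<not> (\<exists>c. good H r F' c)"
      using F(2) good_pullback[of r \<iota> F] inj_on_subset[OF inj\<iota> subset_UNIV] unfolding F'_def by blast
    show "\<exists>c. good H r (F' - {e}) c" if e: "e \<in> F'" for e
    proof -
      obtain e' where e': "e' \<in> F" "e = \<iota> ` e'" using e unfolding F'_def by blast
      obtain c where "good H r (F - {e'}) c" using F(3)[OF e'(1)] by blast
      then obtain c' where "good H r ((`) \<iota> ` (F - {e'})) c'"
        using good_pushforward inj_on_subset[OF inj\<iota> subset_UNIV] by metis
      then have "good H r (F' - {e}) c'" by (rule good_subset) (auto simp: F'_def e'(2))
      then show ?thesis by blast
    qed
  qed (use edge_F' meet_F n_bounds r in simp_all)
  show ?thesis
  proof (rule that[of G \<iota>])
    show "(`) \<iota> ` F \<subseteq> G" unfolding F'_def[symmetric] by (simp add: G_def)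
    show "g \<in> (`) \<iota> ` F" if "g \<in> G" "g \<subseteq> \<Union>((`) \<iota> ` F)" for g
      using induced_F that unfolding F'_def by blast
    show "(`) \<iota> ` F \<subseteq> E' \<and> N \<le> card (\<Union>E')" if E': "E' \<subseteq> G" "\<not> (\<exists>c. good H (Suc r) E' c)" for E'
      using bad_subset_contains_F[OF E'] bad_subset_large[OF E'] n_bounds(3) unfolding F'_def by simp
  qed (use edge_G inj\<iota> G_bad in blast)+
qed

text \<open>Links the subgraph formulation with edge sets: a copy \<open>K\<close> becomes the
  subgraph with vertex set \<open>\<Union>K\<close>, and conversely a subgraph isomorphic to
  \<open>H\<close> contains the image of \<open>edges H\<close>.\<close>

lemma ramsey_iff:
  fixes G :: "'b graph"
  assumes G: "fin_simple_graph G"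
  shows "ramsey q H G \<longleftrightarrow> \<not> (\<exists>c. good H q (edges G) c)"
proof
  assume R: "ramsey q H G"
  show "\<not> (\<exists>c. good H q (edges G) c)"
  proof
    assume "\<exists>c. good H q (edges G) c"
    then obtain c where c: "good H q (edges G) c" by blast
    then have "c \<in> edges G \<rightarrow> {1..q}" using goodD(1) by blast
    then obtain H' i where H': "subgraph H' G" "isomorphic H H'" "\<forall>e\<in>edges H'. c e = i"
      using R unfolding ramsey_def by blast
    obtain h where h: "bij_betw h (vertices H) (vertices H')"
      "\<And>u v. u \<in> vertices H \<Longrightarrow> v \<in> vertices H \<Longrightarrow> {u, v} \<in> edges H \<longleftrightarrow> {h u, h v} \<in> edges H'"
      using H'(2) unfolding isomorphic_def by blast
    have sub: "h ` e \<in> edges H'" if e: "e \<in> edges H" for e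
    proof -
      have "e \<subseteq> vertices H" "card e = 2" using simple e by (auto simp: fin_simple_graph_def)
      then obtain u v where "e = {u, v}" "u \<in> vertices H" "v \<in> vertices H" by (auto simp: card_2_iff)
      then show ?thesis using h(2)[of u v] e by simp
    qed
    then have "(`) h ` edges H \<subseteq> edges H'" by blast
    moreover have "edges H' \<subseteq> edges G" using H'(1) by (simp add: subgraph_def)
    moreover have "(`) h ` edges H \<in> copies H" using h(1) unfolding copies_def bij_betw_def by blast
    ultimately show False using goodD(2)[OF c, of "(`) h ` edges H" i] H'(3) by blast
  qed
next
  assume bad: "\<not> (\<exists>c. good H q (edges G) c)"
  show "ramsey q H G"
    unfolding ramsey_def
  proof
    fix c assume c: "c \<in> edges G \<rightarrow> {1..q}"
    then have cq: "c ` edges G \<subseteq> {1..q}" by blast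
    have "\<not> good H q (edges G) c" using bad by blast
    then obtain K i where K: "K \<in> copies H" "K \<subseteq> edges G" "\<forall>e\<in>K. c e = i"
      unfolding good_def using cq by blast
    obtain h where h: "inj_on h (vertices H)" "K = (`) h ` edges H" "\<Union>K = h ` vertices H"
      using K(1) by (rule copyE)
    let ?H = "Graph (\<Union>K) K"
    have "\<Union>K \<subseteq> vertices G" using K(2) G by (auto simp: fin_simple_graph_def)
    then have "subgraph ?H G"
      using K(2) copy_finite(2)[OF K(1)] copy_card_edge[OF K(1)] by (auto simp: subgraph_def fin_simple_graph_def)
    moreover have "isomorphic H ?H"
      unfolding isomorphic_def
    proof (intro exI[of _ h] conjI ballI)
      show "bij_betw h (vertices H) (vertices ?H)" using h(1,3) by (simp add: bij_betw_def)
      fix u v assume uv: "u \<in> vertices H" "v \<in> vertices H"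
      show "{u, v} \<in> edges H \<longleftrightarrow> {h u, h v} \<in> edges ?H"
      proof
        assume "{u, v} \<in> edges H"
        then have "h ` {u, v} \<in> K" unfolding h(2) by (rule imageI)
        then show "{h u, h v} \<in> edges ?H" by simp
      next
        assume "{h u, h v} \<in> edges ?H"
        then obtain e where e: "e \<in> edges H" "h ` e = h ` {u, v}" using h(2) by auto
        have "e \<subseteq> vertices H" using e(1) simple by (auto simp: fin_simple_graph_def)
        then have "e = {u, v}" using e(2) inj_on_image_eq_iff[OF h(1), of e "{u, v}"] uv by simp
        then show "{u, v} \<in> edges H" using e(1) by simp
      qed
    qed
    \<comment> \<open>The common value is a colour because a copy has at least one edge.\<close>
    moreover have "i \<in> {1..q}"
    proof -
      obtain e where e: "e \<in> K" using copy_two_edges[OF K(1)] by blast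
      have "c e \<in> {1..q}" by (rule subsetD[OF cq imageI[OF subsetD[OF K(2) e]]])
      then show ?thesis using bspec[OF K(3) e] by simp
    qed
    ultimately show "\<exists>H'. subgraph H' G \<and> isomorphic H H' \<and> (\<exists>i\<in>{1..q}. \<forall>e\<in>edges H'. c e = i)"
      using K(3) by (intro exI[of _ ?H]) auto
  qed
qed

section \<open>Ramsey-minimality in terms of edges\<close>

lemma edge_set_edges: "fin_simple_graph G \<Longrightarrow> edge_set (edges G)"
  unfolding fin_simple_graph_def edge_set_def
  by (metis Pow_iff finite_Pow_iff finite_subset subsetI)

text \<open>By \<open>ramsey_iff\<close> only the edges decide whether a graph is Ramsey. Hence a
  minimal graph has no isolated vertices, as removing them would give a smaller Ramsey
  graph.\<close>

lemma ramsey_minimalD: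
  fixes F :: "'b graph"
  assumes "F \<in> ramsey_minimal q H"
  shows "fin_simple_graph F" "edge_set (edges F)" "\<Union>(edges F) = vertices F"
    "\<not> (\<exists>c. good H q (edges F) c)" "e \<in> edges F \<Longrightarrow> \<exists>c. good H q (edges F - {e}) c"
proof -
  have F: "fin_simple_graph F" "ramsey q H F" "\<And>G. proper_subgraph G F \<Longrightarrow> \<not> ramsey q H G"
    using assms by (auto simp: ramsey_minimal_def)
  show "fin_simple_graph F" by (rule F(1))
  show edge: "edge_set (edges F)" by (rule edge_set_edges[OF F(1)])
  show bad: "\<not> (\<exists>c. good H q (edges F) c)" using ramsey_iff[OF F(1)] F(2) by simp
  have sub: "\<Union>(edges F) \<subseteq> vertices F" using F(1) by (auto simp: fin_simple_graph_def)
  show "\<Union>(edges F) = vertices F"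
  proof (rule ccontr)
    assume ne: "\<not> ?thesis"
    let ?G = "Graph (\<Union>(edges F)) (edges F)"
    have G: "fin_simple_graph ?G"
      using edge_setD(2,4)[OF edge] by (auto simp: fin_simple_graph_def)
    have "?G \<noteq> F" using ne by (metis graph.sel(1))
    then have "proper_subgraph ?G F" using G sub by (simp add: proper_subgraph_def subgraph_def)
    then show False using F(3) ramsey_iff[OF G] bad by auto
  qed
  show "\<exists>c. good H q (edges F - {e}) c" if e: "e \<in> edges F"
  proof -
    let ?G = "Graph (vertices F) (edges F - {e})"
    have G: "fin_simple_graph ?G" using F(1) by (auto simp: fin_simple_graph_def)
    have "?G \<noteq> F" using e by (metis DiffD2 graph.sel(2) singletonI)
    then have "proper_subgraph ?G F" using G by (auto simp: proper_subgraph_def subgraph_def)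
    then show ?thesis using F(3) ramsey_iff[OF G] by auto
  qed
qed

lemma ramsey_minimalI:
  fixes E :: "'b set set"
  assumes E: "edge_set E" "\<not> (\<exists>c. good H q E c)" "\<And>e. e \<in> E \<Longrightarrow> \<exists>c. good H q (E - {e}) c"
  shows "Graph (\<Union>E) E \<in> ramsey_minimal q H"
proof -
  have G: "fin_simple_graph (Graph (\<Union>E) E)"
    using edge_setD(2,4)[OF E(1)] by (auto simp: fin_simple_graph_def)
  have "\<not> ramsey q H G'" if G': "proper_subgraph G' (Graph (\<Union>E) E)" for G'
  proof -
    have G's: "fin_simple_graph G'" "vertices G' \<subseteq> \<Union>E" "edges G' \<subseteq> E" "G' \<noteq> Graph (\<Union>E) E"
      using G' by (auto simp: proper_subgraph_def subgraph_def)
    have "edges G' \<noteq> E"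
    proof
      assume "edges G' = E"
      moreover from this have "vertices G' = \<Union>E" using G's(1,2) by (auto simp: fin_simple_graph_def)
      ultimately show False using G's(4) by (metis graph.collapse)
    qed
    then obtain e where "e \<in> E" "edges G' \<subseteq> E - {e}" using G's(3) by blast
    then have "\<exists>c. good H q (edges G') c" using E(3) good_subset by metis
    then show ?thesis using ramsey_iff[OF G's(1)] by simp
  qed
  then show ?thesis using ramsey_iff[OF G] E(2) G by (simp add: ramsey_minimal_def)
qed

end

section \<open>Induced embeddings and the passage to more colours\<close>

definition embeds :: "'a graph \<Rightarrow> 'b graph \<Rightarrow> bool" where
  "embeds F G \<longleftrightarrow> (\<exists>f. inj_on f (vertices F) \<and> f ` vertices F \<subseteq> vertices G \<and>
     (\<forall>u\<in>vertices F. \<forall>v\<in>vertices F. {u, v} \<in> edges F \<longleftrightarrow> {f u, f v} \<in> edges G))"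

lemma embedsE:
  assumes "embeds F G"
  obtains f where "inj_on f (vertices F)" "f ` vertices F \<subseteq> vertices G"
    "\<And>u v. u \<in> vertices F \<Longrightarrow> v \<in> vertices F \<Longrightarrow> {u, v} \<in> edges F \<longleftrightarrow> {f u, f v} \<in> edges G"
  using assms unfolding embeds_def by (elim exE conjE) (rule that; simp)

text \<open>Composability is the reason for working with embeddings: the iteration over the colours
  produces a chain of graphs, each induced in the next.\<close>

lemma embeds_trans:
  assumes "embeds F G" "embeds G G'"
  shows "embeds F G'"
proof -
  obtain f where f: "inj_on f (vertices F)" "f ` vertices F \<subseteq> vertices G"
    "\<And>u v. u \<in> vertices F \<Longrightarrow> v \<in> vertices F \<Longrightarrow> {u, v} \<in> edges F \<longleftrightarrow> {f u, f v} \<in> edges G"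
    by (rule embedsE[OF assms(1)]) (rule that; assumption)
  obtain g where g: "inj_on g (vertices G)" "g ` vertices G \<subseteq> vertices G'"
    "\<And>u v. u \<in> vertices G \<Longrightarrow> v \<in> vertices G \<Longrightarrow> {u, v} \<in> edges G \<longleftrightarrow> {g u, g v} \<in> edges G'"
    by (rule embedsE[OF assms(2)]) (rule that; assumption)
  show ?thesis
    unfolding embeds_def
  proof (intro exI[of _ "g \<circ> f"] conjI ballI)
    show "inj_on (g \<circ> f) (vertices F)" using comp_inj_on[OF f(1) inj_on_subset[OF g(1) f(2)]] .
    show "(g \<circ> f) ` vertices F \<subseteq> vertices G'" using f(2) g(2) by auto
    fix u v assume "u \<in> vertices F" "v \<in> vertices F"
    then show "{u, v} \<in> edges F \<longleftrightarrow> {(g \<circ> f) u, (g \<circ> f) v} \<in> edges G'"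
      using f(2) f(3)[of u v] g(3)[of "f u" "f v"] by auto
  qed
qed

lemma embeds_induced:
  assumes "embeds F G"
  shows "\<exists>F'. induced_subgraph F' G \<and> isomorphic F F'"
proof -
  obtain f where f: "inj_on f (vertices F)" "f ` vertices F \<subseteq> vertices G"
    "\<And>u v. u \<in> vertices F \<Longrightarrow> v \<in> vertices F \<Longrightarrow> {u, v} \<in> edges F \<longleftrightarrow> {f u, f v} \<in> edges G"
    by (rule embedsE[OF assms]) (rule that; assumption)
  let ?F = "induced G (f ` vertices F)"
  have "induced_subgraph ?F G" using f(2) unfolding induced_subgraph_def by blast
  moreover have "isomorphic F ?F"
    unfolding isomorphic_def using f by (intro exI[of _ f]) (auto simp: induced_def bij_betw_def)
  ultimately show ?thesis by blast
qed

context inseparable_graph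
begin

text \<open>Passing to a minimal bad subgraph of \<open>G\<close> keeps \<open>F\<close> induced:
  all edges of \<open>F\<close> survive by the last clause of \<open>sender_extension\<close>, and
  between the vertices of \<open>F\<close> there were no others in \<open>G\<close>.\<close>

lemma ramsey_minimal_extension:
  fixes F :: "'b graph"
  assumes F: "F \<in> ramsey_minimal r H" and r: "2 \<le> r"
  shows "\<exists>G :: nat graph. G \<in> ramsey_minimal (Suc r) H \<and> N \<le> card (vertices G) \<and> embeds F G"
proof -
  note F = ramsey_minimalD[OF F]
  have "finite (vertices F)" using F(1) by (simp add: fin_simple_graph_def)
  from finite_imp_inj_to_nat_seg[OF this] obtain j :: "'b \<Rightarrow> nat" where j: "inj_on j (vertices F)" by metis
  then have jU: "inj_on j (\<Union>(edges F))" by (simp add: F(3))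
  let ?F = "(`) j ` edges F"
  have minimal: "\<exists>c. good H r (?F - {e}) c" if e: "e \<in> ?F" for e
  proof -
    obtain e' where e': "e' \<in> edges F" "e = j ` e'" using e by blast
    obtain c where c: "good H r (edges F - {e'}) c" using F(5)[OF e'(1)] by blast
    have "inj_on j (\<Union>(edges F - {e'}))" by (rule inj_on_subset[OF jU]) blast
    from good_pushforward[OF c this] obtain c' where "good H r ((`) j ` (edges F - {e'})) c'" by metis
    then have "good H r (?F - {e}) c'" by (rule good_subset) (auto simp: e'(2))
    then show ?thesis by blast
  qed
  have bad: "\<not> (\<exists>c. good H r ?F c)" using F(4) good_pullback[OF _ jU] by blast
  obtain G :: "nat set set" and \<iota> :: "nat \<Rightarrow> nat" where
    G: "edge_set G" "inj \<iota>" "(`) \<iota> ` ?F \<subseteq> G" "\<And>g. g \<in> G \<Longrightarrow> g \<subseteq> \<Union>((`) \<iota> ` ?F) \<Longrightarrow> g \<in> (`) \<iota> ` ?F"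
    "\<not> (\<exists>c. good H (Suc r) G c)"
    "\<And>E'. E' \<subseteq> G \<Longrightarrow> \<not> (\<exists>c. good H (Suc r) E' c) \<Longrightarrow> (`) \<iota> ` ?F \<subseteq> E' \<and> N \<le> card (\<Union>E')"
    by (rule sender_extension[OF edge_set_image[OF F(2) jU] bad minimal r, where N = N])
      (assumption, (rule that; assumption))
  obtain E' where E': "E' \<subseteq> G" "\<not> (\<exists>c. good H (Suc r) E' c)" "\<And>e. e \<in> E' \<Longrightarrow> \<exists>c. good H (Suc r) (E' - {e}) c"
    by (rule minimal_not_good[OF edge_setD(1)[OF G(1)] G(5)]) (rule that; assumption)
  let ?G = "Graph (\<Union>E') E'" and ?f = "\<iota> \<circ> j"
  have img: "(`) \<iota> ` ?F = (`) ?f ` edges F" by (simp add: image_image image_comp)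
  have sub: "(`) ?f ` edges F \<subseteq> E'" and N: "N \<le> card (\<Union>E')" using G(6)[OF E'(1,2)] img by auto
  have inj: "inj_on ?f (vertices F)" by (rule comp_inj_on[OF j inj_on_subset[OF G(2) subset_UNIV]])
  have U: "\<Union>((`) ?f ` edges F) = ?f ` vertices F" unfolding F(3)[symmetric] by blast
  have "embeds F ?G"
    unfolding embeds_def
  proof (intro exI[of _ ?f] conjI ballI)
    show "inj_on ?f (vertices F)" by (rule inj)
    show "?f ` vertices F \<subseteq> vertices ?G" using Union_mono[OF sub] U by simp
    fix u v assume uv: "u \<in> vertices F" "v \<in> vertices F"
    show "{u, v} \<in> edges F \<longleftrightarrow> {?f u, ?f v} \<in> edges ?G"
    proof
      assume "{u, v} \<in> edges F"
      then have "?f ` {u, v} \<in> (`) ?f ` edges F" by (rule imageI)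
      then show "{?f u, ?f v} \<in> edges ?G" using sub by auto
    next
      assume "{?f u, ?f v} \<in> edges ?G"
      then have "{?f u, ?f v} \<in> G" using E'(1) by auto
      moreover have "{?f u, ?f v} \<subseteq> \<Union>((`) ?f ` edges F)" unfolding U using uv by blast
      ultimately have "{?f u, ?f v} \<in> (`) ?f ` edges F" using G(4) unfolding img by blast
      then obtain e where e: "e \<in> edges F" "?f ` e = ?f ` {u, v}" by auto
      have "e \<subseteq> vertices F" using e(1) F(3) by blast
      then have "e = {u, v}" using e(2) inj_on_image_eq_iff[OF inj, of e "{u, v}"] uv by simp
      then show "{u, v} \<in> edges F" using e(1) by simp
    qed
  qed
  moreover have "?G \<in> ramsey_minimal (Suc r) H"
    by (rule ramsey_minimalI[OF edge_set_subset[OF G(1) E'(1)] E'(2,3)])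
  ultimately show ?thesis using N by (intro exI[of _ ?G]) simp
qed

lemma ramsey_minimal_extension_iterated:
  fixes F :: "'b graph"
  assumes "F \<in> ramsey_minimal r H" "2 \<le> r" "r < q"
  shows "\<exists>G :: nat graph. G \<in> ramsey_minimal q H \<and> N \<le> card (vertices G) \<and> embeds F G"
proof -
  from assms(3) have "Suc r \<le> q" by simp
  then show ?thesis
  proof (induction q rule: dec_induct)
    case base
    show ?case by (rule ramsey_minimal_extension[OF assms(1,2)])
  next
    case (step m)
    then obtain G :: "nat graph" where G: "G \<in> ramsey_minimal m H" "embeds F G" by blast
    have "2 \<le> m" using assms(2) step.hyps by simp
    from ramsey_minimal_extension[OF G(1) this, of N] show ?case using embeds_trans[OF G(2)] by blast
  qed
qed

end

text \<open>Suppose \<open>u\<close> is outside \<open>P\<close> and \<open>w\<close> outside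
  \<open>Q\<close>. In the triangle the edge between them lies in neither set. If \<open>H\<close>
  is 3-connected, a path from \<open>u\<close> to \<open>w\<close> avoids
  \<open>P \<inter> Q\<close>; each of its edges that starts outside \<open>P\<close> lies in
  \<open>Q\<close>, so it ends outside \<open>P\<close> again. Thus \<open>w\<close> would lie in
  neither set, although it is on an edge.\<close>

lemma inseparable_graphI:
  assumes H: "fin_simple_graph H" and "k_connected 3 H \<or> isomorphic H (complete_graph 3)"
  shows "inseparable_graph H"
proof -
  have V: "\<Union>(edges H) = vertices H \<and> 3 \<le> card (vertices H) \<and>
      (\<forall>P Q. (\<forall>e\<in>edges H. e \<subseteq> P \<or> e \<subseteq> Q) \<longrightarrow> card (P \<inter> Q \<inter> vertices H) \<le> 2 \<longrightarrow>
        vertices H \<subseteq> P \<or> vertices H \<subseteq> Q)"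
    using assms(2)
  proof
    assume k: "k_connected 3 H"
    then have c4: "3 < card (vertices H)"
      and conn: "\<And>S. S \<subseteq> vertices H \<Longrightarrow> card S < 3 \<Longrightarrow> connected_graph (induced H (vertices H - S))"
      by (auto simp: k_connected_def)
    have "vertices H \<subseteq> \<Union>(edges H)"
    proof
      fix u assume u: "u \<in> vertices H"
      have "vertices H \<noteq> {u}" using c4 by auto
      then obtain w where w: "w \<in> vertices H" "w \<noteq> u" using u by blast
      have "(u, w) \<in> {(x, y). {x, y} \<in> edges (induced H (vertices H - {}))}\<^sup>*"
        using conn[of "{}"] u w by (auto simp: connected_graph_def induced_def)
      then obtain y where "{u, y} \<in> edges H"
        using w(2) by (cases rule: converse_rtranclE) (auto simp: induced_def)
      then show "u \<in> \<Union>(edges H)" by blast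
    qed
    moreover have "\<Union>(edges H) \<subseteq> vertices H" using H by (auto simp: fin_simple_graph_def)
    ultimately have U: "\<Union>(edges H) = vertices H" by blast
    have "vertices H \<subseteq> P \<or> vertices H \<subseteq> Q"
      if PQ: "\<forall>e\<in>edges H. e \<subseteq> P \<or> e \<subseteq> Q" "card (P \<inter> Q \<inter> vertices H) \<le> 2" for P Q
    proof (rule ccontr)
      assume "\<not> ?thesis"
      then obtain u w where uw: "u \<in> vertices H" "u \<notin> P" "w \<in> vertices H" "w \<notin> Q" by blast
      let ?S = "P \<inter> Q \<inter> vertices H"
      let ?H = "induced H (vertices H - ?S)"
      have "connected_graph ?H" using conn[of ?S] PQ(2) by simp
      then have path: "(u, w) \<in> {(x, y). {x, y} \<in> edges ?H}\<^sup>*"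
        using uw unfolding connected_graph_def by (simp add: induced_def)
      then have "w \<notin> P"
      proof (induction rule: rtrancl_induct)
        case (step x y)
        then have "{x, y} \<in> edges H" "{x, y} \<subseteq> vertices H - ?S" by (auto simp: induced_def)
        moreover from bspec[OF PQ(1) this(1)] have "y \<in> Q" using step.IH by simp
        ultimately show ?case by auto
      qed (rule uw)
      moreover have "w \<in> P \<union> Q" using uw(3) PQ(1) U by blast
      ultimately show False using uw(4) by blast
    qed
    then show ?thesis using U c4 by auto
  next
    assume "isomorphic H (complete_graph 3)"
    then obtain h :: "'a \<Rightarrow> nat" where h: "bij_betw h (vertices H) {1..3}"
      "\<And>u v. u \<in> vertices H \<Longrightarrow> v \<in> vertices H \<Longrightarrow>
        {u, v} \<in> edges H \<longleftrightarrow> {h u, h v} \<subseteq> {1..3} \<and> card {h u, h v} = 2"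
      unfolding isomorphic_def complete_graph_def graph.sel mem_Collect_eq
      by (elim exE conjE) (rule that; simp)
    have c3: "card (vertices H) = 3" using bij_betw_same_card[OF h(1)] by simp
    have adj: "{u, v} \<in> edges H" if "u \<in> vertices H" "v \<in> vertices H" "u \<noteq> v" for u v
    proof -
      have "h u \<noteq> h v" "h u \<in> {1..3}" "h v \<in> {1..3}" using h(1) that by (auto simp: bij_betw_def inj_on_def)
      then show ?thesis using h(2) that by simp
    qed
    have "vertices H \<subseteq> \<Union>(edges H)"
    proof
      fix u assume u: "u \<in> vertices H"
      have "vertices H \<noteq> {u}" using c3 by auto
      then obtain w where "w \<in> vertices H" "w \<noteq> u" using u by blast
      then show "u \<in> \<Union>(edges H)" using adj[OF u] by blast
    qed
    moreover have "\<Union>(edges H) \<subseteq> vertices H" using H by (auto simp: fin_simple_graph_def)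
    ultimately have U: "\<Union>(edges H) = vertices H" by blast
    have "vertices H \<subseteq> P \<or> vertices H \<subseteq> Q"
      if PQ: "\<forall>e\<in>edges H. e \<subseteq> P \<or> e \<subseteq> Q" for P Q
    proof (rule ccontr)
      assume "\<not> ?thesis"
      then obtain u w where uw: "u \<in> vertices H" "u \<notin> P" "w \<in> vertices H" "w \<notin> Q" by blast
      moreover have "u \<in> P \<union> Q" using uw(1) PQ U by blast
      ultimately have "u \<noteq> w" by blast
      then show False using adj[OF uw(1,3)] uw PQ by blast
    qed
    then show ?thesis using U c3 by auto
  qed
  then show ?thesis using H by unfold_locales auto
qed

theorem theorem1p1:
  fixes H :: "'a graph" and F :: "'b graph" and q r :: nat
  assumes "fin_simple_graph H"
    and "k_connected 3 H \<or> isomorphic H (complete_graph 3)"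
    and "q > r" and "r \<ge> 2"
    and "F \<in> ramsey_minimal r H"
  shows "\<exists>\<G> :: nat graph set.
           infinite \<G> \<and> \<G> \<subseteq> ramsey_minimal q H \<and>
           pairwise (\<lambda>G G'. \<not> isomorphic G G') \<G> \<and>
           (\<forall>G\<in>\<G>. \<exists>F'. induced_subgraph F' G \<and> isomorphic F F')"
proof -
  interpret inseparable_graph H by (rule inseparable_graphI[OF assms(1,2)])
  let ?A = "{G :: nat graph. G \<in> ramsey_minimal q H \<and> embeds F G}"
  let ?C = "(\<lambda>G. card (vertices G)) ` ?A"
  have "infinite ?C"
    unfolding infinite_nat_iff_unbounded_le
  proof
    fix N
    obtain G :: "nat graph" where "G \<in> ramsey_minimal q H" "N \<le> card (vertices G)" "embeds F G"
      using ramsey_minimal_extension_iterated[OF assms(5,4,3), of N] by blast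
    then show "\<exists>m\<ge>N. m \<in> ?C" by blast
  qed
  \<comment> \<open>One graph is selected for each number of vertices that occurs. Infinitely many
    numbers occur, and graphs of different orders are not isomorphic.\<close>
  obtain \<G> where \<G>: "\<G> \<subseteq> ?A" "inj_on (\<lambda>G. card (vertices G)) \<G>" "?C = (\<lambda>G. card (vertices G)) ` \<G>"
    using subset_image_inj[of ?C "\<lambda>G. card (vertices G)" ?A] by blast
  have "infinite \<G>" using \<open>infinite ?C\<close> \<G>(3) by auto
  moreover have "pairwise (\<lambda>G G'. \<not> isomorphic G G') \<G>"
    unfolding pairwise_def
  proof (intro ballI impI notI)
    fix G G' assume G: "G \<in> \<G>" "G' \<in> \<G>" "G \<noteq> G'" "isomorphic G G'"
    then have "card (vertices G) = card (vertices G')"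
      unfolding isomorphic_def using bij_betw_same_card by blast
    then show False using inj_onD[OF \<G>(2) _ G(1,2)] G(3) by blast
  qed
  ultimately show ?thesis using \<G>(1) embeds_induced by (intro exI[of _ \<G>]) blast
qed

end
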